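(* Let $k$ be a unital commutative ring, let $n$ be a natural number and let $\varepsilon\in k$ be invertible. Let $B\mathcal{R}_n(\varepsilon)$ be the braided rook algebra over $k$, and let $B_n$ be the braid group on $n$ strands. Then there exists an isomorphism of graded $k$-modules $$\mathrm{Tor}_{\star}^{B\mathcal{R}_n(\varepsilon)}(\mathbf{1},\mathbf{1})\cong \mathrm{Tor}_{\star}^{k[B_n]}(\mathbf{1},\mathbf{1})=H_{\star}(B_n,k).$$
   Context: A braided rook $n$-diagram consists of two columns (left and right) of $n$ nodes and a set of disjoint strands, each joining a left node to a right node, such that each node is the endpoint of at most one strand (nodes may be unconnected; there are no left-to-left and no right-to-right connections). Whenever two strands cross, the crossing is an over-crossing or an under-crossing. Strands run as in a braid, and diagrams are considered up to isotopy fixing endpoints, as for (partial) braids. The braided rook algebra $B\mathcal{R}_n(\varepsilon)$ consists of formal $k$-linear combinations of braided rook $n$-diagrams. The product $x\cdot y$ of two diagrams is the $k$-bilinear extension of: identify the right-hand nodes of $x$ with the left-hand nodes of $y$, forget the middle nodes, and multiply by a factor $\varepsilon$ for each contractible component lying entirely in the middle, i.e. for each middle node which is attached to no strand of $x$ and no strand of $y$. A strand which reaches the middle column and is not continued is discarded without a factor, leaving its outer node unconnected. The trivial module $\mathbf{1}$ of $B\mathcal{R}_n(\varepsilon)$ is a copy of $k$ (as a left and as a right module) on which diagrams with no missing edges act as $1$ and all other diagrams act as $0$. For the group algebra $k[B_n]$, $\mathbf{1}$ is $k$ with every group element acting as $1$. *)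

theory Defs
  imports "HOL-Analysis.Path_Connected" "HOL-Algebra.Module" "HOL-Algebra.AbelCoset"
begin

section \<open>Braided rook diagrams and the braid group\<close>

text \<open>
  Diagrams are described geometrically. The \<open>n\<close> nodes of a column are the points \<open>1, \<dots>, n\<close> of the
  complex plane. Parametrising a strand by its distance \<open>t \<in> [0,1]\<close> from the left column turns it
  into a path in the plane; as for braids, strands are monotone in \<open>t\<close>, and disjointness
  in \<open>[0,1] \<times> \<complex>\<close> means that at each time \<open>t\<close> the positions of the strands are distinct.
  Over- and under-crossings are those of the projection of \<open>[0,1] \<times> \<complex>\<close> along the imaginary axis.
  The map sends a left node to the strand starting there, if there is one. Only the values of a
  strand on \<open>[0,1]\<close> matter; other values are irrelevant up to isotopy.
\<close>

type_synonym strands = "nat \<rightharpoonup> (real \<Rightarrow> complex)"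

definition partial_braid :: "nat \<Rightarrow> strands \<Rightarrow> bool" where
  "partial_braid n f \<longleftrightarrow>
     dom f \<subseteq> {1..n} \<and>
     (\<forall>i p. f i = Some p \<longrightarrow>
        path p \<and> pathstart p = of_nat i \<and> pathfinish p \<in> of_nat ` {1..n}) \<and>
     (\<forall>i j p q. f i = Some p \<longrightarrow> f j = Some q \<longrightarrow> i \<noteq> j \<longrightarrow> (\<forall>t\<in>{0..1}. p t \<noteq> q t))"

text \<open>Isotopy fixing endpoints: a deformation of the strands through partial braids.\<close>

definition isotopy :: "nat \<Rightarrow> (strands \<times> strands) set" where
  "isotopy n = {(f, g). \<exists>H :: real \<Rightarrow> strands.
     (\<forall>s\<in>{0..1}. partial_braid n (H s) \<and> dom (H s) = dom f) \<and>
     (\<forall>i\<in>dom f. continuous_on ({0..1} \<times> {0..1}) (\<lambda>(s, t). the (H s i) t) \<and>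
        (\<forall>s\<in>{0..1}. pathfinish (the (H s i)) = pathfinish (the (f i)))) \<and>
     H 0 = f \<and> H 1 = g}"

type_synonym diagram = "strands set"

definition diagrams :: "nat \<Rightarrow> diagram set" where
  "diagrams n = {f. partial_braid n f} // isotopy n"

definition end_node :: "(real \<Rightarrow> complex) \<Rightarrow> nat" where
  "end_node p = (THE j. of_nat j = pathfinish p)"

definition concat_strands :: "strands \<Rightarrow> strands \<Rightarrow> strands" where
  "concat_strands f g = (\<lambda>i. case f i of None \<Rightarrow> None
     | Some p \<Rightarrow> (case g (end_node p) of None \<Rightarrow> None | Some q \<Rightarrow> Some (p +++ q)))"

definition concat_diagrams :: "nat \<Rightarrow> diagram \<Rightarrow> diagram \<Rightarrow> diagram" where
  "concat_diagrams n X Y = isotopy n `` {concat_strands f g |f g. f \<in> X \<and> g \<in> Y}"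

definition id_diagram :: "nat \<Rightarrow> diagram" where
  "id_diagram n = isotopy n `` {\<lambda>i. if i \<in> {1..n} then Some (\<lambda>t. of_nat i) else None}"

definition left_nodes :: "diagram \<Rightarrow> nat set" where
  "left_nodes X = (\<Union>f\<in>X. dom f)"

definition right_nodes :: "diagram \<Rightarrow> nat set" where
  "right_nodes X = (\<Union>f\<in>X. end_node ` ran f)"

text \<open>The number of middle nodes of \<open>X \<cdot> Y\<close> attached to no strand of \<open>X\<close> and no strand of \<open>Y\<close>.\<close>

definition isolated_middle :: "nat \<Rightarrow> diagram \<Rightarrow> diagram \<Rightarrow> nat" where
  "isolated_middle n X Y = card ({1..n} - (right_nodes X \<union> left_nodes Y))"

definition rook_monoid :: "nat \<Rightarrow> diagram monoid" where
  "rook_monoid n =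
     \<lparr>carrier = diagrams n, mult = concat_diagrams n, one = id_diagram n\<rparr>"

text \<open>
  Isotopy classes of braids with \<open>n\<close> strands, i.e. the diagrams without missing edges. This is Artin's
  braid group: the fundamental group of the space of \<open>n\<close>-element subsets of the plane.
\<close>

definition braid_group :: "nat \<Rightarrow> diagram monoid" where
  "braid_group n = (rook_monoid n)\<lparr>carrier := {X \<in> diagrams n. left_nodes X = {1..n}}\<rparr>"


section \<open>Free modules and algebras with a basis\<close>

text \<open>
  Modules over a ring \<open>A\<close>, on either side, are given by the record type \<^typ>\<open>('a, 'm) module\<close>, whose
  ring multiplication and unit are not used. For a right module \<open>M\<close> the term
  \<open>a \<odot>\<^bsub>M\<^esub> m\<close> stands for \<open>m \<cdot> a\<close>, so that
  \<open>(a \<otimes>\<^bsub>A\<^esub> b) \<odot>\<^bsub>M\<^esub> m = b \<odot>\<^bsub>M\<^esub> (a \<odot>\<^bsub>M\<^esub> m)\<close>.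
  For a \<open>K\<close>-algebra the same record type carries both the ring and the \<open>K\<close>-module structure.

  \<open>free_module A X\<close> is the free right \<open>A\<close>-module on \<open>X\<close>, consisting of finitely supported functions;
  for commutative \<open>A\<close> it is the module of formal \<open>A\<close>-linear combinations of elements of \<open>X\<close>.
\<close>

definition free_module :: "('a, 'r) ring_scheme \<Rightarrow> 'x set \<Rightarrow> ('a, 'x \<Rightarrow> 'a) module" where
  "free_module A X =
     \<lparr>carrier = {f. (\<forall>x\<in>X. f x \<in> carrier A) \<and> (\<forall>x. x \<notin> X \<longrightarrow> f x = \<zero>\<^bsub>A\<^esub>) \<and>
                    finite {x. f x \<noteq> \<zero>\<^bsub>A\<^esub>}},
      mult = undefined, one = undefined,
      zero = (\<lambda>x. \<zero>\<^bsub>A\<^esub>),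
      add = (\<lambda>f g x. f x \<oplus>\<^bsub>A\<^esub> g x),
      smult = (\<lambda>a f x. f x \<otimes>\<^bsub>A\<^esub> a)\<rparr>"

definition basis_vec :: "('a, 'r) ring_scheme \<Rightarrow> 'x \<Rightarrow> 'x \<Rightarrow> 'a" where
  "basis_vec A x = (\<lambda>y. if y = x then \<one>\<^bsub>A\<^esub> else \<zero>\<^bsub>A\<^esub>)"

text \<open>The \<open>A\<close>-linear map from a free module to \<open>M\<close> with values \<open>v x\<close> on the basis.\<close>

definition lin_ext ::
    "('a, 'r) ring_scheme \<Rightarrow> ('a, 'm) module \<Rightarrow> ('x \<Rightarrow> 'm) \<Rightarrow> ('x \<Rightarrow> 'a) \<Rightarrow> 'm" where
  "lin_ext A M v f = (\<Oplus>\<^bsub>M\<^esub>x\<in>{x. f x \<noteq> \<zero>\<^bsub>A\<^esub>}. f x \<odot>\<^bsub>M\<^esub> v x)"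

text \<open>The \<open>K\<close>-algebra with basis \<open>D\<close> and the bilinear product with \<open>x \<cdot> y = w x y (x \<otimes>\<^bsub>D\<^esub> y)\<close> for \<open>x, y \<in> D\<close>.\<close>

definition twisted_monoid_algebra ::
    "('k, 'r) ring_scheme \<Rightarrow> 'd monoid \<Rightarrow> ('d \<Rightarrow> 'd \<Rightarrow> 'k) \<Rightarrow> ('k, 'd \<Rightarrow> 'k) module" where
  "twisted_monoid_algebra K D w = (free_module K (carrier D))
     \<lparr>mult := (\<lambda>a b z. finsum K (\<lambda>(x, y). w x y \<otimes>\<^bsub>K\<^esub> (a x \<otimes>\<^bsub>K\<^esub> b y))
                 {(x, y). a x \<noteq> \<zero>\<^bsub>K\<^esub> \<and> b y \<noteq> \<zero>\<^bsub>K\<^esub> \<and> x \<otimes>\<^bsub>D\<^esub> y = z}),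
      one := basis_vec K \<one>\<^bsub>D\<^esub>\<rparr>"

definition group_algebra :: "('k, 'r) ring_scheme \<Rightarrow> 'g monoid \<Rightarrow> ('k, 'g \<Rightarrow> 'k) module" where
  "group_algebra K G = twisted_monoid_algebra K G (\<lambda>x y. \<one>\<^bsub>K\<^esub>)"

definition braided_rook_algebra ::
    "('k, 'r) ring_scheme \<Rightarrow> nat \<Rightarrow> 'k \<Rightarrow> ('k, diagram \<Rightarrow> 'k) module" where
  "braided_rook_algebra K n \<epsilon> =
     twisted_monoid_algebra K (rook_monoid n) (\<lambda>X Y. \<epsilon> [^]\<^bsub>K\<^esub> isolated_middle n X Y)"

text \<open>
  The module \<open>K\<close> over an algebra with a basis on which the basis elements in \<open>F\<close> act as \<open>1\<close> and the
  others as \<open>0\<close>. As \<open>K\<close> is commutative, it serves as a left and as a right module.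
\<close>

definition trivial_module :: "('k, 'r) ring_scheme \<Rightarrow> 'd set \<Rightarrow> ('d \<Rightarrow> 'k, 'k) module" where
  "trivial_module K F =
     \<lparr>carrier = carrier K, mult = undefined, one = undefined, zero = \<zero>\<^bsub>K\<^esub>, add = add K,
      smult = (\<lambda>a c. (\<Oplus>\<^bsub>K\<^esub>x\<in>{x \<in> F. a x \<noteq> \<zero>\<^bsub>K\<^esub>}. a x) \<otimes>\<^bsub>K\<^esub> c)\<rparr>"

definition rook_trivial :: "('k, 'r) ring_scheme \<Rightarrow> nat \<Rightarrow> (diagram \<Rightarrow> 'k, 'k) module" where
  "rook_trivial K n = trivial_module K {X \<in> diagrams n. left_nodes X = {1..n}}"

definition group_trivial :: "('k, 'r) ring_scheme \<Rightarrow> 'g monoid \<Rightarrow> ('g \<Rightarrow> 'k, 'k) module" where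
  "group_trivial K G = trivial_module K (carrier G)"


section \<open>Quotients, isomorphisms, homology\<close>

definition quotient_module :: "('a, 'm) module \<Rightarrow> 'm set \<Rightarrow> ('a, 'm set) module" where
  "quotient_module V W =
     \<lparr>carrier = a_rcosets\<^bsub>V\<^esub> W, mult = undefined, one = undefined,
      zero = W, add = set_add V,
      smult = (\<lambda>c U. set_add V W ((\<lambda>u. c \<odot>\<^bsub>V\<^esub> u) ` U))\<rparr>"

definition module_iso ::
    "('k, 'r) ring_scheme \<Rightarrow> ('k, 'v) module \<Rightarrow> ('k, 'w) module \<Rightarrow> ('v \<Rightarrow> 'w) \<Rightarrow> bool" where
  "module_iso K V W h \<longleftrightarrow>
     bij_betw h (carrier V) (carrier W) \<and>
     (\<forall>x\<in>carrier V. \<forall>y\<in>carrier V. h (x \<oplus>\<^bsub>V\<^esub> y) = h x \<oplus>\<^bsub>W\<^esub> h y) \<and>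
     (\<forall>c\<in>carrier K. \<forall>x\<in>carrier V. h (c \<odot>\<^bsub>V\<^esub> x) = c \<odot>\<^bsub>W\<^esub> h x)"

definition graded_isomorphic ::
    "('k, 'r) ring_scheme \<Rightarrow> (nat \<Rightarrow> ('k, 'v) module) \<Rightarrow> (nat \<Rightarrow> ('k, 'w) module) \<Rightarrow> bool" where
  "graded_isomorphic K V W \<longleftrightarrow> (\<exists>h. \<forall>i. module_iso K (V i) (W i) (h i))"

text \<open>In a chain complex \<open>C\<close>, the differential \<open>d i\<close> goes from \<open>C (Suc i)\<close> to \<open>C i\<close>.\<close>

fun cycles :: "(nat \<Rightarrow> ('k, 'v) module) \<Rightarrow> (nat \<Rightarrow> 'v \<Rightarrow> 'v) \<Rightarrow> nat \<Rightarrow> 'v set" where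
  "cycles C d 0 = carrier (C 0)"
| "cycles C d (Suc i) = {x \<in> carrier (C (Suc i)). d i x = \<zero>\<^bsub>C i\<^esub>}"

definition homology ::
    "(nat \<Rightarrow> ('k, 'v) module) \<Rightarrow> (nat \<Rightarrow> 'v \<Rightarrow> 'v) \<Rightarrow> nat \<Rightarrow> ('k, 'v set) module" where
  "homology C d i =
     quotient_module ((C i)\<lparr>carrier := cycles C d i\<rparr>) (d i ` carrier (C (Suc i)))"


section \<open>Tensor products\<close>

text \<open>
  For a \<open>K\<close>-algebra \<open>A\<close>, a right \<open>A\<close>-module \<open>M\<close> and a left \<open>A\<close>-module \<open>N\<close>, the \<open>K\<close>-module
  \<open>M \<otimes>\<^sub>A N\<close> is the quotient of the free \<open>K\<close>-module on \<open>M \<times> N\<close> by the submodule generated by the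
  relations below, in which \<open>c \<in> K\<close> acts on \<open>M\<close> as \<open>c \<cdot> 1\<^sub>A\<close>.
\<close>

definition tensor_free ::
    "('k, 'r) ring_scheme \<Rightarrow> ('a, 'm) module \<Rightarrow> ('a, 'n) module \<Rightarrow> ('k, 'm \<times> 'n \<Rightarrow> 'k) module" where
  "tensor_free K M N = free_module K (carrier M \<times> carrier N)"

definition tensor_relators ::
    "('k, 'r) ring_scheme \<Rightarrow> ('k, 'a) module \<Rightarrow> ('a, 'm) module \<Rightarrow> ('a, 'n) module \<Rightarrow>
     ('m \<times> 'n \<Rightarrow> 'k) set" where
  "tensor_relators K A M N = (let F = tensor_free K M N; e = basis_vec K in
     {e (m \<oplus>\<^bsub>M\<^esub> m', n) \<ominus>\<^bsub>F\<^esub> (e (m, n) \<oplus>\<^bsub>F\<^esub> e (m', n)) |m m' n.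
        m \<in> carrier M \<and> m' \<in> carrier M \<and> n \<in> carrier N} \<union>
     {e (m, n \<oplus>\<^bsub>N\<^esub> n') \<ominus>\<^bsub>F\<^esub> (e (m, n) \<oplus>\<^bsub>F\<^esub> e (m, n')) |m n n'.
        m \<in> carrier M \<and> n \<in> carrier N \<and> n' \<in> carrier N} \<union>
     {e (a \<odot>\<^bsub>M\<^esub> m, n) \<ominus>\<^bsub>F\<^esub> e (m, a \<odot>\<^bsub>N\<^esub> n) |a m n.
        a \<in> carrier A \<and> m \<in> carrier M \<and> n \<in> carrier N} \<union>
     {e ((c \<odot>\<^bsub>A\<^esub> \<one>\<^bsub>A\<^esub>) \<odot>\<^bsub>M\<^esub> m, n) \<ominus>\<^bsub>F\<^esub> c \<odot>\<^bsub>F\<^esub> e (m, n) |c m n.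
        c \<in> carrier K \<and> m \<in> carrier M \<and> n \<in> carrier N})"

definition tensor_span ::
    "('k, 'r) ring_scheme \<Rightarrow> ('k, 'a) module \<Rightarrow> ('a, 'm) module \<Rightarrow> ('a, 'n) module \<Rightarrow>
     ('m \<times> 'n \<Rightarrow> 'k) set" where
  "tensor_span K A M N =
     \<Inter>{W. submodule W K (tensor_free K M N) \<and> tensor_relators K A M N \<subseteq> W}"

definition tensor ::
    "('k, 'r) ring_scheme \<Rightarrow> ('k, 'a) module \<Rightarrow> ('a, 'm) module \<Rightarrow> ('a, 'n) module \<Rightarrow>
     ('k, ('m \<times> 'n \<Rightarrow> 'k) set) module" where
  "tensor K A M N = quotient_module (tensor_free K M N) (tensor_span K A M N)"

text \<open>The map \<open>\<phi> \<otimes> id : M \<otimes>\<^sub>A N \<rightarrow> M' \<otimes>\<^sub>A N\<close>, on cosets.\<close>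

definition tensor_map ::
    "('k, 'r) ring_scheme \<Rightarrow> ('k, 'a) module \<Rightarrow> ('a, 'm') module \<Rightarrow> ('a, 'n) module \<Rightarrow>
     ('m \<Rightarrow> 'm') \<Rightarrow> ('m \<times> 'n \<Rightarrow> 'k) set \<Rightarrow> ('m' \<times> 'n \<Rightarrow> 'k) set" where
  "tensor_map K A M' N \<phi> U =
     set_add (tensor_free K M' N) (tensor_span K A M' N)
       (lin_ext K (tensor_free K M' N) (\<lambda>(m, n). basis_vec K (\<phi> m, n)) ` U)"


section \<open>Tor\<close>

text \<open>
  Tor is computed from a canonical free resolution
  \<open>\<dots> \<rightarrow> P\<^sub>2 \<rightarrow> P\<^sub>1 \<rightarrow> P\<^sub>0 \<rightarrow> M \<rightarrow> 0\<close> of the right \<open>A\<close>-module \<open>M\<close>. Here \<open>P\<^sub>0\<close> is free on the elements of \<open>M\<close>,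
  and \<open>P\<^sub>i\<^sub>+\<^sub>1\<close> is free on the expressions \<open>\<Sum> x\<^sub>j \<cdot> a\<^sub>j\<close> (lists of pairs \<open>(x\<^sub>j, a\<^sub>j)\<close> with
  \<open>x\<^sub>j\<close> a generator of \<open>P\<^sub>i\<close> and \<open>a\<^sub>j \<in> A\<close>) whose value in \<open>P\<^sub>i\<close> lies in the kernel of the map
  leaving \<open>P\<^sub>i\<close>; the differential sends such a generator to its value. Lists are used, rather than
  elements of the kernel, so that the generators in all degrees have one type.
\<close>

datatype ('m, 'a) gen = Elt (elt_of: 'm) | Syz (syz_of: "(('m, 'a) gen \<times> 'a) list")

definition comb_value ::
    "('a, 'r) ring_scheme \<Rightarrow> ('x \<times> 'a) list \<Rightarrow> 'x \<Rightarrow> 'a" where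
  "comb_value A l =
     (\<lambda>z. foldr (\<lambda>(x, a) s. (if x = z then a else \<zero>\<^bsub>A\<^esub>) \<oplus>\<^bsub>A\<^esub> s) l \<zero>\<^bsub>A\<^esub>)"

definition res_aug ::
    "('a, 'r) ring_scheme \<Rightarrow> ('a, 'm) module \<Rightarrow> (('m, 'a) gen \<Rightarrow> 'a) \<Rightarrow> 'm" where
  "res_aug A M = lin_ext A M elt_of"

definition res_diff ::
    "('a, 'r) ring_scheme \<Rightarrow> (('m, 'a) gen \<Rightarrow> 'a) \<Rightarrow> ('m, 'a) gen \<Rightarrow> 'a" where
  "res_diff A = lin_ext A (free_module A UNIV) (\<lambda>x. comb_value A (syz_of x))"

primrec res_gens ::
    "('a, 'r) ring_scheme \<Rightarrow> ('a, 'm) module \<Rightarrow> nat \<Rightarrow> ('m, 'a) gen set" where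
  "res_gens A M 0 = Elt ` carrier M"
| "res_gens A M (Suc i) =
     {Syz l |l. set l \<subseteq> res_gens A M i \<times> carrier A \<and>
        (case i of 0 \<Rightarrow> res_aug A M (comb_value A l) = \<zero>\<^bsub>M\<^esub>
         | Suc j \<Rightarrow> res_diff A (comb_value A l) = (\<lambda>x. \<zero>\<^bsub>A\<^esub>))}"

definition res_module ::
    "('a, 'r) ring_scheme \<Rightarrow> ('a, 'm) module \<Rightarrow> nat \<Rightarrow> ('a, ('m, 'a) gen \<Rightarrow> 'a) module" where
  "res_module A M i = free_module A (res_gens A M i)"

definition Tor ::
    "('k, 'r) ring_scheme \<Rightarrow> ('k, 'a) module \<Rightarrow> ('a, 'm) module \<Rightarrow> ('a, 'n) module \<Rightarrow> nat \<Rightarrow>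
     ('k, ((('m, 'a) gen \<Rightarrow> 'a) \<times> 'n \<Rightarrow> 'k) set set) module" where
  "Tor K A M N =
     homology (\<lambda>i. tensor K A (res_module A M i) N)
              (\<lambda>i. tensor_map K A (res_module A M i) N (res_diff A))"


section \<open>Group homology\<close>

text \<open>
  \<open>H\<^sub>\<star>(G, K)\<close> with trivial coefficients is the homology of the inhomogeneous bar complex, which is free
  on \<open>G\<^sup>i\<close> in degree \<open>i\<close> and has differential \<open>\<Sum>\<^sub>j (-1)\<^sup>j \<partial>\<^sub>j\<close> for the faces \<open>\<partial>\<^sub>0, \<dots>, \<partial>\<^sub>i\<close>.
\<close>

definition bar_face :: "'g monoid \<Rightarrow> nat \<Rightarrow> 'g list \<Rightarrow> 'g list" where
  "bar_face G j l =
     (if j = 0 then tl l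
      else if j = length l then butlast l
      else take (j - 1) l @ [l ! (j - 1) \<otimes>\<^bsub>G\<^esub> l ! j] @ drop (j + 1) l)"

definition bar_module :: "('k, 'r) ring_scheme \<Rightarrow> 'g monoid \<Rightarrow> nat \<Rightarrow> ('k, 'g list \<Rightarrow> 'k) module" where
  "bar_module K G i = free_module K {l. set l \<subseteq> carrier G \<and> length l = i}"

definition bar_diff ::
    "('k, 'r) ring_scheme \<Rightarrow> 'g monoid \<Rightarrow> nat \<Rightarrow> ('g list \<Rightarrow> 'k) \<Rightarrow> 'g list \<Rightarrow> 'k" where
  "bar_diff K G i = (let F = bar_module K G i in
     lin_ext K F (\<lambda>l. \<Oplus>\<^bsub>F\<^esub>j\<in>{..Suc i}.
       if even j then basis_vec K (bar_face G j l) else \<ominus>\<^bsub>F\<^esub> basis_vec K (bar_face G j l)))"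

definition group_homology ::
    "('k, 'r) ring_scheme \<Rightarrow> 'g monoid \<Rightarrow> nat \<Rightarrow> ('k, ('g list \<Rightarrow> 'k) set) module" where
  "group_homology K G = homology (bar_module K G) (bar_diff K G)"

end

theory Submission
  imports Defs
begin

text \<open>
  The augmentation identifies \<open>A\<^sup>X \<otimes>\<^sub>A \<one>\<close> with \<open>K\<^sup>X\<close>, so that \<open>Tor\<close> is the homology of the
  reduction to \<open>K\<close> of a free resolution of \<open>\<one>\<close>, and by the comparison theorem any free resolution will do.
  For a monoid algebra the bar resolution reduces to the bar complex.

  Let \<open>A\<close> be the braided rook algebra and \<open>I\<close> the ideal spanned by the diagrams with a missing edge, so
  that \<open>A / I\<close> is the group algebra \<open>B\<close> of the braid group. As \<open>\<epsilon>\<close> is invertible, there is \<open>\<eta> \<in> 1 + I\<close> with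
  \<open>I \<eta> = 0\<close>. If the image of \<open>z\<close> in a free resolution over \<open>A\<close> reduced modulo \<open>I\<close> is a cycle, then
  \<open>z \<eta>\<close> is a cycle with the same image. Hence the reduction modulo \<open>I\<close> of a free resolution
  of \<open>\<one>\<close> over \<open>A\<close> is a free resolution over \<open>B\<close>, and both have the same reduction to \<open>K\<close>.
\<close>


section \<open>Right modules and linear maps\<close>

text \<open>Reducing a free resolution over \<open>A\<close> modulo an ideal \<open>I\<close>
  usually destroys exactness; the defect is the higher Tor of \<open>A / I\<close>. Here
  \<open>1 - \<eta>\<close> lies in \<open>I\<close> and is a right identity of \<open>I\<close>, so
  \<open>I = A (1 - \<eta>)\<close> is a direct summand of the left module \<open>A\<close>, and
  \<open>A / I\<close> is projective as a left module. Lifting cycles by \<open>\<eta>\<close> is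
  the resulting flatness in coordinates: scalars act on coordinates from the right, and the boundary
  of a lifted cycle has its coordinates in \<open>I\<close>, where \<open>\<eta>\<close> kills them.
  The element \<open>\<eta>\<close> comes from the factor for isolated nodes. Let
  \<open>p\<^sub>j\<close> be the identity diagram without strand \<open>j\<close>. If
  \<open>X\<close> misses the right node \<open>j\<close>, then
  \<open>X p\<^sub>j = \<epsilon> X\<close>, as \<open>j\<close> is the only middle node met by no
  strand of either factor. Hence \<open>\<epsilon>\<^sup>-\<^sup>1 p\<^sub>j\<close> is a right
  identity on these diagrams, and \<open>\<eta>\<close> is a product of the elements
  \<open>1 - \<epsilon>\<^sup>-\<^sup>1 p\<^sub>j\<close>. It kills \<open>I\<close> because a
  diagram with a missing edge misses a right node.\<close>

locale right_module = abelian_group M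
  for R :: "('a, 'r) ring_scheme" and M :: "('a, 'm) module" (structure) +
  assumes ring: "ring R"
    and smult_closed [simp, intro]:
      "\<lbrakk>a \<in> carrier R; x \<in> carrier M\<rbrakk> \<Longrightarrow> a \<odot>\<^bsub>M\<^esub> x \<in> carrier M"
    and smult_l_distr:
      "\<lbrakk>a \<in> carrier R; b \<in> carrier R; x \<in> carrier M\<rbrakk> \<Longrightarrow>
        (a \<oplus>\<^bsub>R\<^esub> b) \<odot>\<^bsub>M\<^esub> x = a \<odot>\<^bsub>M\<^esub> x \<oplus>\<^bsub>M\<^esub> b \<odot>\<^bsub>M\<^esub> x"
    and smult_r_distr:
      "\<lbrakk>a \<in> carrier R; x \<in> carrier M; y \<in> carrier M\<rbrakk> \<Longrightarrow>
        a \<odot>\<^bsub>M\<^esub> (x \<oplus>\<^bsub>M\<^esub> y) = a \<odot>\<^bsub>M\<^esub> x \<oplus>\<^bsub>M\<^esub> a \<odot>\<^bsub>M\<^esub> y"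
    and smult_assoc:
      "\<lbrakk>a \<in> carrier R; b \<in> carrier R; x \<in> carrier M\<rbrakk> \<Longrightarrow>
        (a \<otimes>\<^bsub>R\<^esub> b) \<odot>\<^bsub>M\<^esub> x = b \<odot>\<^bsub>M\<^esub> (a \<odot>\<^bsub>M\<^esub> x)"
    and smult_one [simp]: "x \<in> carrier M \<Longrightarrow> \<one>\<^bsub>R\<^esub> \<odot>\<^bsub>M\<^esub> x = x"
begin

lemma abelian_group: "abelian_group M" ..

lemma smult_l_null [simp]:
  assumes "x \<in> carrier M" shows "\<zero>\<^bsub>R\<^esub> \<odot>\<^bsub>M\<^esub> x = \<zero>\<^bsub>M\<^esub>"
proof -
  interpret R: ring R by (rule ring)
  have "\<zero>\<^bsub>R\<^esub> \<odot>\<^bsub>M\<^esub> x \<oplus>\<^bsub>M\<^esub> \<zero>\<^bsub>R\<^esub> \<odot>\<^bsub>M\<^esub> x = \<zero>\<^bsub>R\<^esub> \<odot>\<^bsub>M\<^esub> x"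
    using smult_l_distr[of "\<zero>\<^bsub>R\<^esub>" "\<zero>\<^bsub>R\<^esub>" x] assms by simp
  then show ?thesis using assms by (metis R.zero_closed add.r_cancel_one' smult_closed)
qed

lemma smult_r_null [simp]:
  assumes "a \<in> carrier R" shows "a \<odot>\<^bsub>M\<^esub> \<zero>\<^bsub>M\<^esub> = \<zero>\<^bsub>M\<^esub>"
proof -
  have "a \<odot>\<^bsub>M\<^esub> \<zero>\<^bsub>M\<^esub> \<oplus>\<^bsub>M\<^esub> a \<odot>\<^bsub>M\<^esub> \<zero>\<^bsub>M\<^esub> = a \<odot>\<^bsub>M\<^esub> \<zero>\<^bsub>M\<^esub>"
    using smult_r_distr[of a "\<zero>\<^bsub>M\<^esub>" "\<zero>\<^bsub>M\<^esub>"] assms by simp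
  then show ?thesis using assms by (metis add.r_cancel_one' smult_closed zero_closed)
qed

end

text \<open>Kept apart from linearity because important maps below are only additive, among them
  coordinatewise reduction along a ring homomorphism and the contracting homotopy of the bar
  resolution.\<close>

definition additive_maps :: "('m, 'a) ring_scheme \<Rightarrow> ('n, 'b) ring_scheme \<Rightarrow> ('m \<Rightarrow> 'n) set" where
  "additive_maps M N = {f \<in> carrier M \<rightarrow> carrier N.
     \<forall>x\<in>carrier M. \<forall>y\<in>carrier M. f (x \<oplus>\<^bsub>M\<^esub> y) = f x \<oplus>\<^bsub>N\<^esub> f y}"

definition linear_maps ::
    "('a, 'r) ring_scheme \<Rightarrow> ('a, 'm) module \<Rightarrow> ('a, 'n) module \<Rightarrow> ('m \<Rightarrow> 'n) set" where
  "linear_maps R M N = {f \<in> additive_maps M N.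
     \<forall>a\<in>carrier R. \<forall>x\<in>carrier M. f (a \<odot>\<^bsub>M\<^esub> x) = a \<odot>\<^bsub>N\<^esub> f x}"

lemma additive_mapsI:
  assumes "\<And>x. x \<in> carrier M \<Longrightarrow> f x \<in> carrier N"
    and "\<And>x y. \<lbrakk>x \<in> carrier M; y \<in> carrier M\<rbrakk> \<Longrightarrow> f (x \<oplus>\<^bsub>M\<^esub> y) = f x \<oplus>\<^bsub>N\<^esub> f y"
  shows "f \<in> additive_maps M N"
  using assms by (auto simp: additive_maps_def)

lemma linear_mapsI:
  assumes "\<And>x. x \<in> carrier M \<Longrightarrow> f x \<in> carrier N"
    and "\<And>x y. \<lbrakk>x \<in> carrier M; y \<in> carrier M\<rbrakk> \<Longrightarrow> f (x \<oplus>\<^bsub>M\<^esub> y) = f x \<oplus>\<^bsub>N\<^esub> f y"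
    and "\<And>a x. \<lbrakk>a \<in> carrier R; x \<in> carrier M\<rbrakk> \<Longrightarrow> f (a \<odot>\<^bsub>M\<^esub> x) = a \<odot>\<^bsub>N\<^esub> f x"
  shows "f \<in> linear_maps R M N"
  using assms by (auto simp: linear_maps_def additive_maps_def)

lemma additive_closed: "\<lbrakk>f \<in> additive_maps M N; x \<in> carrier M\<rbrakk> \<Longrightarrow> f x \<in> carrier N"
  by (auto simp: additive_maps_def)

lemma additive_add:
  "\<lbrakk>f \<in> additive_maps M N; x \<in> carrier M; y \<in> carrier M\<rbrakk> \<Longrightarrow> f (x \<oplus>\<^bsub>M\<^esub> y) = f x \<oplus>\<^bsub>N\<^esub> f y"
  by (auto simp: additive_maps_def)

lemma additive_zero:
  assumes "f \<in> additive_maps M N" "abelian_group M" "abelian_group N"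
  shows "f \<zero>\<^bsub>M\<^esub> = \<zero>\<^bsub>N\<^esub>"
proof -
  interpret M: abelian_group M by fact
  interpret N: abelian_group N by fact
  have "f \<zero>\<^bsub>M\<^esub> \<oplus>\<^bsub>N\<^esub> f \<zero>\<^bsub>M\<^esub> = f \<zero>\<^bsub>M\<^esub>"
    using additive_add[OF assms(1), of "\<zero>\<^bsub>M\<^esub>" "\<zero>\<^bsub>M\<^esub>"] by simp
  then show ?thesis using additive_closed[OF assms(1)] by (metis M.zero_closed N.add.r_cancel_one')
qed

lemma additive_neg:
  assumes "f \<in> additive_maps M N" "abelian_group M" "abelian_group N" "x \<in> carrier M"
  shows "f (\<ominus>\<^bsub>M\<^esub> x) = \<ominus>\<^bsub>N\<^esub> f x"
proof -
  interpret M: abelian_group M by fact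
  interpret N: abelian_group N by fact
  have "f (\<ominus>\<^bsub>M\<^esub> x) \<oplus>\<^bsub>N\<^esub> f x = \<zero>\<^bsub>N\<^esub>"
    using additive_add[OF assms(1), of "\<ominus>\<^bsub>M\<^esub> x" x] assms additive_zero[OF assms(1-3)]
    by (simp add: M.l_neg)
  then show ?thesis using additive_closed[OF assms(1)] assms(4)
    by (metis M.a_inv_closed N.minus_equality)
qed

lemma additive_minus:
  assumes "f \<in> additive_maps M N" "abelian_group M" "abelian_group N" "x \<in> carrier M" "y \<in> carrier M"
  shows "f (x \<ominus>\<^bsub>M\<^esub> y) = f x \<ominus>\<^bsub>N\<^esub> f y"
proof -
  interpret M: abelian_group M by fact
  show ?thesis
    using assms(4,5) by (simp add: a_minus_def additive_add[OF assms(1)] additive_neg[OF assms(1-3)])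
qed

lemma additive_finsum:
  assumes "f \<in> additive_maps M N" "abelian_group M" "abelian_group N" "g \<in> A \<rightarrow> carrier M"
  shows "f (finsum M g A) = finsum N (\<lambda>x. f (g x)) A"
proof -
  interpret M: abelian_group M by fact
  interpret N: abelian_group N by fact
  note z = additive_zero[OF assms(1-3)]
  show ?thesis
  proof (cases "finite A")
    case True
    then show ?thesis using assms(4)
    proof (induction A)
      case empty
      then show ?case by (simp add: z)
    next
      case (insert a A)
      then have "g \<in> A \<rightarrow> carrier M" "g a \<in> carrier M" by auto
      moreover from this have "(\<lambda>x. f (g x)) \<in> A \<rightarrow> carrier N" "f (g a) \<in> carrier N"
        using additive_closed[OF assms(1)] by auto
      ultimately show ?case
        using insert by (simp add: additive_add[OF assms(1)])
    qed
  qed (simp add: z)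
qed

lemma additive_comp: "\<lbrakk>f \<in> additive_maps M N; g \<in> additive_maps N P\<rbrakk> \<Longrightarrow> (\<lambda>x. g (f x)) \<in> additive_maps M P"
  by (auto simp: additive_maps_def Pi_def)

lemma linear_additive: "f \<in> linear_maps R M N \<Longrightarrow> f \<in> additive_maps M N"
  by (simp add: linear_maps_def)

lemmas linear_closed = additive_closed[OF linear_additive]
lemmas linear_add = additive_add[OF linear_additive]
lemmas linear_zero = additive_zero[OF linear_additive]
lemmas linear_minus = additive_minus[OF linear_additive]

lemma linear_smult:
  "\<lbrakk>f \<in> linear_maps R M N; a \<in> carrier R; x \<in> carrier M\<rbrakk> \<Longrightarrow> f (a \<odot>\<^bsub>M\<^esub> x) = a \<odot>\<^bsub>N\<^esub> f x"
  by (auto simp: linear_maps_def)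

lemma linear_comp: "\<lbrakk>f \<in> linear_maps R M N; g \<in> linear_maps R N P\<rbrakk> \<Longrightarrow> (\<lambda>x. g (f x)) \<in> linear_maps R M P"
  by (auto simp: linear_maps_def additive_maps_def Pi_def)

lemma linear_id: "(\<lambda>x. x) \<in> linear_maps R M M"
  by (auto simp: linear_maps_def additive_maps_def)

text \<open>Needed for the maps \<open>F - h d\<close> and \<open>G F - id\<close>, whose lifting
  produces homotopies.\<close>

lemma linear_diff:
  assumes f: "f \<in> linear_maps R M N" and g: "g \<in> linear_maps R M N"
    and M: "right_module R M" and N: "right_module R N"
  shows "(\<lambda>x. f x \<ominus>\<^bsub>N\<^esub> g x) \<in> linear_maps R M N"
proof -
  interpret M: right_module R M by fact
  interpret N: right_module R N by fact
  have sm: "a \<odot>\<^bsub>N\<^esub> (x \<ominus>\<^bsub>N\<^esub> y) = a \<odot>\<^bsub>N\<^esub> x \<ominus>\<^bsub>N\<^esub> a \<odot>\<^bsub>N\<^esub> y"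
    if "a \<in> carrier R" "x \<in> carrier N" "y \<in> carrier N" for a x y
  proof -
    have "(\<lambda>x. a \<odot>\<^bsub>N\<^esub> x) \<in> additive_maps N N"
      using that by (auto intro!: additive_mapsI simp: N.smult_r_distr)
    from additive_minus[OF this N.abelian_group N.abelian_group] show ?thesis using that by simp
  qed
  show ?thesis
    by (rule linear_mapsI)
      (auto simp: linear_closed[OF f] linear_closed[OF g] linear_add[OF f] linear_add[OF g]
        linear_smult[OF f] linear_smult[OF g] sm[unfolded a_minus_def] a_minus_def N.minus_add N.a_ac
        simp del: N.add.inv_mult_group)
qed


section \<open>Free modules\<close>

definition single :: "('a, 'r) ring_scheme \<Rightarrow> 'x \<Rightarrow> 'a \<Rightarrow> 'x \<Rightarrow> 'a" where
  "single R x a = (\<lambda>y. if y = x then a else \<zero>\<^bsub>R\<^esub>)"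

lemma basis_vec_single: "basis_vec R x = single R x \<one>\<^bsub>R\<^esub>"
  by (simp add: basis_vec_def single_def)

lemma free_module_simps [simp]:
  "zero (free_module R X) = (\<lambda>x. \<zero>\<^bsub>R\<^esub>)"
  "add (free_module R X) = (\<lambda>f g x. f x \<oplus>\<^bsub>R\<^esub> g x)"
  "smult (free_module R X) = (\<lambda>a f x. f x \<otimes>\<^bsub>R\<^esub> a)"
  by (simp_all add: free_module_def)

lemma free_module_carrier:
  "f \<in> carrier (free_module R X) \<longleftrightarrow>
    (\<forall>x\<in>X. f x \<in> carrier R) \<and> (\<forall>x. x \<notin> X \<longrightarrow> f x = \<zero>\<^bsub>R\<^esub>) \<and> finite {x. f x \<noteq> \<zero>\<^bsub>R\<^esub>}"
  by (simp add: free_module_def)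

lemma free_module_carrierI:
  assumes "\<And>x. x \<in> X \<Longrightarrow> f x \<in> carrier R" "finite S" "S \<subseteq> X" "\<And>x. x \<notin> S \<Longrightarrow> f x = \<zero>\<^bsub>R\<^esub>"
  shows "f \<in> carrier (free_module R X)"
  using assms by (auto simp: free_module_carrier intro: finite_subset[of _ S])

lemma free_module_support:
  assumes "f \<in> carrier (free_module R X)"
  shows "finite {x. f x \<noteq> \<zero>\<^bsub>R\<^esub>}" "{x. f x \<noteq> \<zero>\<^bsub>R\<^esub>} \<subseteq> X"
  using assms by (auto simp: free_module_carrier)

context ring
begin

lemma free_module_value [simp]: "f \<in> carrier (free_module R X) \<Longrightarrow> f x \<in> carrier R"
  by (cases "x \<in> X") (auto simp: free_module_carrier)

lemma free_module_mono: "X \<subseteq> Y \<Longrightarrow> carrier (free_module R X) \<subseteq> carrier (free_module R Y)"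
  by (force simp: free_module_carrier)

lemma single_closed: "\<lbrakk>x \<in> X; a \<in> carrier R\<rbrakk> \<Longrightarrow> single R x a \<in> carrier (free_module R X)"
  by (rule free_module_carrierI[of _ _ _ "{x}"]) (auto simp: single_def)

lemma single_zero [simp]: "single R x \<zero> = (\<lambda>y. \<zero>)"
  by (auto simp: single_def)

lemma free_module_add_closed:
  assumes "f \<in> carrier (free_module R X)" "g \<in> carrier (free_module R X)"
  shows "(\<lambda>x. f x \<oplus> g x) \<in> carrier (free_module R X)"
  using assms free_module_support[OF assms(1)] free_module_support[OF assms(2)]
  by (intro free_module_carrierI[of _ _ _ "{x. f x \<noteq> \<zero>} \<union> {x. g x \<noteq> \<zero>}"]) auto

lemma abelian_group_free_module: "abelian_group (free_module R X)"
proof (rule abelian_groupI)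
  fix f assume f: "f \<in> carrier (free_module R X)"
  then have "(\<lambda>x. \<ominus> f x) \<in> carrier (free_module R X)"
    using free_module_support[OF f]
    by (intro free_module_carrierI[of _ _ _ "{x. f x \<noteq> \<zero>}"]) auto
  moreover have "(\<lambda>x. \<ominus> f x) \<oplus>\<^bsub>free_module R X\<^esub> f = \<zero>\<^bsub>free_module R X\<^esub>"
    using f by (auto simp: l_neg)
  ultimately show "\<exists>g\<in>carrier (free_module R X). g \<oplus>\<^bsub>free_module R X\<^esub> f = \<zero>\<^bsub>free_module R X\<^esub>"
    by blast
next
  show "\<zero>\<^bsub>free_module R X\<^esub> \<in> carrier (free_module R X)"
    by (auto simp: free_module_carrier)
qed (auto simp: free_module_add_closed a_ac)

lemma right_module_free_module: "right_module R (free_module R X)"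
proof -
  interpret F: abelian_group "free_module R X" by (rule abelian_group_free_module)
  show ?thesis
  proof
    fix a f assume a: "a \<in> carrier R" and f: "f \<in> carrier (free_module R X)"
    then show "a \<odot>\<^bsub>free_module R X\<^esub> f \<in> carrier (free_module R X)"
      using free_module_support[OF f]
      by (intro free_module_carrierI[of _ _ _ "{x. f x \<noteq> \<zero>}"]) auto
  qed (auto simp: l_distr r_distr m_assoc)
qed

lemma free_module_neg:
  assumes f: "f \<in> carrier (free_module R X)"
  shows "\<ominus>\<^bsub>free_module R X\<^esub> f = (\<lambda>x. \<ominus> f x)"
proof -
  interpret F: abelian_group "free_module R X" by (rule abelian_group_free_module)
  have "(\<lambda>x. \<ominus> f x) \<in> carrier (free_module R X)"
    using f free_module_support[OF f]
    by (intro free_module_carrierI[of _ _ _ "{x. f x \<noteq> \<zero>}"]) auto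
  then show ?thesis
    using f by (intro F.minus_equality) (auto simp: l_neg)
qed

lemma free_module_minus:
  assumes "f \<in> carrier (free_module R X)" "g \<in> carrier (free_module R X)"
  shows "f \<ominus>\<^bsub>free_module R X\<^esub> g = (\<lambda>x. f x \<ominus> g x)"
  using assms by (simp add: a_minus_def free_module_neg)

text \<open>One point of the support is removed at a time. The summands are \<open>single\<close>
  elements with arbitrary coefficients, so that the rule applies to properties that ignore the
  scalar action.\<close>

lemma free_module_induct [consumes 1, case_names zero single add]:
  assumes f: "f \<in> carrier (free_module R X)"
    and zero: "P (\<lambda>x. \<zero>)"
    and single: "\<And>x a. \<lbrakk>x \<in> X; a \<in> carrier R\<rbrakk> \<Longrightarrow> P (single R x a)"
    and add: "\<And>f g. \<lbrakk>f \<in> carrier (free_module R X); g \<in> carrier (free_module R X); P f; P g\<rbrakk>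
      \<Longrightarrow> P (\<lambda>x. f x \<oplus> g x)"
  shows "P f"
proof -
  have "finite S \<Longrightarrow> S \<subseteq> X \<Longrightarrow> f \<in> carrier (free_module R X) \<Longrightarrow> {x. f x \<noteq> \<zero>} \<subseteq> S \<Longrightarrow> P f" for S f
  proof (induction S arbitrary: f rule: finite_induct)
    case empty
    then have "f = (\<lambda>x. \<zero>)" by auto
    then show ?case using zero by simp
  next
    case (insert s S)
    let ?g = "f(s := \<zero>)"
    have g: "?g \<in> carrier (free_module R X)"
      using insert by (intro free_module_carrierI[of _ _ _ S]) auto
    have "{x. ?g x \<noteq> \<zero>} \<subseteq> S" using insert.prems by auto
    then have "P ?g" using insert.IH insert.prems g by blast
    moreover have "P (single R s (f s))" using insert by (intro single) auto
    moreover have "single R s (f s) \<in> carrier (free_module R X)"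
      using insert.prems by (intro single_closed) auto
    ultimately have "P (\<lambda>x. single R s (f s) x \<oplus> ?g x)"
      using g by (intro add)
    moreover have "(\<lambda>x. single R s (f s) x \<oplus> ?g x) = f"
      using insert by (auto simp: single_def)
    ultimately show ?case by simp
  qed
  then show ?thesis using f free_module_support[OF f] by blast
qed

end

text \<open>The sum in \<open>lin_ext\<close> runs over the support, which varies with
  \<open>f\<close>. Over a common finite superset the sums for \<open>f\<close>, for
  \<open>g\<close> and for \<open>f\<close> plus \<open>g\<close> can be compared term by
  term.\<close>

lemma lin_ext_superset:
  assumes "right_module R M" "f \<in> carrier (free_module R X)" "v \<in> X \<rightarrow> carrier M"
    and "finite S" "{x. f x \<noteq> \<zero>\<^bsub>R\<^esub>} \<subseteq> S" "S \<subseteq> X"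
  shows "lin_ext R M v f = (\<Oplus>\<^bsub>M\<^esub>x\<in>S. f x \<odot>\<^bsub>M\<^esub> v x)"
proof -
  interpret M: right_module R M by fact
  interpret R: ring R by (rule M.ring)
  have "v x \<in> carrier M" if "x \<in> S" for x using assms that by auto
  then show ?thesis unfolding lin_ext_def
    using assms(2,4-) by (intro M.add.finprod_mono_neutral_cong_left) auto
qed

lemma lin_ext_linear:
  assumes M: "right_module R M" and v: "v \<in> X \<rightarrow> carrier M"
  shows "lin_ext R M v \<in> linear_maps R (free_module R X) M"
proof (rule linear_mapsI)
  interpret M: right_module R M by fact
  interpret R: ring R by (rule M.ring)
  interpret F: right_module R "free_module R X" by (rule R.right_module_free_module)
  note ext = lin_ext_superset[OF M _ v]
  fix f assume f: "f \<in> carrier (free_module R X)"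
  note sf = free_module_support[OF f]
  have v': "v x \<in> carrier M" if "x \<in> X" for x using v that by auto
  show "lin_ext R M v f \<in> carrier M"
    using f v' sf by (auto simp: lin_ext_def intro!: M.finsum_closed)
  {
    fix g assume g: "g \<in> carrier (free_module R X)"
    note sg = free_module_support[OF g]
    let ?S = "{x. f x \<noteq> \<zero>\<^bsub>R\<^esub>} \<union> {x. g x \<noteq> \<zero>\<^bsub>R\<^esub>}"
    have fg: "f \<oplus>\<^bsub>free_module R X\<^esub> g \<in> carrier (free_module R X)" using f g by blast
    have "(\<Oplus>\<^bsub>M\<^esub>x\<in>?S. (f \<oplus>\<^bsub>free_module R X\<^esub> g) x \<odot>\<^bsub>M\<^esub> v x)
        = (\<Oplus>\<^bsub>M\<^esub>x\<in>?S. f x \<odot>\<^bsub>M\<^esub> v x \<oplus>\<^bsub>M\<^esub> g x \<odot>\<^bsub>M\<^esub> v x)"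
      using sf sg v' f g by (intro M.finsum_cong') (auto simp: M.smult_l_distr Pi_def subset_iff)
    also have "\<dots> = (\<Oplus>\<^bsub>M\<^esub>x\<in>?S. f x \<odot>\<^bsub>M\<^esub> v x) \<oplus>\<^bsub>M\<^esub> (\<Oplus>\<^bsub>M\<^esub>x\<in>?S. g x \<odot>\<^bsub>M\<^esub> v x)"
      using sf sg v' f g by (intro M.finsum_addf) auto
    finally have "(\<Oplus>\<^bsub>M\<^esub>x\<in>?S. (f \<oplus>\<^bsub>free_module R X\<^esub> g) x \<odot>\<^bsub>M\<^esub> v x)
        = (\<Oplus>\<^bsub>M\<^esub>x\<in>?S. f x \<odot>\<^bsub>M\<^esub> v x) \<oplus>\<^bsub>M\<^esub> (\<Oplus>\<^bsub>M\<^esub>x\<in>?S. g x \<odot>\<^bsub>M\<^esub> v x)" .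
    moreover have "{x. f x \<oplus>\<^bsub>R\<^esub> g x \<noteq> \<zero>\<^bsub>R\<^esub>} \<subseteq> ?S" by auto
    ultimately show "lin_ext R M v (f \<oplus>\<^bsub>free_module R X\<^esub> g) = lin_ext R M v f \<oplus>\<^bsub>M\<^esub> lin_ext R M v g"
      using ext[OF f, of ?S] ext[OF g, of ?S] ext[OF fg, of ?S] sf sg f g by auto
  next
    fix a assume a: "a \<in> carrier R"
    have af: "a \<odot>\<^bsub>free_module R X\<^esub> f \<in> carrier (free_module R X)" using f a by blast
    have add: "(\<lambda>x. a \<odot>\<^bsub>M\<^esub> x) \<in> additive_maps M M"
      using a by (auto intro!: additive_mapsI simp: M.smult_r_distr)
    let ?S = "{x. f x \<noteq> \<zero>\<^bsub>R\<^esub>}"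
    have "(\<Oplus>\<^bsub>M\<^esub>x\<in>?S. (a \<odot>\<^bsub>free_module R X\<^esub> f) x \<odot>\<^bsub>M\<^esub> v x) = (\<Oplus>\<^bsub>M\<^esub>x\<in>?S. a \<odot>\<^bsub>M\<^esub> (f x \<odot>\<^bsub>M\<^esub> v x))"
      using sf v' f a by (intro M.finsum_cong') (auto simp: M.smult_assoc Pi_def subset_iff)
    also have "\<dots> = a \<odot>\<^bsub>M\<^esub> (\<Oplus>\<^bsub>M\<^esub>x\<in>?S. f x \<odot>\<^bsub>M\<^esub> v x)"
      using sf v' f by (intro additive_finsum[OF add M.abelian_group M.abelian_group, symmetric]) auto
    finally have "(\<Oplus>\<^bsub>M\<^esub>x\<in>?S. (a \<odot>\<^bsub>free_module R X\<^esub> f) x \<odot>\<^bsub>M\<^esub> v x) = a \<odot>\<^bsub>M\<^esub> (\<Oplus>\<^bsub>M\<^esub>x\<in>?S. f x \<odot>\<^bsub>M\<^esub> v x)" .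
    moreover have "{x. f x \<otimes>\<^bsub>R\<^esub> a \<noteq> \<zero>\<^bsub>R\<^esub>} \<subseteq> ?S" using a by auto
    ultimately show "lin_ext R M v (a \<odot>\<^bsub>free_module R X\<^esub> f) = a \<odot>\<^bsub>M\<^esub> lin_ext R M v f"
      using ext[OF f, of ?S] ext[OF af, of ?S] sf f a by auto
  }
qed

lemma lin_ext_single:
  assumes M: "right_module R M" and "v x \<in> carrier M" "a \<in> carrier R"
  shows "lin_ext R M v (single R x a) = a \<odot>\<^bsub>M\<^esub> v x"
proof -
  interpret M: right_module R M by fact
  interpret R: ring R by (rule M.ring)
  have "lin_ext R M v (single R x a) = (\<Oplus>\<^bsub>M\<^esub>y\<in>{x}. single R x a y \<odot>\<^bsub>M\<^esub> v y)"
    using assms by (intro lin_ext_superset[of _ _ _ "{x}"] R.single_closed) (auto simp: single_def)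
  also have "\<dots> = a \<odot>\<^bsub>M\<^esub> v x" using assms by (simp add: single_def)
  finally show ?thesis .
qed

lemma lin_ext_basis_vec:
  assumes "right_module R M" and "v x \<in> carrier M"
  shows "lin_ext R M v (basis_vec R x) = v x"
proof -
  interpret M: right_module R M by fact
  interpret R: ring R by (rule M.ring)
  show ?thesis using assms by (simp add: basis_vec_single lin_ext_single)
qed

text \<open>The elements \<open>single R x a\<close> generate a free module as an abelian group, so
  they determine additive maps. Basis vectors alone determine only linear ones.\<close>

lemma additive_eqI:
  assumes "ring R" and N: "abelian_group N"
    and f: "f \<in> additive_maps (free_module R X) N" and g: "g \<in> additive_maps (free_module R X) N"
    and eq: "\<And>x a. \<lbrakk>x \<in> X; a \<in> carrier R\<rbrakk> \<Longrightarrow> f (single R x a) = g (single R x a)"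
    and u: "u \<in> carrier (free_module R X)"
  shows "f u = g u"
proof -
  interpret R: ring R by fact
  note z = additive_zero[OF f R.abelian_group_free_module N]
    additive_zero[OF g R.abelian_group_free_module N]
  show ?thesis using u
  proof (induction rule: R.free_module_induct)
    case zero
    then show ?case using z by simp
  next
    case (single x a)
    then show ?case by (rule eq)
  next
    case (add u v)
    then show ?case using additive_add[OF f, of u v] additive_add[OF g, of u v] by simp
  qed
qed

lemma single_smult:
  assumes "ring R" "a \<in> carrier R" 
  shows "a \<odot>\<^bsub>free_module R X\<^esub> basis_vec R x = single R x a"
proof -
  interpret R: ring R by fact
  show ?thesis using assms by (auto simp: basis_vec_single single_def)
qed

lemma basis_vec_closed: "ring R \<Longrightarrow> x \<in> X \<Longrightarrow> basis_vec R x \<in> carrier (free_module R X)"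
  by (simp add: basis_vec_single ring.single_closed monoid.one_closed ring.is_monoid)

lemma linear_single:
  assumes "ring R" "f \<in> linear_maps R (free_module R X) N" "x \<in> X" "a \<in> carrier R"
  shows "f (single R x a) = a \<odot>\<^bsub>N\<^esub> f (basis_vec R x)"
proof -
  have "f (single R x a) = f (a \<odot>\<^bsub>free_module R X\<^esub> basis_vec R x)"
    by (subst single_smult[OF assms(1,4)]) (rule refl)
  also have "\<dots> = a \<odot>\<^bsub>N\<^esub> f (basis_vec R x)"
    by (rule linear_smult[OF assms(2,4) basis_vec_closed[OF assms(1,3)]])
  finally show ?thesis .
qed

lemma linear_eqI:
  assumes R: "ring R" and N: "abelian_group N"
    and f: "f \<in> linear_maps R (free_module R X) N" and g: "g \<in> linear_maps R (free_module R X) N"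
    and eq: "\<And>x. x \<in> X \<Longrightarrow> f (basis_vec R x) = g (basis_vec R x)"
    and u: "u \<in> carrier (free_module R X)"
  shows "f u = g u"
  by (rule additive_eqI[OF R N linear_additive[OF f] linear_additive[OF g] _ u])
    (simp add: linear_single[OF R f] linear_single[OF R g] eq)

text \<open>Projectivity of free modules. Preimages under \<open>e\<close> are chosen for the basis
  vectors only; the lift extends them, and linearity settles the rest.\<close>

lemma free_lift:
  assumes N: "right_module R N" and L: "right_module R L"
    and e: "e \<in> linear_maps R L N" and f: "f \<in> linear_maps R (free_module R X) N"
    and im: "\<And>x. x \<in> X \<Longrightarrow> f (basis_vec R x) \<in> e ` carrier L"
  obtains h where "h \<in> linear_maps R (free_module R X) L"
    "\<And>u. u \<in> carrier (free_module R X) \<Longrightarrow> e (h u) = f u"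
proof -
  interpret N: right_module R N by fact
  interpret L: right_module R L by fact
  define v where "v x = (SOME y. y \<in> carrier L \<and> e y = f (basis_vec R x))" for x
  have v: "v x \<in> carrier L \<and> e (v x) = f (basis_vec R x)" if x: "x \<in> X" for x
  proof -
    obtain y where "y \<in> carrier L" "f (basis_vec R x) = e y" using im[OF x] by (rule imageE)
    then have "\<exists>y. y \<in> carrier L \<and> e y = f (basis_vec R x)" by auto
    then show ?thesis unfolding v_def by (rule someI_ex)
  qed
  then have h: "lin_ext R L v \<in> linear_maps R (free_module R X) L"
    by (intro lin_ext_linear L) auto
  have "e (lin_ext R L v u) = f u" if "u \<in> carrier (free_module R X)" for u
    by (rule linear_eqI[OF N.ring N.abelian_group linear_comp[OF h e] f _ that])
      (simp add: lin_ext_basis_vec[OF L] v)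
  with h that show ?thesis by blast
qed


section \<open>Quotients and homology\<close>

text \<open>Negatives come for free, being multiples by \<open>\<ominus> \<one>\<close>.\<close>

lemma submoduleI:
  assumes M: "right_module R M" and sub: "H \<subseteq> carrier M" and zero: "\<zero>\<^bsub>M\<^esub> \<in> H"
    and add: "\<And>x y. \<lbrakk>x \<in> H; y \<in> H\<rbrakk> \<Longrightarrow> x \<oplus>\<^bsub>M\<^esub> y \<in> H"
    and smult: "\<And>a x. \<lbrakk>a \<in> carrier R; x \<in> H\<rbrakk> \<Longrightarrow> a \<odot>\<^bsub>M\<^esub> x \<in> H"
  shows "submodule H R M"
proof -
  interpret M: right_module R M by fact
  interpret R: ring R by (rule M.ring)
  have neg: "\<ominus>\<^bsub>M\<^esub> x \<in> H" if "x \<in> H" for x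
  proof -
    have x: "x \<in> carrier M" using sub that by auto
    have "(\<ominus>\<^bsub>R\<^esub> \<one>\<^bsub>R\<^esub>) \<odot>\<^bsub>M\<^esub> x \<oplus>\<^bsub>M\<^esub> x = (\<ominus>\<^bsub>R\<^esub> \<one>\<^bsub>R\<^esub> \<oplus>\<^bsub>R\<^esub> \<one>\<^bsub>R\<^esub>) \<odot>\<^bsub>M\<^esub> x"
      using x M.smult_l_distr[of "\<ominus>\<^bsub>R\<^esub> \<one>\<^bsub>R\<^esub>" "\<one>\<^bsub>R\<^esub>" x] by simp
    also have "\<dots> = \<zero>\<^bsub>M\<^esub>" using x by (simp add: R.l_neg)
    finally have "\<ominus>\<^bsub>M\<^esub> x = (\<ominus>\<^bsub>R\<^esub> \<one>\<^bsub>R\<^esub>) \<odot>\<^bsub>M\<^esub> x"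
      using x by (intro M.minus_equality) auto
    then show ?thesis using smult that by simp
  qed
  show ?thesis
  proof (rule submodule.intro)
    show "subgroup H (add_monoid M)"
      using sub zero add neg by (auto simp: subgroup_def a_inv_def[symmetric])
  qed (auto intro: submodule_axioms.intro smult)
qed

lemma submodule_abelian_subgroup:
  assumes "submodule H R M" "abelian_group M"
  shows "abelian_subgroup H M"
  using assms by (intro abelian_subgroupI3) (auto simp: additive_subgroup_def submodule_def)

lemma submoduleD:
  assumes "submodule H R M"
  shows "H \<subseteq> carrier M" "\<zero>\<^bsub>M\<^esub> \<in> H" "\<And>x y. \<lbrakk>x \<in> H; y \<in> H\<rbrakk> \<Longrightarrow> x \<oplus>\<^bsub>M\<^esub> y \<in> H"
    "\<And>a x. \<lbrakk>a \<in> carrier R; x \<in> H\<rbrakk> \<Longrightarrow> a \<odot>\<^bsub>M\<^esub> x \<in> H" "\<And>x. x \<in> H \<Longrightarrow> \<ominus>\<^bsub>M\<^esub> x \<in> H"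
  using assms by (auto simp: submodule_def submodule_axioms_def subgroup_def a_inv_def[symmetric])

lemma right_module_submodule:
  assumes M: "right_module R M" and H: "submodule H R M"
  shows "right_module R (M\<lparr>carrier := H\<rparr>)"
proof -
  interpret M: right_module R M by fact
  note HD = submoduleD[OF H]
  have in_M: "x \<in> H \<Longrightarrow> x \<in> carrier M" for x using HD(1) by auto
  have "abelian_group (M\<lparr>carrier := H\<rparr>)"
  proof (rule abelian_groupI)
    show "\<exists>y\<in>carrier (M\<lparr>carrier := H\<rparr>). y \<oplus>\<^bsub>M\<lparr>carrier := H\<rparr>\<^esub> x = \<zero>\<^bsub>M\<lparr>carrier := H\<rparr>\<^esub>"
      if "x \<in> carrier (M\<lparr>carrier := H\<rparr>)" for x
      using that by (auto intro!: bexI[of _ "\<ominus>\<^bsub>M\<^esub> x"] simp: HD in_M M.l_neg)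
  qed (auto simp: HD in_M M.a_ac)
  then interpret H: abelian_group "M\<lparr>carrier := H\<rparr>" .
  show ?thesis
    by (rule right_module.intro[OF H.abelian_group_axioms right_module_axioms.intro[OF M.ring]])
      (auto simp: HD in_M M.smult_l_distr M.smult_r_distr M.smult_assoc)
qed

lemma linear_image_submodule:
  assumes L: "right_module R L" and M: "right_module R M" and f: "f \<in> linear_maps R L M"
  shows "submodule (f ` carrier L) R M"
proof -
  interpret L: right_module R L by fact
  interpret M: right_module R M by fact
  have "\<zero>\<^bsub>M\<^esub> \<in> f ` carrier L"
    using linear_zero[OF f L.abelian_group M.abelian_group] by (metis L.zero_closed imageI)
  then show ?thesis
    by (intro submoduleI[OF M])
      (auto simp: linear_closed[OF f] linear_add[OF f, symmetric] linear_smult[OF f, symmetric])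
qed

lemma linear_kernel_submodule:
  assumes L: "right_module R L" and M: "right_module R M" and f: "f \<in> linear_maps R L M"
  shows "submodule {x \<in> carrier L. f x = \<zero>\<^bsub>M\<^esub>} R L"
proof -
  interpret L: right_module R L by fact
  interpret M: right_module R M by fact
  show ?thesis
    by (rule submoduleI[OF L])
      (auto simp: linear_add[OF f] linear_smult[OF f] linear_zero[OF f L.abelian_group M.abelian_group])
qed

lemma submodule_carrier: "right_module R M \<Longrightarrow> submodule (carrier M) R M"
  by (rule submoduleI) (auto simp: right_module.smult_closed abelian_groupE right_module_def)

lemma coset_eq_iff:
  assumes "abelian_subgroup W V" "x \<in> carrier V" "y \<in> carrier V"
  shows "W +>\<^bsub>V\<^esub> x = W +>\<^bsub>V\<^esub> y \<longleftrightarrow> x \<ominus>\<^bsub>V\<^esub> y \<in> W"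
proof -
  interpret abelian_subgroup W V by fact
  have "W +>\<^bsub>V\<^esub> x = W +>\<^bsub>V\<^esub> y \<longleftrightarrow> x \<in> W +>\<^bsub>V\<^esub> y"
    using a_rcos_self[OF assms(2)] a_repr_independence'[of x y] assms(3) by auto
  then show ?thesis using a_rcos_module[OF assms(3,2)] by (simp add: a_minus_def)
qed

text \<open>A coset is mapped only into part of a coset of \<open>W'\<close>; adding
  \<open>W'\<close> fills it up. Scalar multiplication on quotients and \<open>tensor_map\<close>
  are both defined in this form.\<close>

lemma induced_coset:
  assumes W: "abelian_subgroup W V" and W': "abelian_subgroup W' V'"
    and f: "f \<in> additive_maps V V'" and im: "f ` W \<subseteq> W'" and x: "x \<in> carrier V"
  shows "set_add V' W' (f ` (W +>\<^bsub>V\<^esub> x)) = W' +>\<^bsub>V'\<^esub> f x"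
proof -
  interpret W: abelian_subgroup W V by fact
  interpret W': abelian_subgroup W' V' by fact
  have WV: "w \<in> W \<Longrightarrow> w \<in> carrier V" for w by auto
  note fc = additive_closed[OF f x]
  show ?thesis
  proof (intro equalityI subsetI)
    fix u assume "u \<in> set_add V' W' (f ` (W +>\<^bsub>V\<^esub> x))"
    then obtain w' w where w: "w' \<in> W'" "w \<in> W" "u = w' \<oplus>\<^bsub>V'\<^esub> f (w \<oplus>\<^bsub>V\<^esub> x)"
      by (auto simp: set_add_def' a_r_coset_def')
    moreover have fw: "f w \<in> W'" using im w by auto
    ultimately have "u = (w' \<oplus>\<^bsub>V'\<^esub> f w) \<oplus>\<^bsub>V'\<^esub> f x"
      using fc x WV by (simp add: additive_add[OF f] W'.add.m_assoc)
    then show "u \<in> W' +>\<^bsub>V'\<^esub> f x" using w fw by (auto simp: a_r_coset_def')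
  next
    fix u assume "u \<in> W' +>\<^bsub>V'\<^esub> f x"
    then obtain w' where "w' \<in> W'" "u = w' \<oplus>\<^bsub>V'\<^esub> f x" by (auto simp: a_r_coset_def')
    then show "u \<in> set_add V' W' (f ` (W +>\<^bsub>V\<^esub> x))"
      using W.a_rcos_self[OF x] by (auto simp: set_add_def')
  qed
qed

section \<open>Quotient modules and their isomorphisms\<close>

lemma quotient_carrier_iff:
  "U \<in> carrier (quotient_module V W) \<longleftrightarrow> (\<exists>x\<in>carrier V. U = W +>\<^bsub>V\<^esub> x)"
  by (auto simp: quotient_module_def A_RCOSETS_def')

lemma quotient_simps:
  assumes V: "right_module R V" and W: "submodule W R V"
  shows "\<zero>\<^bsub>quotient_module V W\<^esub> = W +>\<^bsub>V\<^esub> \<zero>\<^bsub>V\<^esub>"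
    "\<lbrakk>x \<in> carrier V; y \<in> carrier V\<rbrakk> \<Longrightarrow>
      (W +>\<^bsub>V\<^esub> x) \<oplus>\<^bsub>quotient_module V W\<^esub> (W +>\<^bsub>V\<^esub> y) = W +>\<^bsub>V\<^esub> (x \<oplus>\<^bsub>V\<^esub> y)"
    "\<lbrakk>a \<in> carrier R; x \<in> carrier V\<rbrakk> \<Longrightarrow>
      a \<odot>\<^bsub>quotient_module V W\<^esub> (W +>\<^bsub>V\<^esub> x) = W +>\<^bsub>V\<^esub> (a \<odot>\<^bsub>V\<^esub> x)"
proof -
  interpret V: right_module R V by fact
  have sub: "abelian_subgroup W V" by (rule submodule_abelian_subgroup[OF W V.abelian_group])
  interpret W: abelian_subgroup W V by fact
  show "\<zero>\<^bsub>quotient_module V W\<^esub> = W +>\<^bsub>V\<^esub> \<zero>\<^bsub>V\<^esub>"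
    using V.a_coset_add_zero[OF W.a_subset] by (simp add: quotient_module_def)
  show "(W +>\<^bsub>V\<^esub> x) \<oplus>\<^bsub>quotient_module V W\<^esub> (W +>\<^bsub>V\<^esub> y) = W +>\<^bsub>V\<^esub> (x \<oplus>\<^bsub>V\<^esub> y)"
    if "x \<in> carrier V" "y \<in> carrier V"
    using that by (simp add: quotient_module_def W.a_rcos_sum)
  assume a: "a \<in> carrier R" and x: "x \<in> carrier V"
  have "(\<lambda>u. a \<odot>\<^bsub>V\<^esub> u) \<in> additive_maps V V"
    using a by (auto intro!: additive_mapsI simp: V.smult_r_distr)
  from induced_coset[OF sub sub this _ x]
  show "a \<odot>\<^bsub>quotient_module V W\<^esub> (W +>\<^bsub>V\<^esub> x) = W +>\<^bsub>V\<^esub> (a \<odot>\<^bsub>V\<^esub> x)"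
    using submoduleD(4)[OF W a] by (auto simp: quotient_module_def)
qed

lemma right_module_quotient:
  assumes V: "right_module R V" and W: "submodule W R V"
  shows "right_module R (quotient_module V W)"
proof -
  interpret V: right_module R V by fact
  interpret R: ring R by (rule V.ring)
  note simps = quotient_simps[OF V W] quotient_carrier_iff
  have "abelian_group (quotient_module V W)"
  proof (rule abelian_groupI)
    show "\<exists>y\<in>carrier (quotient_module V W). y \<oplus>\<^bsub>quotient_module V W\<^esub> x = \<zero>\<^bsub>quotient_module V W\<^esub>"
      if x: "x \<in> carrier (quotient_module V W)" for x
    proof -
      obtain u where "u \<in> carrier V" "x = W +>\<^bsub>V\<^esub> u" using x by (auto simp: simps)
      then show ?thesis
        by (intro bexI[of _ "W +>\<^bsub>V\<^esub> \<ominus>\<^bsub>V\<^esub> u"]) (auto simp: simps V.l_neg)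
    qed
    show "\<zero>\<^bsub>quotient_module V W\<^esub> \<in> carrier (quotient_module V W)"
      by (auto simp: simps(1) quotient_carrier_iff)
    show "\<zero>\<^bsub>quotient_module V W\<^esub> \<oplus>\<^bsub>quotient_module V W\<^esub> x = x"
      if x: "x \<in> carrier (quotient_module V W)" for x
      using x by (auto simp: simps)
  qed (auto simp: simps V.a_ac)
  then interpret Q: abelian_group "quotient_module V W" .
  show ?thesis
    by (rule right_module.intro[OF Q.abelian_group_axioms right_module_axioms.intro[OF V.ring]])
      (auto simp: simps V.smult_l_distr V.smult_r_distr V.smult_assoc)
qed

definition induced_map :: "('k, 'w) module \<Rightarrow> 'w set \<Rightarrow> ('v \<Rightarrow> 'w) \<Rightarrow> 'v set \<Rightarrow> 'w set" where
  "induced_map V' W' f U = set_add V' W' (f ` U)"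

text \<open>The conditions \<open>im\<close>, \<open>inj\<close> and \<open>surj\<close> are
  well-definedness, injectivity and surjectivity of the induced map, stated for representatives.
  They leave room for an \<open>f\<close> that is neither injective nor surjective itself, such as a
  homotopy equivalence.\<close>

lemma quotient_iso:
  assumes V: "right_module K V" and V': "right_module K V'"
    and W: "submodule W K V" and W': "submodule W' K V'"
    and f: "f \<in> linear_maps K V V'" and im: "f ` W \<subseteq> W'"
    and inj: "\<And>v. \<lbrakk>v \<in> carrier V; f v \<in> W'\<rbrakk> \<Longrightarrow> v \<in> W"
    and surj: "\<And>v'. v' \<in> carrier V' \<Longrightarrow> \<exists>v\<in>carrier V. \<exists>w\<in>W'. v' = w \<oplus>\<^bsub>V'\<^esub> f v"
  shows "module_iso K (quotient_module V W) (quotient_module V' W') (induced_map V' W' f)"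
proof -
  interpret V: right_module K V by fact
  interpret V': right_module K V' by fact
  have sW: "abelian_subgroup W V" by (rule submodule_abelian_subgroup[OF W V.abelian_group])
  have sW': "abelian_subgroup W' V'" by (rule submodule_abelian_subgroup[OF W' V'.abelian_group])
  interpret W': abelian_subgroup W' V' by fact
  note h = induced_coset[OF sW sW' linear_additive[OF f] im, folded induced_map_def]
  have inj_h: "inj_on (induced_map V' W' f) (carrier (quotient_module V W))"
  proof (rule inj_onI)
    fix U U' assume "U \<in> carrier (quotient_module V W)" "U' \<in> carrier (quotient_module V W)"
      and eq: "induced_map V' W' f U = induced_map V' W' f U'"
    then obtain u u' where u: "u \<in> carrier V" "U = W +>\<^bsub>V\<^esub> u" "u' \<in> carrier V" "U' = W +>\<^bsub>V\<^esub> u'"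
      by (auto simp: quotient_carrier_iff)
    with eq have "W' +>\<^bsub>V'\<^esub> f u = W' +>\<^bsub>V'\<^esub> f u'" by (simp add: h)
    then have "f (u \<ominus>\<^bsub>V\<^esub> u') \<in> W'"
      using u by (simp add: coset_eq_iff[OF sW'] linear_closed[OF f]
        linear_minus[OF f V.abelian_group V'.abelian_group])
    then have "u \<ominus>\<^bsub>V\<^esub> u' \<in> W" using u by (intro inj) auto
    then show "U = U'" using u by (simp add: coset_eq_iff[OF sW])
  qed
  have surj_h: "induced_map V' W' f ` carrier (quotient_module V W) = carrier (quotient_module V' W')"
  proof (intro equalityI subsetI)
    fix U' assume "U' \<in> carrier (quotient_module V' W')"
    then obtain v' where v': "v' \<in> carrier V'" "U' = W' +>\<^bsub>V'\<^esub> v'" by (auto simp: quotient_carrier_iff)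
    obtain v w where v: "v \<in> carrier V" "w \<in> W'" "v' = w \<oplus>\<^bsub>V'\<^esub> f v" using surj[OF v'(1)] by auto
    then have "v' \<in> W' +>\<^bsub>V'\<^esub> f v" by (auto simp: a_r_coset_def')
    then have "U' = induced_map V' W' f (W +>\<^bsub>V\<^esub> v)"
      using v v' W'.a_repr_independence'[of v' "f v"] by (simp add: h linear_closed[OF f])
    then show "U' \<in> induced_map V' W' f ` carrier (quotient_module V W)"
      using v by (simp add: quotient_carrier_iff) (rule imageI, auto simp: quotient_carrier_iff)
  next
    fix U' assume "U' \<in> induced_map V' W' f ` carrier (quotient_module V W)"
    then obtain v where "v \<in> carrier V" "U' = W' +>\<^bsub>V'\<^esub> f v"
      by (auto simp: quotient_carrier_iff h)
    then show "U' \<in> carrier (quotient_module V' W')"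
      using linear_closed[OF f] by (auto simp: quotient_carrier_iff)
  qed
  show ?thesis unfolding module_iso_def
  proof (intro conjI ballI)
    show "bij_betw (induced_map V' W' f) (carrier (quotient_module V W)) (carrier (quotient_module V' W'))"
      using inj_h surj_h by (simp add: bij_betw_def)
    fix x assume "x \<in> carrier (quotient_module V W)"
    then obtain u where u: "u \<in> carrier V" "x = W +>\<^bsub>V\<^esub> u" by (auto simp: quotient_carrier_iff)
    {
      fix y assume "y \<in> carrier (quotient_module V W)"
      then obtain v where v: "v \<in> carrier V" "y = W +>\<^bsub>V\<^esub> v" by (auto simp: quotient_carrier_iff)
      show "induced_map V' W' f (x \<oplus>\<^bsub>quotient_module V W\<^esub> y)
          = induced_map V' W' f x \<oplus>\<^bsub>quotient_module V' W'\<^esub> induced_map V' W' f y"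
        using u v by (simp add: quotient_simps[OF V W] quotient_simps[OF V' W'] h linear_add[OF f]
          linear_closed[OF f])
    next
      fix c assume "c \<in> carrier K"
      then show "induced_map V' W' f (c \<odot>\<^bsub>quotient_module V W\<^esub> x)
          = c \<odot>\<^bsub>quotient_module V' W'\<^esub> induced_map V' W' f x"
        using u by (simp add: quotient_simps[OF V W] quotient_simps[OF V' W'] h linear_smult[OF f]
          linear_closed[OF f])
    }
  qed
qed

lemma module_iso_sym:
  assumes V: "right_module K V" and h: "module_iso K V W h"
  shows "module_iso K W V (inv_into (carrier V) h)"
proof -
  interpret V: right_module K V by fact
  let ?g = "inv_into (carrier V) h"
  have bij: "bij_betw h (carrier V) (carrier W)" using h by (simp add: module_iso_def)
  have g: "bij_betw ?g (carrier W) (carrier V)" by (rule bij_betw_inv_into[OF bij])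
  have gc: "?g x \<in> carrier V" if "x \<in> carrier W" for x using g that by (rule bij_betwE[rule_format])
  have hg: "h (?g x) = x" if "x \<in> carrier W" for x using bij_betw_inv_into_right[OF bij that] .
  have gh: "?g (h x) = x" if "x \<in> carrier V" for x using bij_betw_inv_into_left[OF bij that] .
  have add: "h (x \<oplus>\<^bsub>V\<^esub> y) = h x \<oplus>\<^bsub>W\<^esub> h y" if "x \<in> carrier V" "y \<in> carrier V" for x y
    using h that by (simp add: module_iso_def)
  have sm: "h (c \<odot>\<^bsub>V\<^esub> x) = c \<odot>\<^bsub>W\<^esub> h x" if "c \<in> carrier K" "x \<in> carrier V" for c x
    using h that by (simp add: module_iso_def)
  show ?thesis unfolding module_iso_def
  proof (intro conjI ballI g)
    fix x assume x: "x \<in> carrier W"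
    {
      fix y assume y: "y \<in> carrier W"
      show "?g (x \<oplus>\<^bsub>W\<^esub> y) = ?g x \<oplus>\<^bsub>V\<^esub> ?g y"
        using gh[of "?g x \<oplus>\<^bsub>V\<^esub> ?g y"] add[of "?g x" "?g y"] gc x y hg by simp
    next
      fix c assume c: "c \<in> carrier K"
      show "?g (c \<odot>\<^bsub>W\<^esub> x) = c \<odot>\<^bsub>V\<^esub> ?g x"
        using gh[of "c \<odot>\<^bsub>V\<^esub> ?g x"] sm[of c "?g x"] gc x c hg by simp
    }
  qed
qed

lemma module_iso_trans:
  assumes "module_iso K U V g" "module_iso K V W h"
  shows "module_iso K U W (h \<circ> g)"
proof -
  have "g x \<in> carrier V" if "x \<in> carrier U" for x
    using assms(1) that by (auto simp: module_iso_def bij_betw_def)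
  then show ?thesis
    using assms bij_betw_trans[of g "carrier U" "carrier V" h "carrier W"] by (simp add: module_iso_def)
qed

lemma graded_isomorphicI:
  assumes "\<And>i. \<exists>h. module_iso K (V i) (W i) h"
  shows "graded_isomorphic K V W"
  using assms unfolding graded_isomorphic_def by (intro choice) auto

lemma graded_isomorphic_sym:
  assumes "graded_isomorphic K V W" "\<And>i. right_module K (V i)"
  shows "graded_isomorphic K W V"
proof -
  obtain h where "\<And>i. module_iso K (V i) (W i) (h i)"
    using assms(1) by (auto simp: graded_isomorphic_def)
  from module_iso_sym[OF assms(2) this] show ?thesis by (intro graded_isomorphicI exI)
qed

lemma graded_isomorphic_trans:
  assumes "graded_isomorphic K U V" "graded_isomorphic K V W"
  shows "graded_isomorphic K U W"
proof -
  obtain g h where "\<And>i. module_iso K (U i) (V i) (g i)" "\<And>i. module_iso K (V i) (W i) (h i)"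
    using assms by (auto simp: graded_isomorphic_def)
  from module_iso_trans[OF this] show ?thesis by (intro graded_isomorphicI exI)
qed

section \<open>Homology of chain complexes\<close>

locale chain_complex =
  fixes K :: "('k, 'r) ring_scheme" and C :: "nat \<Rightarrow> ('k, 'v) module" and d :: "nat \<Rightarrow> 'v \<Rightarrow> 'v"
  assumes right_module: "\<And>i. right_module K (C i)"
    and d_linear: "\<And>i. d i \<in> linear_maps K (C (Suc i)) (C i)"
    and d_d: "\<And>i x. x \<in> carrier (C (Suc (Suc i))) \<Longrightarrow> d i (d (Suc i) x) = \<zero>\<^bsub>C i\<^esub>"
begin

lemma submodule_cycles: "submodule (cycles C d i) K (C i)"
  using linear_kernel_submodule[OF right_module right_module d_linear] submodule_carrier[OF right_module]
  by (cases i) simp_all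

lemma boundaries_cycles: "d i ` carrier (C (Suc i)) \<subseteq> cycles C d i"
  by (cases i) (auto simp: linear_closed[OF d_linear] d_d)

lemma cycles_module: "right_module K ((C i)\<lparr>carrier := cycles C d i\<rparr>)"
  by (rule right_module_submodule[OF right_module submodule_cycles])

lemma d_into_cycles: "d i \<in> linear_maps K (C (Suc i)) ((C i)\<lparr>carrier := cycles C d i\<rparr>)"
  using boundaries_cycles[of i]
  by (intro linear_mapsI) (auto simp: linear_add[OF d_linear] linear_smult[OF d_linear])

lemma submodule_boundaries:
  "submodule (d i ` carrier (C (Suc i))) K ((C i)\<lparr>carrier := cycles C d i\<rparr>)"
  by (rule linear_image_submodule[OF right_module cycles_module d_into_cycles])

lemma right_module_homology: "right_module K (homology C d i)"
  unfolding homology_def by (rule right_module_quotient[OF cycles_module submodule_boundaries])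

end

text \<open>A criterion for quasi-isomorphisms: \<open>inj\<close> and \<open>surj\<close> are
  bijectivity on homology, written for cycles. It is applied to a homotopy equivalence in the
  comparison theorem and to degreewise isomorphisms in the transport of complexes.\<close>

lemma homology_iso:
  assumes C: "chain_complex K C d" and C': "chain_complex K C' d'"
    and f: "\<And>i. f i \<in> linear_maps K (C i) (C' i)"
    and comm: "\<And>i x. x \<in> carrier (C (Suc i)) \<Longrightarrow> d' i (f (Suc i) x) = f i (d i x)"
    and inj: "\<And>i z w. \<lbrakk>z \<in> cycles C d i; w \<in> carrier (C' (Suc i)); f i z = d' i w\<rbrakk>
      \<Longrightarrow> z \<in> d i ` carrier (C (Suc i))"
    and surj: "\<And>i z'. z' \<in> cycles C' d' i \<Longrightarrow>
      \<exists>z\<in>cycles C d i. \<exists>w\<in>carrier (C' (Suc i)). z' = d' i w \<oplus>\<^bsub>C' i\<^esub> f i z"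
  shows "graded_isomorphic K (homology C d) (homology C' d')"
proof (rule graded_isomorphicI)
  fix i
  interpret C: chain_complex K C d by fact
  interpret C': chain_complex K C' d' by fact
  have zero: "f j \<zero>\<^bsub>C j\<^esub> = \<zero>\<^bsub>C' j\<^esub>" for j
    by (rule linear_zero[OF f])
      (auto intro: right_module.abelian_group C.right_module C'.right_module)
  have cyc: "f i z \<in> cycles C' d' i" if "z \<in> cycles C d i" for z
    using that by (cases i) (auto simp: linear_closed[OF f] comm zero)
  have cycC: "z \<in> carrier (C i)" if "z \<in> cycles C d i" for z
    using submoduleD(1)[OF C.submodule_cycles] that by auto
  show "\<exists>h. module_iso K (homology C d i) (homology C' d' i) h"
    unfolding homology_def
  proof (rule exI, rule quotient_iso[OF C.cycles_module C'.cycles_module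
        C.submodule_boundaries C'.submodule_boundaries])
    show "f i \<in> linear_maps K (C i\<lparr>carrier := cycles C d i\<rparr>) (C' i\<lparr>carrier := cycles C' d' i\<rparr>)"
      by (rule linear_mapsI) (auto simp: cyc cycC linear_add[OF f] linear_smult[OF f])
    show "f i ` d i ` carrier (C (Suc i)) \<subseteq> d' i ` carrier (C' (Suc i))"
      by (auto simp: comm[symmetric] linear_closed[OF f])
    show "v \<in> d i ` carrier (C (Suc i))"
      if "v \<in> carrier (C i\<lparr>carrier := cycles C d i\<rparr>)" "f i v \<in> d' i ` carrier (C' (Suc i))" for v
      using that inj by auto
    show "\<exists>v\<in>carrier (C i\<lparr>carrier := cycles C d i\<rparr>). \<exists>w\<in>d' i ` carrier (C' (Suc i)).
        v' = w \<oplus>\<^bsub>C' i\<lparr>carrier := cycles C' d' i\<rparr>\<^esub> f i v"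
      if "v' \<in> carrier (C' i\<lparr>carrier := cycles C' d' i\<rparr>)" for v'
      using that surj[of v' i] by auto
  qed
qed

text \<open>Differentials are functions on a whole type, whereas those identified below are known to
  agree only on the carriers.\<close>

lemma homology_cong:
  assumes "\<And>i x. x \<in> carrier (C (Suc i)) \<Longrightarrow> d i x = d' i x"
  shows "homology C d = homology C d'"
proof
  fix i
  have "cycles C d i = cycles C d' i" using assms by (cases i) auto
  moreover have "d i ` carrier (C (Suc i)) = d' i ` carrier (C (Suc i))"
    by (rule image_cong) (simp_all add: assms)
  ultimately show "homology C d i = homology C d' i" by (simp add: homology_def)
qed


section \<open>Base change of free modules\<close>

text \<open>The map induced by \<open>\<phi>\<close> after extension of scalars, in coordinates: the
  bases stay the same, so a vector is lifted along \<open>\<sigma>\<close>, mapped by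
  \<open>\<phi>\<close> and reduced along \<open>\<pi>\<close>. In this way no tensor product with
  the quotient ring has to be formed.\<close>

definition base_change :: "('a \<Rightarrow> 'b) \<Rightarrow> ('b \<Rightarrow> 'a) \<Rightarrow> (('x \<Rightarrow> 'a) \<Rightarrow> 'y \<Rightarrow> 'a) \<Rightarrow> ('x \<Rightarrow> 'b) \<Rightarrow> 'y \<Rightarrow> 'b" where
  "base_change \<pi> \<sigma> \<phi> g = (\<lambda>y. \<pi> (\<phi> (\<lambda>x. \<sigma> (g x)) y))"

text \<open>\<open>\<sigma>\<close> is only a set-theoretic section. The condition at zero keeps
  lifted vectors finitely supported.\<close>

locale ring_surjection = A: ring A + B: ring B
  for A :: "('a, 'r) ring_scheme" and B :: "('b, 's) ring_scheme" and \<pi> :: "'a \<Rightarrow> 'b" and \<sigma> :: "'b \<Rightarrow> 'a" +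
  assumes hom: "\<pi> \<in> ring_hom A B"
    and section_closed [simp]: "\<And>b. b \<in> carrier B \<Longrightarrow> \<sigma> b \<in> carrier A"
    and hom_section [simp]: "\<And>b. b \<in> carrier B \<Longrightarrow> \<pi> (\<sigma> b) = b"
    and section_zero [simp]: "\<sigma> \<zero>\<^bsub>B\<^esub> = \<zero>\<^bsub>A\<^esub>"
begin

lemma hom_closed [simp]: "a \<in> carrier A \<Longrightarrow> \<pi> a \<in> carrier B"
  by (rule ring_hom_closed[OF hom])

lemma hom_zero [simp]: "\<pi> \<zero>\<^bsub>A\<^esub> = \<zero>\<^bsub>B\<^esub>"
  by (rule ring_hom_zero[OF hom A.ring_axioms B.ring_axioms])

lemmas hom_simps = ring_hom_add[OF hom] ring_hom_mult[OF hom] ring_hom_one[OF hom]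

lemma push_closed:
  assumes "f \<in> carrier (free_module A X)" shows "(\<lambda>x. \<pi> (f x)) \<in> carrier (free_module B X)"
  using assms free_module_support[OF assms]
  by (intro free_module_carrierI[of _ _ _ "{x. f x \<noteq> \<zero>\<^bsub>A\<^esub>}"]) auto

lemma lift_closed:
  assumes "g \<in> carrier (free_module B X)" shows "(\<lambda>x. \<sigma> (g x)) \<in> carrier (free_module A X)"
  using assms free_module_support[OF assms]
  by (intro free_module_carrierI[of _ _ _ "{x. g x \<noteq> \<zero>\<^bsub>B\<^esub>}"]) auto

lemma push_lift [simp]: "g \<in> carrier (free_module B X) \<Longrightarrow> (\<lambda>x. \<pi> (\<sigma> (g x))) = g"
  by auto

lemma push_single: "a \<in> carrier A \<Longrightarrow> (\<lambda>y. \<pi> (single A x a y)) = single B x (\<pi> a)"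
  by (auto simp: single_def)

text \<open>Such an \<open>f\<close> depends only on the reduction of its argument, because it
  factors through a \<open>B\<close>-linear map on the free module over \<open>B\<close>. This is
  why lifting along a section that need not be additive still yields a linear map.\<close>

lemma semilinear_factor:
  assumes N: "right_module B N" and f: "f \<in> additive_maps (free_module A X) N"
    and sm: "\<And>a u. \<lbrakk>a \<in> carrier A; u \<in> carrier (free_module A X)\<rbrakk> \<Longrightarrow>
      f (a \<odot>\<^bsub>free_module A X\<^esub> u) = \<pi> a \<odot>\<^bsub>N\<^esub> f u"
  shows "\<And>u. u \<in> carrier (free_module A X) \<Longrightarrow> f (\<lambda>x. \<sigma> (\<pi> (u x))) = f u"
    and "(\<lambda>g. f (\<lambda>x. \<sigma> (g x))) \<in> linear_maps B (free_module B X) N"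
proof -
  interpret N: right_module B N by fact
  \<comment> \<open>The factor is forced by the values of \<open>f\<close> on the basis
    vectors.\<close>
  define L where "L = lin_ext B N (\<lambda>x. f (basis_vec A x))"
  have fe: "f (basis_vec A x) \<in> carrier N" if "x \<in> X" for x
    by (rule additive_closed[OF f basis_vec_closed[OF A.ring_axioms that]])
  have L: "L \<in> linear_maps B (free_module B X) N"
    unfolding L_def using fe by (intro lin_ext_linear N.right_module_axioms) auto
  have push: "(\<lambda>u x. \<pi> (u x)) \<in> additive_maps (free_module A X) (free_module B X)"
    by (rule additive_mapsI) (auto intro: push_closed simp: hom_simps)
  have factor: "f u = L (\<lambda>x. \<pi> (u x))" if u: "u \<in> carrier (free_module A X)" for u
  proof (rule additive_eqI[OF A.ring_axioms N.abelian_group f additive_comp[OF push linear_additive[OF L]] _ u])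
    fix x a assume x: "x \<in> X" and a: "a \<in> carrier A"
    have "f (single A x a) = \<pi> a \<odot>\<^bsub>N\<^esub> f (basis_vec A x)"
      using sm[OF a basis_vec_closed[OF A.ring_axioms x]]
      by (simp add: single_smult[OF A.ring_axioms a, of X x, symmetric])
    also have "\<dots> = L (\<lambda>y. \<pi> (single A x a y))"
      using x a fe unfolding L_def by (simp add: push_single lin_ext_single[OF N.right_module_axioms])
    finally show "f (single A x a) = L (\<lambda>y. \<pi> (single A x a y))" .
  qed
  show "f (\<lambda>x. \<sigma> (\<pi> (u x))) = f u" if u: "u \<in> carrier (free_module A X)" for u
    using factor[OF lift_closed[OF push_closed[OF u]]] factor[OF u] push_lift[OF push_closed[OF u]]
    by simp
  have "f (\<lambda>x. \<sigma> (g x)) = L g" if "g \<in> carrier (free_module B X)" for g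
    using factor[OF lift_closed[OF that]] push_lift[OF that] by simp
  then show "(\<lambda>g. f (\<lambda>x. \<sigma> (g x))) \<in> linear_maps B (free_module B X) N"
    using linear_add[OF L] linear_smult[OF L]
      right_module.smult_closed[OF B.right_module_free_module, of _ _ X]
    by (intro linear_mapsI) (simp_all add: linear_closed[OF L] B.free_module_add_closed)
qed

context
  fixes \<phi> :: "('x \<Rightarrow> 'a) \<Rightarrow> 'y \<Rightarrow> 'a" and X Y
  assumes \<phi>: "\<phi> \<in> linear_maps A (free_module A X) (free_module A Y)"
begin

private lemma push_map:
  "(\<lambda>u y. \<pi> (\<phi> u y)) \<in> additive_maps (free_module A X) (free_module B Y)"
  "\<lbrakk>a \<in> carrier A; u \<in> carrier (free_module A X)\<rbrakk> \<Longrightarrow>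
    (\<lambda>y. \<pi> (\<phi> (a \<odot>\<^bsub>free_module A X\<^esub> u) y)) = \<pi> a \<odot>\<^bsub>free_module B Y\<^esub> (\<lambda>y. \<pi> (\<phi> u y))"
  using linear_closed[OF \<phi>] A.free_module_value[OF linear_closed[OF \<phi>]]
    linear_add[OF \<phi>] linear_smult[OF \<phi>]
  by (auto intro!: additive_mapsI push_closed ext simp: hom_simps)

lemma base_change_linear: "base_change \<pi> \<sigma> \<phi> \<in> linear_maps B (free_module B X) (free_module B Y)"
  using semilinear_factor(2)[OF B.right_module_free_module push_map]
  by (simp add: base_change_def[abs_def])

text \<open>Any lift of a vector may be used to compute the base change, not only the one made by
  \<open>\<sigma>\<close>.\<close>

lemma base_change_push:
  "u \<in> carrier (free_module A X) \<Longrightarrow> base_change \<pi> \<sigma> \<phi> (\<lambda>x. \<pi> (u x)) = (\<lambda>y. \<pi> (\<phi> u y))"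
  using semilinear_factor(1)[OF B.right_module_free_module push_map]
  by (simp add: base_change_def)

end

text \<open>The inner value is the reduction of \<open>\<phi>\<close> applied to a lift, and
  \<open>base_change_push\<close> lets that very vector serve as the lift for
  \<open>\<psi>\<close>.\<close>

lemma base_change_comp:
  assumes "\<phi> \<in> linear_maps A (free_module A X) (free_module A Y)"
    and "\<psi> \<in> linear_maps A (free_module A Y) (free_module A Z)" and "g \<in> carrier (free_module B X)"
  shows "base_change \<pi> \<sigma> \<psi> (base_change \<pi> \<sigma> \<phi> g) = base_change \<pi> \<sigma> (\<lambda>u. \<psi> (\<phi> u)) g"
proof -
  have "base_change \<pi> \<sigma> \<psi> (base_change \<pi> \<sigma> \<phi> g)
      = base_change \<pi> \<sigma> \<psi> (\<lambda>y. \<pi> (\<phi> (\<lambda>x. \<sigma> (g x)) y))" by (simp add: base_change_def)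
  also have "\<dots> = (\<lambda>z. \<pi> (\<psi> (\<phi> (\<lambda>x. \<sigma> (g x))) z))"
    by (rule base_change_push[OF assms(2) linear_closed[OF assms(1) lift_closed[OF assms(3)]]])
  finally show ?thesis by (simp add: base_change_def)
qed

end


section \<open>Free resolutions\<close>

text \<open>In degree 0 the outgoing map is the augmentation, so that exactness in all degrees
  becomes the single equation \<open>exact\<close> of the next locale.\<close>

fun syzygies ::
    "('a, 'r) ring_scheme \<Rightarrow> (nat \<Rightarrow> 'x set) \<Rightarrow> (nat \<Rightarrow> ('x \<Rightarrow> 'a) \<Rightarrow> 'x \<Rightarrow> 'a) \<Rightarrow>
     ('a, 'm) module \<Rightarrow> (('x \<Rightarrow> 'a) \<Rightarrow> 'm) \<Rightarrow> nat \<Rightarrow> ('x \<Rightarrow> 'a) set" where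
  "syzygies A X d M aug 0 = {u \<in> carrier (free_module A (X 0)). aug u = \<zero>\<^bsub>M\<^esub>}"
| "syzygies A X d M aug (Suc i) =
    {u \<in> carrier (free_module A (X (Suc i))). d i u = \<zero>\<^bsub>free_module A (X i)\<^esub>}"

locale free_resolution = M: right_module A M
  for A :: "('a, 'r) ring_scheme" and M :: "('a, 'm) module" and X :: "nat \<Rightarrow> 'x set"
    and d :: "nat \<Rightarrow> ('x \<Rightarrow> 'a) \<Rightarrow> 'x \<Rightarrow> 'a" and aug :: "('x \<Rightarrow> 'a) \<Rightarrow> 'm" +
  assumes d_linear: "\<And>i. d i \<in> linear_maps A (free_module A (X (Suc i))) (free_module A (X i))"
    and aug_linear: "aug \<in> linear_maps A (free_module A (X 0)) M"
    and aug_surj: "aug ` carrier (free_module A (X 0)) = carrier M"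
    and exact: "\<And>i. d i ` carrier (free_module A (X (Suc i))) = syzygies A X d M aug i"
begin

sublocale A: ring A by (rule M.ring)

lemma d_syzygy: "u \<in> carrier (free_module A (X (Suc i))) \<Longrightarrow> d i u \<in> syzygies A X d M aug i"
  using exact by blast

lemma aug_d: "u \<in> carrier (free_module A (X (Suc 0))) \<Longrightarrow> aug (d 0 u) = \<zero>\<^bsub>M\<^esub>"
  using d_syzygy[of u 0] by simp

lemma d_d: "u \<in> carrier (free_module A (X (Suc (Suc i)))) \<Longrightarrow> d i (d (Suc i) u) = \<zero>\<^bsub>free_module A (X i)\<^esub>"
  using d_syzygy[of u "Suc i"] by simp

lemma chain_complex_base_change:
  assumes "ring_surjection A K \<alpha> \<iota>"
  shows "chain_complex K (\<lambda>i. free_module K (X i)) (\<lambda>i. base_change \<alpha> \<iota> (d i))"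
proof -
  interpret ring_surjection A K \<alpha> \<iota> by fact
  show ?thesis
  proof (rule chain_complex.intro)
    show "right_module K (free_module K (X i))" for i by (rule B.right_module_free_module)
    show "base_change \<alpha> \<iota> (d i) \<in> linear_maps K (free_module K (X (Suc i))) (free_module K (X i))" for i
      by (rule base_change_linear[OF d_linear])
    fix i x assume x: "x \<in> carrier (free_module K (X (Suc (Suc i))))"
    show "base_change \<alpha> \<iota> (d i) (base_change \<alpha> \<iota> (d (Suc i)) x) = \<zero>\<^bsub>free_module K (X i)\<^esub>"
      using base_change_comp[OF d_linear d_linear x] d_d[OF lift_closed[OF x]]
      by (simp add: base_change_def)
  qed
qed

end

section \<open>Chain maps and null homotopies between two free resolutions\<close>

locale two_resolutions =
  P: free_resolution A M X d aug + Q: free_resolution A M Y d' aug'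
  for A :: "('a, 'r) ring_scheme" and M :: "('a, 'm) module"
    and X :: "nat \<Rightarrow> 'x set" and d aug and Y :: "nat \<Rightarrow> 'y set" and d' aug'
begin

definition chain_map :: "(nat \<Rightarrow> ('x \<Rightarrow> 'a) \<Rightarrow> 'y \<Rightarrow> 'a) \<Rightarrow> bool" where
  "chain_map F \<longleftrightarrow>
    (\<forall>i. F i \<in> linear_maps A (free_module A (X i)) (free_module A (Y i))) \<and>
    (\<forall>i. \<forall>u\<in>carrier (free_module A (X (Suc i))). d' i (F (Suc i) u) = F i (d i u))"

lemma chain_mapD:
  assumes "chain_map F"
  shows "F i \<in> linear_maps A (free_module A (X i)) (free_module A (Y i))"
    "u \<in> carrier (free_module A (X (Suc i))) \<Longrightarrow> d' i (F (Suc i) u) = F i (d i u)"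
  using assms by (auto simp: chain_map_def)

text \<open>The identity of \<open>M\<close> is lifted degree by degree: boundaries in the source
  are syzygies, the map built so far sends them to syzygies of the target, these are boundaries by
  exactness, and freeness of the source provides the next lift.\<close>

lemma ex_chain_map:
  obtains F where "chain_map F"
    "\<And>u. u \<in> carrier (free_module A (X 0)) \<Longrightarrow> aug' (F 0 u) = aug u"
proof -
  \<comment> \<open>The invariant of the recursion: preservation of syzygies is what makes the next
    lifting problem solvable.\<close>
  define lift where "lift i f \<longleftrightarrow> f \<in> linear_maps A (free_module A (X i)) (free_module A (Y i)) \<and>
      f ` syzygies A X d M aug i \<subseteq> syzygies A Y d' M aug' i \<and>
      (i = 0 \<longrightarrow> (\<forall>u\<in>carrier (free_module A (X 0)). aug' (f u) = aug u))" for i f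
  have "\<exists>F. \<forall>i. lift i (F i) \<and>
      (\<forall>u\<in>carrier (free_module A (X (Suc i))). d' i (F (Suc i) u) = F i (d i u))"
  proof (rule dependent_nat_choice)
    obtain f where f: "f \<in> linear_maps A (free_module A (X 0)) (free_module A (Y 0))"
      "\<And>u. u \<in> carrier (free_module A (X 0)) \<Longrightarrow> aug' (f u) = aug u"
    proof (rule free_lift[OF P.M.right_module_axioms P.A.right_module_free_module Q.aug_linear P.aug_linear])
      show "aug (basis_vec A x) \<in> aug' ` carrier (free_module A (Y 0))" if "x \<in> X 0" for x
        using linear_closed[OF P.aug_linear basis_vec_closed[OF P.A.ring_axioms that]] Q.aug_surj by simp
    qed blast
    then have "lift 0 f" by (auto simp: lift_def linear_closed[OF f(1)])
    then show "\<exists>f. lift 0 f" by blast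
  next
    fix f i assume f: "lift i f"
    then have lin: "f \<in> linear_maps A (free_module A (X i)) (free_module A (Y i))"
      and syz: "\<And>u. u \<in> syzygies A X d M aug i \<Longrightarrow> f u \<in> syzygies A Y d' M aug' i"
      by (auto simp: lift_def)
    obtain g where g: "g \<in> linear_maps A (free_module A (X (Suc i))) (free_module A (Y (Suc i)))"
      "\<And>u. u \<in> carrier (free_module A (X (Suc i))) \<Longrightarrow> d' i (g u) = f (d i u)"
    proof (rule free_lift[OF P.A.right_module_free_module P.A.right_module_free_module Q.d_linear
          linear_comp[OF P.d_linear lin]])
      show "f (d i (basis_vec A x)) \<in> d' i ` carrier (free_module A (Y (Suc i)))" if "x \<in> X (Suc i)" for x
        using syz[OF P.d_syzygy[OF basis_vec_closed[OF P.A.ring_axioms that]]] Q.exact by simp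
    qed blast
    moreover from g have "lift (Suc i) g"
      using linear_zero[OF lin P.A.abelian_group_free_module P.A.abelian_group_free_module]
      by (auto simp: lift_def linear_closed[OF g(1)])
    ultimately show "\<exists>g. lift (Suc i) g \<and>
        (\<forall>u\<in>carrier (free_module A (X (Suc i))). d' i (g u) = f (d i u))" by blast
  qed
  then obtain F where "\<And>i. lift i (F i)"
    "\<And>i u. u \<in> carrier (free_module A (X (Suc i))) \<Longrightarrow> d' i (F (Suc i) u) = F i (d i u)" by blast
  then show ?thesis by (intro that[of F]) (auto simp: lift_def chain_map_def)
qed

text \<open>A lift of the zero map is null-homotopic: \<open>F - h d\<close> takes its values in the
  syzygies of the target, hence lifts through \<open>d'\<close> by exactness and freeness.\<close>

lemma ex_null_homotopy:
  assumes F: "chain_map F"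
    and aug: "\<And>u. u \<in> carrier (free_module A (X 0)) \<Longrightarrow> aug' (F 0 u) = \<zero>\<^bsub>M\<^esub>"
  obtains h where
    "\<And>i. h i \<in> linear_maps A (free_module A (X i)) (free_module A (Y (Suc i)))"
    "\<And>u. u \<in> carrier (free_module A (X 0)) \<Longrightarrow> d' 0 (h 0 u) = F 0 u"
    "\<And>i u. u \<in> carrier (free_module A (X (Suc i))) \<Longrightarrow>
      d' (Suc i) (h (Suc i) u) = F (Suc i) u \<ominus>\<^bsub>free_module A (Y (Suc i))\<^esub> h i (d i u)"
proof -
  note FD = chain_mapD[OF F]
  \<comment> \<open>On syzygies the homotopy identity loses its term \<open>h (d u)\<close>; this
    instance is what the next degree needs in order to see that \<open>F - h d\<close> is killed by
    \<open>d'\<close>.\<close>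
  define htpy where "htpy i f \<longleftrightarrow> f \<in> linear_maps A (free_module A (X i)) (free_module A (Y (Suc i))) \<and>
      (\<forall>u\<in>syzygies A X d M aug i. d' i (f u) = F i u) \<and>
      (i = 0 \<longrightarrow> (\<forall>u\<in>carrier (free_module A (X 0)). d' 0 (f u) = F 0 u))" for i f
  have "\<exists>h. \<forall>i. htpy i (h i) \<and> (\<forall>u\<in>carrier (free_module A (X (Suc i))).
      d' (Suc i) (h (Suc i) u) = F (Suc i) u \<ominus>\<^bsub>free_module A (Y (Suc i))\<^esub> h i (d i u))"
  proof (rule dependent_nat_choice)
    obtain f where f: "f \<in> linear_maps A (free_module A (X 0)) (free_module A (Y (Suc 0)))"
      "\<And>u. u \<in> carrier (free_module A (X 0)) \<Longrightarrow> d' 0 (f u) = F 0 u"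
    proof (rule free_lift[OF P.A.right_module_free_module P.A.right_module_free_module Q.d_linear FD(1)])
      show "F 0 (basis_vec A x) \<in> d' 0 ` carrier (free_module A (Y (Suc 0)))" if "x \<in> X 0" for x
        using aug[OF basis_vec_closed[OF P.A.ring_axioms that]]
          linear_closed[OF FD(1) basis_vec_closed[OF P.A.ring_axioms that]] Q.exact[of 0] by simp
    qed blast
    then have "htpy 0 f" by (auto simp: htpy_def)
    then show "\<exists>f. htpy 0 f" by blast
  next
    fix f i assume f: "htpy i f"
    then have lin: "f \<in> linear_maps A (free_module A (X i)) (free_module A (Y (Suc i)))"
      and syz: "\<And>u. u \<in> syzygies A X d M aug i \<Longrightarrow> d' i (f u) = F i u"
      by (auto simp: htpy_def)
    let ?Y = "free_module A (Y (Suc i))"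
    interpret Yi: right_module A "free_module A (Y i)" by (rule P.A.right_module_free_module)
    interpret YS: right_module A ?Y by (rule P.A.right_module_free_module)
    have lin': "(\<lambda>u. F (Suc i) u \<ominus>\<^bsub>?Y\<^esub> f (d i u)) \<in> linear_maps A (free_module A (X (Suc i))) ?Y"
      by (rule linear_diff[OF FD(1) linear_comp[OF P.d_linear lin]
            P.A.right_module_free_module P.A.right_module_free_module])
    obtain g where g: "g \<in> linear_maps A (free_module A (X (Suc i))) (free_module A (Y (Suc (Suc i))))"
      "\<And>u. u \<in> carrier (free_module A (X (Suc i))) \<Longrightarrow> d' (Suc i) (g u) = F (Suc i) u \<ominus>\<^bsub>?Y\<^esub> f (d i u)"
    proof (rule free_lift[OF P.A.right_module_free_module P.A.right_module_free_module Q.d_linear lin'])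
      fix x assume "x \<in> X (Suc i)"
      then have x: "basis_vec A x \<in> carrier (free_module A (X (Suc i)))"
        by (rule basis_vec_closed[OF P.A.ring_axioms])
      have c: "F (Suc i) (basis_vec A x) \<in> carrier ?Y" "f (d i (basis_vec A x)) \<in> carrier ?Y"
        by (rule linear_closed[OF FD(1) x], rule linear_closed[OF lin linear_closed[OF P.d_linear x]])
      have "d' i (F (Suc i) (basis_vec A x) \<ominus>\<^bsub>?Y\<^esub> f (d i (basis_vec A x)))
          = F i (d i (basis_vec A x)) \<ominus>\<^bsub>free_module A (Y i)\<^esub> F i (d i (basis_vec A x))"
        using c FD(2)[OF x] syz[OF P.d_syzygy[OF x]]
        by (simp only: linear_minus[OF Q.d_linear YS.abelian_group Yi.abelian_group])
      also have "\<dots> = \<zero>\<^bsub>free_module A (Y i)\<^esub>"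
        using linear_closed[OF FD(1) linear_closed[OF P.d_linear x]]
        by (simp only: a_minus_def Yi.r_neg)
      finally show "F (Suc i) (basis_vec A x) \<ominus>\<^bsub>?Y\<^esub> f (d i (basis_vec A x))
          \<in> d' (Suc i) ` carrier (free_module A (Y (Suc (Suc i))))"
        using c Q.exact[of "Suc i"] YS.minus_closed[OF c] by simp
    qed blast
    moreover have "d' (Suc i) (g u) = F (Suc i) u" if u: "u \<in> syzygies A X d M aug (Suc i)" for u
    proof -
      have uc: "u \<in> carrier (free_module A (X (Suc i)))" and du: "d i u = \<zero>\<^bsub>free_module A (X i)\<^esub>"
        using u by auto
      have "f (d i u) = \<zero>\<^bsub>?Y\<^esub>"
        unfolding du by (rule linear_zero[OF lin P.A.abelian_group_free_module YS.abelian_group])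
      moreover have "\<ominus>\<^bsub>?Y\<^esub> \<zero>\<^bsub>?Y\<^esub> = \<zero>\<^bsub>?Y\<^esub>"
        by (rule YS.minus_equality[OF YS.l_zero[OF YS.zero_closed] YS.zero_closed YS.zero_closed])
      ultimately show ?thesis
        using g(2)[OF uc] linear_closed[OF FD(1) uc]
        by (simp only: a_minus_def YS.r_zero)
    qed
    ultimately show "\<exists>g. htpy (Suc i) g \<and> (\<forall>u\<in>carrier (free_module A (X (Suc i))).
        d' (Suc i) (g u) = F (Suc i) u \<ominus>\<^bsub>?Y\<^esub> f (d i u))"
      by (intro exI[of _ g]) (auto simp: htpy_def)
  qed
  then obtain h where "\<And>i. htpy i (h i)"
    "\<And>i u. u \<in> carrier (free_module A (X (Suc i))) \<Longrightarrow>
      d' (Suc i) (h (Suc i) u) = F (Suc i) u \<ominus>\<^bsub>free_module A (Y (Suc i))\<^esub> h i (d i u)" by blast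
  then show ?thesis by (intro that[of h]) (auto simp: htpy_def)
qed

text \<open>The homotopy identity is reduced to \<open>K\<close>. The lift \<open>?z\<close> of a
  cycle \<open>z\<close> need not be a cycle, but its boundary reduces to zero, and so does the
  image of that boundary under \<open>h\<close>.\<close>

lemma base_change_null:
  assumes "ring_surjection A K \<alpha> \<iota>" and F: "chain_map F"
    and aug: "\<And>u. u \<in> carrier (free_module A (X 0)) \<Longrightarrow> aug' (F 0 u) = \<zero>\<^bsub>M\<^esub>"
    and z: "z \<in> cycles (\<lambda>i. free_module K (X i)) (\<lambda>i. base_change \<alpha> \<iota> (d i)) i"
  shows "\<exists>w\<in>carrier (free_module K (Y (Suc i))). base_change \<alpha> \<iota> (F i) z = base_change \<alpha> \<iota> (d' i) w"
proof -
  interpret ring_surjection A K \<alpha> \<iota> by fact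
  note FD = chain_mapD[OF F]
  obtain h where h: "\<And>i. h i \<in> linear_maps A (free_module A (X i)) (free_module A (Y (Suc i)))"
    "\<And>u. u \<in> carrier (free_module A (X 0)) \<Longrightarrow> d' 0 (h 0 u) = F 0 u"
    "\<And>i u. u \<in> carrier (free_module A (X (Suc i))) \<Longrightarrow>
      d' (Suc i) (h (Suc i) u) = F (Suc i) u \<ominus>\<^bsub>free_module A (Y (Suc i))\<^esub> h i (d i u)"
    by (rule ex_null_homotopy[OF F aug]; (assumption | rule that))
  have zc: "z \<in> carrier (free_module K (X i))" using z by (cases i) auto
  let ?z = "\<lambda>x. \<iota> (z x)"
  have zl: "?z \<in> carrier (free_module A (X i))" by (rule lift_closed[OF zc])
  have dh: "base_change \<alpha> \<iota> (d' i) (base_change \<alpha> \<iota> (h i) z) = (\<lambda>y. \<alpha> (d' i (h i ?z) y))"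
    using base_change_comp[OF h(1) Q.d_linear zc] by (simp add: base_change_def)
  have "(\<lambda>y. \<alpha> (d' i (h i ?z) y)) = (\<lambda>y. \<alpha> (F i ?z y))"
  proof (cases i)
    case 0
    then show ?thesis using h(2) zl by simp
  next
    case (Suc j)
    have zl': "?z \<in> carrier (free_module A (X (Suc j)))" using zl Suc by simp
    note Fc = linear_closed[OF FD(1) zl'] and dz = linear_closed[OF P.d_linear zl']
    have hd: "(\<lambda>y. \<alpha> (h j (d j ?z) y)) = (\<lambda>y. \<zero>\<^bsub>K\<^esub>)"
    proof -
      have "(\<lambda>y. \<alpha> (h j (d j ?z) y)) = base_change \<alpha> \<iota> (h j) (\<lambda>x. \<alpha> (d j ?z x))"
        by (rule base_change_push[OF h(1) dz, symmetric])
      also have "(\<lambda>x. \<alpha> (d j ?z x)) = \<zero>\<^bsub>free_module K (X j)\<^esub>"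
        using z Suc by (simp add: base_change_def)
      also have "base_change \<alpha> \<iota> (h j) \<zero>\<^bsub>free_module K (X j)\<^esub> = (\<lambda>y. \<zero>\<^bsub>K\<^esub>)"
        using linear_zero[OF base_change_linear[OF h(1)] B.abelian_group_free_module
            B.abelian_group_free_module] by simp
      finally show ?thesis .
    qed
    have \<alpha>: "\<alpha> \<in> additive_maps A K" by (rule additive_mapsI) (auto simp: hom_simps)
    have "\<alpha> (d' i (h i ?z) y) = \<alpha> (F i ?z y)" for y
    proof -
      have hc: "h j (d j ?z) \<in> carrier (free_module A (Y (Suc j)))" by (rule linear_closed[OF h(1) dz])
      have "\<alpha> (d' i (h i ?z) y) = \<alpha> (F i ?z y \<ominus>\<^bsub>A\<^esub> h j (d j ?z) y)"
        using h(3)[OF zl'] Suc by (simp add: P.A.free_module_minus[OF Fc hc])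
      also have "\<dots> = \<alpha> (F i ?z y) \<ominus>\<^bsub>K\<^esub> \<alpha> (h j (d j ?z) y)"
        using Fc hc Suc
        by (intro additive_minus[OF \<alpha> P.A.is_abelian_group B.is_abelian_group]) auto
      also have "\<alpha> (h j (d j ?z) y) = \<zero>\<^bsub>K\<^esub>" using fun_cong[OF hd] by simp
      also have "\<alpha> (F i ?z y) \<ominus>\<^bsub>K\<^esub> \<zero>\<^bsub>K\<^esub> = \<alpha> (F i ?z y)"
        using Fc Suc by (simp add: a_minus_def)
      finally show ?thesis .
    qed
    then show ?thesis by auto
  qed
  then have "base_change \<alpha> \<iota> (F i) z = base_change \<alpha> \<iota> (d' i) (base_change \<alpha> \<iota> (h i) z)"
    using dh by (simp add: base_change_def[of \<alpha> \<iota> "F i"])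
  then show ?thesis
    using linear_closed[OF base_change_linear[OF h(1)] zc] by blast
qed

end

lemma (in two_resolutions) chain_map_comp_minus_id:
  assumes F: "chain_map F" and G: "two_resolutions.chain_map A Y d' X d G"
  shows "two_resolutions.chain_map A X d X d (\<lambda>i u. G i (F i u) \<ominus>\<^bsub>free_module A (X i)\<^esub> u)"
proof -
  interpret R: two_resolutions A M Y d' aug' X d aug by unfold_locales
  interpret S: two_resolutions A M X d aug X d aug by unfold_locales
  note FD = chain_mapD[OF F] and GD = R.chain_mapD[OF G]
  note ab = P.A.abelian_group_free_module
  show ?thesis unfolding S.chain_map_def
  proof (intro conjI allI ballI)
    show "(\<lambda>u. G i (F i u) \<ominus>\<^bsub>free_module A (X i)\<^esub> u) \<in> linear_maps A (free_module A (X i)) (free_module A (X i))" for i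
      by (rule linear_diff[OF linear_comp[OF FD(1) GD(1)] linear_id
            P.A.right_module_free_module P.A.right_module_free_module])
    fix i u assume u: "u \<in> carrier (free_module A (X (Suc i)))"
    show "d i (G (Suc i) (F (Suc i) u) \<ominus>\<^bsub>free_module A (X (Suc i))\<^esub> u)
        = G i (F i (d i u)) \<ominus>\<^bsub>free_module A (X i)\<^esub> d i u"
      using u by (simp only: linear_minus[OF P.d_linear ab ab] linear_closed[OF FD(1)]
        linear_closed[OF GD(1)] GD(2) FD(2))
  qed
qed

text \<open>\<open>G F - id\<close> lifts the zero map of \<open>M\<close> and is therefore
  null-homotopic; after reduction it sends cycles to boundaries.\<close>

lemma (in two_resolutions) base_change_homotopy_inverse:
  assumes "ring_surjection A K \<alpha> \<iota>"
    and F: "chain_map F" "\<And>u. u \<in> carrier (free_module A (X 0)) \<Longrightarrow> aug' (F 0 u) = aug u"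
    and G: "two_resolutions.chain_map A Y d' X d G"
      "\<And>u. u \<in> carrier (free_module A (Y 0)) \<Longrightarrow> aug (G 0 u) = aug' u"
    and z: "z \<in> cycles (\<lambda>i. free_module K (X i)) (\<lambda>i. base_change \<alpha> \<iota> (d i)) i"
  shows "\<exists>w\<in>carrier (free_module K (X (Suc i))).
    base_change \<alpha> \<iota> (G i) (base_change \<alpha> \<iota> (F i) z) \<ominus>\<^bsub>free_module K (X i)\<^esub> z = base_change \<alpha> \<iota> (d i) w"
proof -
  interpret ring_surjection A K \<alpha> \<iota> by fact
  interpret QP: two_resolutions A M Y d' aug' X d aug by unfold_locales
  interpret PP: two_resolutions A M X d aug X d aug by unfold_locales
  note FD = chain_mapD[OF F(1)] and GD = QP.chain_mapD[OF G(1)]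
  note ab = P.A.abelian_group_free_module
  let ?b = "base_change \<alpha> \<iota>"
  have zc: "z \<in> carrier (free_module K (X i))" using z by (cases i) auto
  have "\<exists>w\<in>carrier (free_module K (X (Suc i))).
      ?b (\<lambda>u. G i (F i u) \<ominus>\<^bsub>free_module A (X i)\<^esub> u) z = ?b (d i) w"
  proof (rule PP.base_change_null[OF assms(1) chain_map_comp_minus_id[OF F(1) G(1)] _ z])
    fix u assume u: "u \<in> carrier (free_module A (X 0))"
    show "aug (G 0 (F 0 u) \<ominus>\<^bsub>free_module A (X 0)\<^esub> u) = \<zero>\<^bsub>M\<^esub>"
      using u linear_closed[OF P.aug_linear u]
      by (simp only: linear_minus[OF P.aug_linear ab P.M.abelian_group] linear_closed[OF FD(1)]
        linear_closed[OF GD(1)] F(2) G(2)) (simp add: a_minus_def P.M.r_neg)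
  qed
  moreover have "?b (\<lambda>u. G i (F i u) \<ominus>\<^bsub>free_module A (X i)\<^esub> u) z
      = ?b (G i) (?b (F i) z) \<ominus>\<^bsub>free_module K (X i)\<^esub> z"
  proof -
    note zl = lift_closed[OF zc]
    note c = linear_closed[OF GD(1) linear_closed[OF FD(1) zl]]
    have \<alpha>: "\<alpha> \<in> additive_maps A K" by (rule additive_mapsI) (auto simp: hom_simps)
    show ?thesis
      using c zl zc push_closed[OF c]
      by (simp add: base_change_comp[OF FD(1) GD(1) zc] B.free_module_minus)
        (simp add: base_change_def P.A.free_module_minus B.free_module_minus
          additive_minus[OF \<alpha> P.A.is_abelian_group B.is_abelian_group])
  qed
  ultimately show ?thesis by simp
qed

text \<open>Chain maps in both directions lift the identity of \<open>M\<close>, and both composites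
  are homotopic to the identity. The homotopies are used for individual cycles, which is the form
  that \<open>homology_iso\<close> asks for.\<close>

theorem comparison:
  assumes P: "free_resolution A M X d aug" and Q: "free_resolution A M Y d' aug'"
    and "ring_surjection A K \<alpha> \<iota>"
  shows "graded_isomorphic K
    (homology (\<lambda>i. free_module K (X i)) (\<lambda>i. base_change \<alpha> \<iota> (d i)))
    (homology (\<lambda>i. free_module K (Y i)) (\<lambda>i. base_change \<alpha> \<iota> (d' i)))"
proof -
  interpret ring_surjection A K \<alpha> \<iota> by fact
  interpret P: free_resolution A M X d aug by fact
  interpret Q: free_resolution A M Y d' aug' by fact
  interpret PQ: two_resolutions A M X d aug Y d' aug' by unfold_locales
  interpret QP: two_resolutions A M Y d' aug' X d aug by unfold_locales
  interpret CP: chain_complex K "\<lambda>i. free_module K (X i)" "\<lambda>i. base_change \<alpha> \<iota> (d i)"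
    by (rule P.chain_complex_base_change) fact
  interpret CQ: chain_complex K "\<lambda>i. free_module K (Y i)" "\<lambda>i. base_change \<alpha> \<iota> (d' i)"
    by (rule Q.chain_complex_base_change) fact
  obtain F where F: "PQ.chain_map F" "\<And>u. u \<in> carrier (free_module A (X 0)) \<Longrightarrow> aug' (F 0 u) = aug u"
    by (rule PQ.ex_chain_map) (rule that)
  obtain G where G: "QP.chain_map G" "\<And>u. u \<in> carrier (free_module A (Y 0)) \<Longrightarrow> aug (G 0 u) = aug' u"
    by (rule QP.ex_chain_map) (rule that)
  note FD = PQ.chain_mapD[OF F(1)] and GD = QP.chain_mapD[OF G(1)]
  let ?b = "base_change \<alpha> \<iota>"
  have comm: "?b (d' i) (?b (F (Suc i)) x) = ?b (F i) (?b (d i) x)"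
    if "x \<in> carrier (free_module K (X (Suc i)))" for i x
    using that base_change_comp[OF FD(1) Q.d_linear that] base_change_comp[OF P.d_linear FD(1) that]
    by (simp add: base_change_def FD(2) lift_closed)
  have comm': "?b (d i) (?b (G (Suc i)) x) = ?b (G i) (?b (d' i) x)"
    if "x \<in> carrier (free_module K (Y (Suc i)))" for i x
    using that base_change_comp[OF GD(1) P.d_linear that] base_change_comp[OF Q.d_linear GD(1) that]
    by (simp add: base_change_def GD(2) lift_closed)
  have GF: "\<exists>w\<in>carrier (free_module K (X (Suc i))).
      ?b (G i) (?b (F i) z) \<ominus>\<^bsub>free_module K (X i)\<^esub> z = ?b (d i) w"
    if "z \<in> cycles (\<lambda>i. free_module K (X i)) (\<lambda>i. ?b (d i)) i" for i z
    by (rule PQ.base_change_homotopy_inverse[OF assms(3) F G that])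
  have FG: "\<exists>w\<in>carrier (free_module K (Y (Suc i))).
      ?b (F i) (?b (G i) z) \<ominus>\<^bsub>free_module K (Y i)\<^esub> z = ?b (d' i) w"
    if "z \<in> cycles (\<lambda>i. free_module K (Y i)) (\<lambda>i. ?b (d' i)) i" for i z
    by (rule QP.base_change_homotopy_inverse[OF assms(3) G F that])
  show ?thesis
  proof (rule homology_iso[OF CP.chain_complex_axioms CQ.chain_complex_axioms, where f = "\<lambda>i. ?b (F i)"])
    show "?b (F i) \<in> linear_maps K (free_module K (X i)) (free_module K (Y i))" for i
      by (rule base_change_linear[OF FD(1)])
    show "?b (d' i) (?b (F (Suc i)) x) = ?b (F i) (?b (d i) x)"
      if "x \<in> carrier (free_module K (X (Suc i)))" for i x by (rule comm[OF that])
  next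
    fix i z w assume z: "z \<in> cycles (\<lambda>i. free_module K (X i)) (\<lambda>i. ?b (d i)) i"
      and w: "w \<in> carrier (free_module K (Y (Suc i)))" and eq: "?b (F i) z = ?b (d' i) w"
    let ?Xi = "free_module K (X i)"
    interpret Xi: abelian_group ?Xi by (rule B.abelian_group_free_module)
    have zc: "z \<in> carrier ?Xi" using submoduleD(1)[OF CP.submodule_cycles] z by blast
    obtain v where v: "v \<in> carrier (free_module K (X (Suc i)))"
      "?b (G i) (?b (F i) z) \<ominus>\<^bsub>?Xi\<^esub> z = ?b (d i) v" using GF[OF z] by blast
    have Gw: "?b (G (Suc i)) w \<in> carrier (free_module K (X (Suc i)))"
      by (rule linear_closed[OF base_change_linear[OF GD(1)] w])
    \<comment> \<open>If \<open>F z = d' w\<close> and \<open>G (F z) - z = d v\<close>, then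
      \<open>z = d (G w - v)\<close>.\<close>
    let ?y = "?b (G (Suc i)) w \<ominus>\<^bsub>free_module K (X (Suc i))\<^esub> v"
    have "?b (d i) ?y = ?b (d i) (?b (G (Suc i)) w) \<ominus>\<^bsub>?Xi\<^esub> ?b (d i) v"
      by (rule linear_minus[OF CP.d_linear B.abelian_group_free_module B.abelian_group_free_module Gw v(1)])
    also have "?b (d i) (?b (G (Suc i)) w) = ?b (G i) (?b (F i) z)"
      using comm'[OF w] eq by simp
    also have "?b (G i) (?b (F i) z) \<ominus>\<^bsub>?Xi\<^esub> ?b (d i) v
        = ?b (G i) (?b (F i) z) \<ominus>\<^bsub>?Xi\<^esub> (?b (G i) (?b (F i) z) \<ominus>\<^bsub>?Xi\<^esub> z)" using v by simp
    also have "\<dots> = z"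
    proof -
      have c: "?b (G i) (?b (F i) z) \<in> carrier ?Xi"
        by (rule linear_closed[OF base_change_linear[OF GD(1)] linear_closed[OF base_change_linear[OF FD(1)] zc]])
      show ?thesis using c zc
        by (simp only: a_minus_def Xi.minus_add Xi.minus_minus Xi.a_inv_closed Xi.a_assoc[symmetric] Xi.r_neg Xi.l_zero)
    qed
    finally have "?b (d i) ?y = z" .
    moreover have "?y \<in> carrier (free_module K (X (Suc i)))"
      by (rule abelian_group.minus_closed[OF B.abelian_group_free_module Gw v(1)])
    ultimately show "z \<in> ?b (d i) ` carrier (free_module K (X (Suc i)))" by blast
  next
    fix i z' assume z': "z' \<in> cycles (\<lambda>i. free_module K (Y i)) (\<lambda>i. ?b (d' i)) i"
    let ?Yi = "free_module K (Y i)"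
    interpret Yi: abelian_group ?Yi by (rule B.abelian_group_free_module)
    interpret YS: abelian_group "free_module K (Y (Suc i))" by (rule B.abelian_group_free_module)
    have zc: "z' \<in> carrier ?Yi" using submoduleD(1)[OF CQ.submodule_cycles] z' by blast
    obtain v where v: "v \<in> carrier (free_module K (Y (Suc i)))"
      "?b (F i) (?b (G i) z') \<ominus>\<^bsub>?Yi\<^esub> z' = ?b (d' i) v" using FG[OF z'] by blast
    have zero: "?b (G j) \<zero>\<^bsub>free_module K (Y j)\<^esub> = \<zero>\<^bsub>free_module K (X j)\<^esub>" for j
      by (rule linear_zero[OF base_change_linear[OF GD(1)] B.abelian_group_free_module B.abelian_group_free_module])
    \<comment> \<open>The class of \<open>z'\<close> comes from the cycle \<open>G z'\<close>: the
      equation \<open>F (G z') - z' = d' v\<close> gives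
      \<open>z' = d' (- v) + F (G z')\<close>.\<close>
    have Gz: "?b (G i) z' \<in> cycles (\<lambda>i. free_module K (X i)) (\<lambda>i. ?b (d i)) i"
    proof (cases i)
      case 0
      then show ?thesis using linear_closed[OF base_change_linear[OF GD(1)] zc] by simp
    next
      case (Suc j)
      then have "z' \<in> carrier (free_module K (Y (Suc j)))"
        "?b (d' j) z' = \<zero>\<^bsub>free_module K (Y j)\<^esub>" using z' by auto
      then show ?thesis
        using Suc comm'[of z' j] zero[of j] linear_closed[OF base_change_linear[OF GD(1)] zc] by simp
    qed
    have c: "?b (F i) (?b (G i) z') \<in> carrier ?Yi"
      by (rule linear_closed[OF base_change_linear[OF FD(1)] linear_closed[OF base_change_linear[OF GD(1)] zc]])
    have neg: "?b (d' i) (\<ominus>\<^bsub>free_module K (Y (Suc i))\<^esub> v) = \<ominus>\<^bsub>?Yi\<^esub> ?b (d' i) v"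
      by (rule additive_neg[OF linear_additive[OF CQ.d_linear] YS.abelian_group_axioms Yi.abelian_group_axioms v(1)])
    have "\<ominus>\<^bsub>?Yi\<^esub> ?b (d' i) v \<oplus>\<^bsub>?Yi\<^esub> ?b (F i) (?b (G i) z') = z'"
      using c zc unfolding v(2)[symmetric] a_minus_def
      by (simp only: Yi.minus_add Yi.minus_minus Yi.a_inv_closed Yi.a_ac Yi.a_closed Yi.l_neg Yi.r_neg Yi.r_zero)
    then have "z' = ?b (d' i) (\<ominus>\<^bsub>free_module K (Y (Suc i))\<^esub> v) \<oplus>\<^bsub>?Yi\<^esub> ?b (F i) (?b (G i) z')"
      unfolding neg by (rule sym)
    then show "\<exists>z\<in>cycles (\<lambda>i. free_module K (X i)) (\<lambda>i. ?b (d i)) i.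
        \<exists>w\<in>carrier (free_module K (Y (Suc i))). z' = ?b (d' i) w \<oplus>\<^bsub>?Yi\<^esub> ?b (F i) z"
      using Gz YS.a_inv_closed[OF v(1)] by blast
  qed
qed

text \<open>Multiplication by \<open>\<eta>\<close> lifts cycles over \<open>B\<close> to cycles over \<open>A\<close>.\<close>

theorem free_resolution_base_change:
  assumes "free_resolution A M X d aug" and "ring_surjection A B \<pi> \<sigma>"
    and N: "right_module B N" and MN: "carrier N = carrier M" "zero N = zero M" "add N = add M"
      "\<And>a x. \<lbrakk>a \<in> carrier A; x \<in> carrier M\<rbrakk> \<Longrightarrow> a \<odot>\<^bsub>M\<^esub> x = \<pi> a \<odot>\<^bsub>N\<^esub> x"
    and \<eta>: "\<eta> \<in> carrier A" "\<pi> \<eta> = \<one>\<^bsub>B\<^esub>" "\<And>a. \<lbrakk>a \<in> carrier A; \<pi> a = \<zero>\<^bsub>B\<^esub>\<rbrakk> \<Longrightarrow> a \<otimes>\<^bsub>A\<^esub> \<eta> = \<zero>\<^bsub>A\<^esub>"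
  shows "free_resolution B N X (\<lambda>i. base_change \<pi> \<sigma> (d i)) (\<lambda>g. aug (\<lambda>x. \<sigma> (g x)))"
proof -
  interpret ring_surjection A B \<pi> \<sigma> by fact
  interpret P: free_resolution A M X d aug by fact
  interpret N: right_module B N by fact
  let ?b = "base_change \<pi> \<sigma>"
  have aug_add: "aug \<in> additive_maps (free_module A (X 0)) N"
    using P.aug_linear MN by (simp add: linear_maps_def additive_maps_def)
  have aug_sm: "aug (a \<odot>\<^bsub>free_module A (X 0)\<^esub> u) = \<pi> a \<odot>\<^bsub>N\<^esub> aug u"
    if "a \<in> carrier A" "u \<in> carrier (free_module A (X 0))" for a u
    using that by (simp only: linear_smult[OF P.aug_linear] MN(4) linear_closed[OF P.aug_linear])
  have aug_sl: "\<And>u. u \<in> carrier (free_module A (X 0)) \<Longrightarrow> aug (\<lambda>x. \<sigma> (\<pi> (u x))) = aug u"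
      "(\<lambda>g. aug (\<lambda>x. \<sigma> (g x))) \<in> linear_maps B (free_module B (X 0)) N"
    by (rule semilinear_factor[OF N aug_add aug_sm]; assumption)+
  show ?thesis
  proof (intro free_resolution.intro N free_resolution_axioms.intro)
    show "?b (d i) \<in> linear_maps B (free_module B (X (Suc i))) (free_module B (X i))" for i
      by (rule base_change_linear[OF P.d_linear])
    show "(\<lambda>g. aug (\<lambda>x. \<sigma> (g x))) \<in> linear_maps B (free_module B (X 0)) N"
      by (rule aug_sl(2))
    show "(\<lambda>g. aug (\<lambda>x. \<sigma> (g x))) ` carrier (free_module B (X 0)) = carrier N"
    proof (intro equalityI subsetI)
      fix c assume "c \<in> carrier N"
      then have "c \<in> aug ` carrier (free_module A (X 0))" using P.aug_surj MN by simp
      then obtain u where u: "u \<in> carrier (free_module A (X 0))" "aug u = c" by blast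
      then show "c \<in> (\<lambda>g. aug (\<lambda>x. \<sigma> (g x))) ` carrier (free_module B (X 0))"
        using aug_sl(1)[OF u(1)] push_closed[OF u(1)] by (auto intro!: image_eqI[of _ _ "\<lambda>x. \<pi> (u x)"])
    qed (use linear_closed[OF aug_sl(2)] in auto)
    fix i
    show "?b (d i) ` carrier (free_module B (X (Suc i))) = syzygies B X (\<lambda>i. ?b (d i)) N (\<lambda>g. aug (\<lambda>x. \<sigma> (g x))) i"
      (is "_ = ?S i")
    proof (intro equalityI subsetI)
      fix z assume "z \<in> ?b (d i) ` carrier (free_module B (X (Suc i)))"
      then obtain g where g: "g \<in> carrier (free_module B (X (Suc i)))" "z = ?b (d i) g" by auto
      note gl = lift_closed[OF g(1)] and zc = linear_closed[OF base_change_linear[OF P.d_linear] g(1)]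
      show "z \<in> ?S i"
      proof (cases i)
        case 0
        then show ?thesis
          using zc g gl aug_sl(1)[OF linear_closed[OF P.d_linear gl[unfolded 0]]] P.aug_d[of "\<lambda>x. \<sigma> (g x)"] MN
          by (simp add: base_change_def)
      next
        case (Suc j)
        then show ?thesis
          using zc g gl base_change_comp[OF P.d_linear P.d_linear g(1)[unfolded Suc]] P.d_d[of "\<lambda>x. \<sigma> (g x)"]
          by (simp add: base_change_def)
      qed
    next
      fix z assume z: "z \<in> ?S i"
      then have zc: "z \<in> carrier (free_module B (X i))" by (cases i) auto
      note zl = lift_closed[OF zc]
      interpret Xi: right_module A "free_module A (X i)" by (rule A.right_module_free_module)
      \<comment> \<open>The corrected lift of \<open>z\<close>. In degree 0 the plain lift is
        already killed by \<open>aug\<close>, since the augmentation over \<open>B\<close> is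
        computed from it. In higher degrees its boundary has coordinates in the kernel of
        \<open>\<pi>\<close>, which \<open>\<eta>\<close> annihilates from the right.\<close>
      let ?u = "\<eta> \<odot>\<^bsub>free_module A (X i)\<^esub> (\<lambda>x. \<sigma> (z x))"
      have uc: "?u \<in> carrier (free_module A (X i))" using \<eta>(1) zl by (rule Xi.smult_closed)
      have "?u \<in> syzygies A X d M aug i"
      proof (cases i)
        case 0
        have "aug (\<lambda>x. \<sigma> (z x)) = \<zero>\<^bsub>M\<^esub>" using z 0 MN by simp
        then have "aug ?u = \<zero>\<^bsub>M\<^esub>"
          using linear_smult[OF P.aug_linear \<eta>(1) zl[unfolded 0]] \<eta>(1) 0
          by (simp only: P.M.smult_r_null)
        then show ?thesis using uc 0 by simp
      next
        case (Suc j)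
        note dz = linear_closed[OF P.d_linear zl[unfolded Suc]]
        have \<pi>dz: "\<pi> (d j (\<lambda>x. \<sigma> (z x)) y) = \<zero>\<^bsub>B\<^esub>" for y
          using z Suc by (auto simp: base_change_def dest: fun_cong)
        have "d j ?u = \<eta> \<odot>\<^bsub>free_module A (X j)\<^esub> d j (\<lambda>x. \<sigma> (z x))"
          using linear_smult[OF P.d_linear \<eta>(1) zl[unfolded Suc]] Suc by simp
        also have "\<dots> = \<zero>\<^bsub>free_module A (X j)\<^esub>"
          using A.free_module_value[OF dz] by (simp add: \<eta>(3) \<pi>dz)
        finally show ?thesis using uc Suc by simp
      qed
      then obtain w where w: "w \<in> carrier (free_module A (X (Suc i)))" "d i w = ?u"
        using P.exact[of i] by (metis imageE)
      have "?b (d i) (\<lambda>x. \<pi> (w x)) = (\<lambda>x. \<pi> (?u x))"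
        using base_change_push[OF P.d_linear w(1)] w(2) by simp
      \<comment> \<open>The correction is invisible after reduction because
        \<open>\<pi> \<eta> = \<one>\<close>.\<close>
      also have "\<dots> = z"
        using zc \<eta> B.free_module_value[OF zc] by (auto simp: hom_simps)
      finally show "z \<in> ?b (d i) ` carrier (free_module B (X (Suc i)))"
        using push_closed[OF w(1)] by (metis imageI)
    qed
  qed
qed

text \<open>The composite of \<open>\<sigma>\<close> and \<open>\<iota>'\<close> may differ from
  \<open>\<iota>\<close>, but it also lifts \<open>g\<close> along \<open>\<alpha>\<close>, and all
  lifts give the same result.\<close>

lemma base_change_base_change:
  assumes "ring_surjection A B \<pi> \<sigma>" "ring_surjection B K \<beta> \<iota>'" "ring_surjection A K \<alpha> \<iota>"
    and \<alpha>: "\<And>a. a \<in> carrier A \<Longrightarrow> \<alpha> a = \<beta> (\<pi> a)"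
    and \<phi>: "\<phi> \<in> linear_maps A (free_module A X) (free_module A Y)"
    and g: "g \<in> carrier (free_module K X)"
  shows "base_change \<beta> \<iota>' (base_change \<pi> \<sigma> \<phi>) g = base_change \<alpha> \<iota> \<phi> g"
proof -
  interpret AB: ring_surjection A B \<pi> \<sigma> by fact
  interpret BK: ring_surjection B K \<beta> \<iota>' by fact
  interpret AK: ring_surjection A K \<alpha> \<iota> by fact
  let ?u = "\<lambda>x. \<sigma> (\<iota>' (g x))"
  have u: "?u \<in> carrier (free_module A X)" by (rule AB.lift_closed[OF BK.lift_closed[OF g]])
  have "base_change \<alpha> \<iota> \<phi> (\<lambda>x. \<alpha> (?u x)) = (\<lambda>y. \<alpha> (\<phi> ?u y))"
    by (rule AK.base_change_push[OF \<phi> u])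
  moreover have "(\<lambda>x. \<alpha> (?u x)) = g"
    using AB.A.free_module_value[OF u] BK.B.free_module_value[OF g] by (simp add: \<alpha>)
  ultimately show ?thesis
    using AB.A.free_module_value[OF linear_closed[OF \<phi> u]] by (simp add: base_change_def \<alpha>)
qed


section \<open>The canonical resolution\<close>

lemma linear_zero_on_basis:
  assumes R: "ring R" and N: "right_module R N" and f: "f \<in> linear_maps R (free_module R X) N"
    and z: "\<And>x. x \<in> X \<Longrightarrow> f (basis_vec R x) = \<zero>\<^bsub>N\<^esub>" and u: "u \<in> carrier (free_module R X)"
  shows "f u = \<zero>\<^bsub>N\<^esub>"
proof -
  interpret N: right_module R N by fact
  have "(\<lambda>_. \<zero>\<^bsub>N\<^esub>) \<in> linear_maps R (free_module R X) N"
    by (rule linear_mapsI) auto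
  from linear_eqI[OF R N.abelian_group f this _ u] z show ?thesis by simp
qed

lemma comb_value_simps [simp]:
  "comb_value A [] = (\<lambda>z. \<zero>\<^bsub>A\<^esub>)"
  "comb_value A ((x, a) # l) = (\<lambda>z. single A x a z \<oplus>\<^bsub>A\<^esub> comb_value A l z)"
  by (auto simp: comb_value_def single_def)

context ring
begin

lemma comb_value_closed:
  "set l \<subseteq> X \<times> carrier R \<Longrightarrow> comb_value R l \<in> carrier (free_module R X)"
proof (induction l)
  case Nil
  then show ?case using abelian_groupE(2)[OF abelian_group_free_module[of X]] by simp
next
  case (Cons p l)
  then show ?case by (cases p) (auto intro: free_module_add_closed single_closed)
qed

lemma comb_value_append:
  "\<lbrakk>set l \<subseteq> X \<times> carrier R; set l' \<subseteq> X \<times> carrier R\<rbrakk> \<Longrightarrow>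
    comb_value R (l @ l') = (\<lambda>z. comb_value R l z \<oplus> comb_value R l' z)"
proof (induction l)
  case Nil
  then show ?case using free_module_value[OF comb_value_closed[of l']] by simp
next
  case (Cons p l)
  obtain x a where p: "p = (x, a)" by (cases p)
  have "comb_value R l z \<in> carrier R" "comb_value R l' z \<in> carrier R" "single R x a z \<in> carrier R" for z
    using Cons.prems p free_module_value[OF comb_value_closed[of l]]
      free_module_value[OF comb_value_closed[of l']] by (auto simp: single_def)
  then show ?case using Cons p by (simp add: a_assoc)
qed

text \<open>Hence every syzygy is the value of some list, and so the boundary of a generator one
  degree higher.\<close>

lemma ex_comb_value:
  assumes "f \<in> carrier (free_module R X)"
  shows "\<exists>l. set l \<subseteq> X \<times> carrier R \<and> comb_value R l = f"
  using assms
proof (induction rule: free_module_induct)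
  case zero
  show ?case by (intro exI[of _ "[]"]) simp
next
  case (single x a)
  then have "single R x a y \<oplus> \<zero> = single R x a y" for y by (simp add: single_def)
  with single show ?case by (intro exI[of _ "[(x, a)]"]) auto
next
  case (add f g)
  then obtain l l' where "set l \<subseteq> X \<times> carrier R" "comb_value R l = f"
    "set l' \<subseteq> X \<times> carrier R" "comb_value R l' = g" by auto
  then show ?case by (intro exI[of _ "l @ l'"]) (simp add: comb_value_append)
qed

end

context
  fixes A :: "('a, 'r) ring_scheme" and M :: "('a, 'm) module"
  assumes M: "right_module A M"
begin

interpretation M: right_module A M by (rule M)
interpretation A: ring A by (rule M.ring)

lemma res_gens_SucD:
  assumes "x \<in> res_gens A M (Suc i)"
  shows "x = Syz (syz_of x)" "set (syz_of x) \<subseteq> res_gens A M i \<times> carrier A"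
  using assms by auto

lemma comb_value_syz_closed:
  "x \<in> res_gens A M (Suc i) \<Longrightarrow> comb_value A (syz_of x) \<in> carrier (free_module A (res_gens A M i))"
  by (rule A.comb_value_closed[OF res_gens_SucD(2)])

text \<open>\<open>res_diff\<close> sums in the free module on all generators, so that one function
  serves every degree. On generators of degree \<open>Suc i\<close> the values lie in the module of
  degree \<open>i\<close>, where the sums agree.\<close>

lemma res_diff_linear:
  "res_diff A \<in> linear_maps A (free_module A (res_gens A M (Suc i))) (free_module A (res_gens A M i))"
  (is "_ \<in> linear_maps A ?F ?G")
proof -
  let ?U = "free_module A (UNIV :: ('m, 'a) gen set)"
  let ?v = "\<lambda>x :: ('m, 'a) gen. comb_value A (syz_of x)"
  note sub = A.free_module_mono[OF subset_UNIV, of "res_gens A M i"]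
  have v: "?v x \<in> carrier ?G" if "x \<in> res_gens A M (Suc i)" for x
    by (rule comb_value_syz_closed[OF that])
  have lin: "lin_ext A ?G ?v \<in> linear_maps A ?F ?G"
    using v by (intro lin_ext_linear A.right_module_free_module) auto
  have linU: "lin_ext A ?U ?v \<in> linear_maps A ?F ?U"
    using v sub by (intro lin_ext_linear A.right_module_free_module) auto
  have linGU: "lin_ext A ?G ?v \<in> linear_maps A ?F ?U"
    using lin sub by (auto simp: linear_maps_def additive_maps_def)
  have eq: "lin_ext A ?U ?v u = lin_ext A ?G ?v u" if u: "u \<in> carrier ?F" for u
  proof (rule linear_eqI[OF A.ring_axioms A.abelian_group_free_module linU linGU _ u])
    fix x assume "x \<in> res_gens A M (Suc i)"
    then have "?v x \<in> carrier ?G" "?v x \<in> carrier ?U" using v sub by auto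
    then show "lin_ext A ?U ?v (basis_vec A x) = lin_ext A ?G ?v (basis_vec A x)"
      by (simp add: lin_ext_basis_vec[OF A.right_module_free_module])
  qed
  show ?thesis
    using linear_add[OF lin] linear_smult[OF lin] linear_closed[OF lin] eq
      right_module.smult_closed[OF A.right_module_free_module, of _ _ "res_gens A M (Suc i)"]
    by (intro linear_mapsI) (simp_all add: res_diff_def A.free_module_add_closed del: res_gens.simps)
qed

lemma res_diff_basis:
  assumes "x \<in> res_gens A M (Suc i)"
  shows "res_diff A (basis_vec A x) = comb_value A (syz_of x)"
  unfolding res_diff_def
  using comb_value_syz_closed[OF assms] A.free_module_mono[OF subset_UNIV, of "res_gens A M i"]
  by (intro lin_ext_basis_vec A.right_module_free_module) auto

lemma res_aug_linear: "res_aug A M \<in> linear_maps A (free_module A (res_gens A M 0)) M"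
  unfolding res_aug_def by (rule lin_ext_linear[OF M]) auto

lemma res_aug_basis: "m \<in> carrier M \<Longrightarrow> res_aug A M (basis_vec A (Elt m)) = m"
  unfolding res_aug_def using lin_ext_basis_vec[OF M, of elt_of "Elt m"] by simp

text \<open>Exact by construction: a list over the previous generators gives a new generator
  precisely when its value is a syzygy, and every syzygy is the value of such a list.\<close>

theorem free_resolution_res:
  "free_resolution A M (res_gens A M) (\<lambda>_. res_diff A) (res_aug A M)"
proof (intro free_resolution.intro M free_resolution_axioms.intro res_diff_linear res_aug_linear)
  let ?X = "res_gens A M"
  show "res_aug A M ` carrier (free_module A (?X 0)) = carrier M"
  proof (intro equalityI subsetI)
    fix m assume m: "m \<in> carrier M"
    have "basis_vec A (Elt m) \<in> carrier (free_module A (?X 0))"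
      using m by (intro basis_vec_closed A.ring_axioms) simp
    then show "m \<in> res_aug A M ` carrier (free_module A (?X 0))"
      using res_aug_basis[OF m] by (metis imageI)
  qed (use linear_closed[OF res_aug_linear] in auto)
  fix i
  show "res_diff A ` carrier (free_module A (?X (Suc i))) = syzygies A ?X (\<lambda>_. res_diff A) M (res_aug A M) i"
    (is "_ = ?S i")
  proof (intro equalityI subsetI)
    fix z assume "z \<in> res_diff A ` carrier (free_module A (?X (Suc i)))"
    then obtain u where u: "u \<in> carrier (free_module A (?X (Suc i)))" "z = res_diff A u" by auto
    note zc = linear_closed[OF res_diff_linear u(1)]
    show "z \<in> ?S i"
    proof (cases i)
      case 0
      have "res_aug A M (res_diff A u) = \<zero>\<^bsub>M\<^esub>"
        using u(1)[unfolded 0]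
      proof (rule linear_zero_on_basis[OF A.ring_axioms M linear_comp[OF res_diff_linear res_aug_linear], rotated])
        fix x assume x: "x \<in> ?X (Suc 0)"
        then show "res_aug A M (res_diff A (basis_vec A x)) = \<zero>\<^bsub>M\<^esub>"
          using res_diff_basis[OF x] by auto
      qed
      then show ?thesis using zc u 0 by simp
    next
      case (Suc j)
      have "res_diff A (res_diff A u) = \<zero>\<^bsub>free_module A (?X j)\<^esub>"
        using u(1)[unfolded Suc]
      proof (rule linear_zero_on_basis[OF A.ring_axioms A.right_module_free_module
            linear_comp[OF res_diff_linear res_diff_linear], rotated])
        fix x assume x: "x \<in> ?X (Suc (Suc j))"
        then show "res_diff A (res_diff A (basis_vec A x)) = \<zero>\<^bsub>free_module A (?X j)\<^esub>"
          using res_diff_basis[OF x] by auto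
      qed
      then show ?thesis using zc u Suc by simp
    qed
  next
    fix z assume z: "z \<in> ?S i"
    then have "z \<in> carrier (free_module A (?X i))" by (cases i) auto
    then obtain l where l: "set l \<subseteq> ?X i \<times> carrier A" "comb_value A l = z"
      using A.ex_comb_value by blast
    have x: "Syz l \<in> ?X (Suc i)"
      using l z by (cases i) auto
    have "res_diff A (basis_vec A (Syz l)) = z" using res_diff_basis[OF x] l by simp
    then show "z \<in> res_diff A ` carrier (free_module A (?X (Suc i)))"
      using basis_vec_closed[OF A.ring_axioms x] by (metis imageI)
  qed
qed

end


section \<open>Tensor products of free modules with the trivial module\<close>

text \<open>Degreewise isomorphisms carry the structure of a complex along: linearity of
  \<open>d'\<close> and the vanishing of its square are inherited from \<open>d\<close>. In this way
  \<open>tensor_map\<close> is seen to be a differential.\<close>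

lemma chain_complex_transport:
  assumes C: "chain_complex K C d" and D: "\<And>i. right_module K (D i)"
    and s: "\<And>i. s i \<in> linear_maps K (C i) (D i)" and bij: "\<And>i. bij_betw (s i) (carrier (C i)) (carrier (D i))"
    and comm: "\<And>i x. x \<in> carrier (C (Suc i)) \<Longrightarrow> d' i (s (Suc i) x) = s i (d i x)"
  shows "chain_complex K D d'" "graded_isomorphic K (homology C d) (homology D d')"
proof -
  interpret C: chain_complex K C d by fact
  have ex: "\<exists>x\<in>carrier (C i). y = s i x" if "y \<in> carrier (D i)" for i y
    using bij[of i] that by (auto simp: bij_betw_def)
  have Cc: "x \<oplus>\<^bsub>C i\<^esub> y \<in> carrier (C i)" "a \<in> carrier K \<Longrightarrow> a \<odot>\<^bsub>C i\<^esub> x \<in> carrier (C i)"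
    if "x \<in> carrier (C i)" "y \<in> carrier (C i)" for x y a i
    using that right_module.smult_closed[OF C.right_module]
      abelian_groupE(1)[OF right_module.abelian_group[OF C.right_module]] by auto
  have zero: "s i \<zero>\<^bsub>C i\<^esub> = \<zero>\<^bsub>D i\<^esub>" for i
    by (rule linear_zero[OF s right_module.abelian_group[OF C.right_module] right_module.abelian_group[OF D]])
  note dc = linear_closed[OF C.d_linear]
  have lin: "d' i \<in> linear_maps K (D (Suc i)) (D i)" for i
  proof (rule linear_mapsI)
    fix y assume "y \<in> carrier (D (Suc i))"
    then obtain x where x: "x \<in> carrier (C (Suc i))" "y = s (Suc i) x" using ex by blast
    show "d' i y \<in> carrier (D i)" using x comm linear_closed[OF s] dc by simp
    {
      fix y' assume "y' \<in> carrier (D (Suc i))"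
      then obtain x' where x': "x' \<in> carrier (C (Suc i))" "y' = s (Suc i) x'" using ex by blast
      have "d' i (y \<oplus>\<^bsub>D (Suc i)\<^esub> y') = d' i (s (Suc i) (x \<oplus>\<^bsub>C (Suc i)\<^esub> x'))"
        using x x' by (simp add: linear_add[OF s])
      also have "\<dots> = s i (d i (x \<oplus>\<^bsub>C (Suc i)\<^esub> x'))"
        by (rule comm[OF Cc(1)[OF x(1) x'(1)]])
      also have "\<dots> = s i (d i x) \<oplus>\<^bsub>D i\<^esub> s i (d i x')"
        using x x' by (simp add: linear_add[OF s] linear_add[OF C.d_linear] dc)
      finally show "d' i (y \<oplus>\<^bsub>D (Suc i)\<^esub> y') = d' i y \<oplus>\<^bsub>D i\<^esub> d' i y'" using x x' comm by simp
    next
      fix a assume a: "a \<in> carrier K"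
      have "d' i (a \<odot>\<^bsub>D (Suc i)\<^esub> y) = d' i (s (Suc i) (a \<odot>\<^bsub>C (Suc i)\<^esub> x))"
        using x a by (simp add: linear_smult[OF s])
      also have "\<dots> = s i (d i (a \<odot>\<^bsub>C (Suc i)\<^esub> x))"
        by (rule comm[OF Cc(2)[OF x(1) x(1) a]])
      also have "\<dots> = a \<odot>\<^bsub>D i\<^esub> s i (d i x)"
        using x a by (simp add: linear_smult[OF s] linear_smult[OF C.d_linear] dc)
      finally show "d' i (a \<odot>\<^bsub>D (Suc i)\<^esub> y) = a \<odot>\<^bsub>D i\<^esub> d' i y" using x comm by simp
    }
  qed
  show D': "chain_complex K D d'"
  proof (rule chain_complex.intro)
    show "right_module K (D i)" "d' i \<in> linear_maps K (D (Suc i)) (D i)" for i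
      by (rule D, rule lin)
    fix i y assume "y \<in> carrier (D (Suc (Suc i)))"
    then obtain x where x: "x \<in> carrier (C (Suc (Suc i)))" "y = s (Suc (Suc i)) x" using ex by blast
    then show "d' i (d' (Suc i) y) = \<zero>\<^bsub>D i\<^esub>" using comm dc C.d_d zero by simp
  qed
  have inj: "x = x'" if "s i x = s i x'" "x \<in> carrier (C i)" "x' \<in> carrier (C i)" for i x x'
    using bij[of i] that by (auto simp: bij_betw_def dest: inj_onD)
  show "graded_isomorphic K (homology C d) (homology D d')"
  proof (rule homology_iso[OF C D' s comm])
    fix i z w assume z: "z \<in> cycles C d i" and "w \<in> carrier (D (Suc i))" and eq: "s i z = d' i w"
    then obtain x where x: "x \<in> carrier (C (Suc i))" "w = s (Suc i) x" using ex by blast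
    have zc: "z \<in> carrier (C i)" using submoduleD(1)[OF C.submodule_cycles] z by blast
    have "z = d i x" using eq x comm by (intro inj[OF _ zc dc]) auto
    then show "z \<in> d i ` carrier (C (Suc i))" using x by blast
  next
    fix i z' assume z': "z' \<in> cycles D d' i"
    then have "z' \<in> carrier (D i)" by (cases i) auto
    then obtain x where x: "x \<in> carrier (C i)" "z' = s i x" using ex by blast
    have xc: "x \<in> cycles C d i"
    proof (cases i)
      case (Suc j)
      then have x': "x \<in> carrier (C (Suc j))" using x by simp
      have "s j (d j x) = s j \<zero>\<^bsub>C j\<^esub>" using z' x x' Suc comm zero by simp
      then have "d j x = \<zero>\<^bsub>C j\<^esub>"
        using inj dc[OF x'] abelian_groupE(2)[OF right_module.abelian_group[OF C.right_module]] by blast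
      then show ?thesis using x' Suc by simp
    qed (use x in simp)
    have zD: "\<zero>\<^bsub>D (Suc i)\<^esub> \<in> carrier (D (Suc i))"
      by (rule abelian_groupE(2)[OF right_module.abelian_group[OF D]])
    moreover have "z' = d' i \<zero>\<^bsub>D (Suc i)\<^esub> \<oplus>\<^bsub>D i\<^esub> s i x"
    proof -
      interpret Di: right_module K "D i" by (rule D)
      have "d' i \<zero>\<^bsub>D (Suc i)\<^esub> = \<zero>\<^bsub>D i\<^esub>"
        by (rule linear_zero[OF lin right_module.abelian_group[OF D] Di.abelian_group])
      then show ?thesis using x linear_closed[OF s x(1)] by simp
    qed
    ultimately show "\<exists>z\<in>cycles C d i. \<exists>w\<in>carrier (D (Suc i)). z' = d' i w \<oplus>\<^bsub>D i\<^esub> s i z"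
      using xc by blast
  qed
qed

text \<open>\<open>\<iota>\<close> is the unit map of the algebra, so lifting along this section
  respects addition and scalars. \<open>T\<close> is \<open>K\<close> with the action through
  \<open>\<alpha>\<close>; by commutativity of \<open>K\<close> it may stand on either side of a
  tensor product.\<close>

locale augmented_algebra = ring_surjection A K \<alpha> \<iota> + K: cring K
  for A :: "('k, 'a) module" and K :: "('k, 'r) ring_scheme" and \<alpha> \<iota> and T :: "('a, 'k) module" +
  assumes \<iota>_hom: "\<iota> \<in> ring_hom K A"
    and smult_unit: "\<And>c. c \<in> carrier K \<Longrightarrow> c \<odot>\<^bsub>A\<^esub> \<one>\<^bsub>A\<^esub> = \<iota> c"
    and T_simps: "carrier T = carrier K" "zero T = \<zero>\<^bsub>K\<^esub>" "add T = add K"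
      "\<And>a c. \<lbrakk>a \<in> carrier A; c \<in> carrier K\<rbrakk> \<Longrightarrow> a \<odot>\<^bsub>T\<^esub> c = \<alpha> a \<otimes>\<^bsub>K\<^esub> c"
begin

lemma right_module_T: "right_module A T"
proof -
  have "abelian_group T"
    by (rule abelian_groupI) (auto simp: T_simps B.a_ac intro!: bexI[of _ "\<ominus>\<^bsub>K\<^esub> _"] B.l_neg)
  then show ?thesis
    by (intro right_module.intro right_module_axioms.intro A.ring_axioms)
      (auto simp: T_simps hom_simps B.l_distr B.r_distr K.m_ac)
qed

section \<open>The tensor product of a free module with the trivial module\<close>

context
  fixes X :: "'x set"
begin

abbreviation (input) FX where "FX \<equiv> free_module A X"
abbreviation (input) TF where "TF \<equiv> tensor_free K FX T"
abbreviation (input) TS where "TS \<equiv> tensor_span K A FX T"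

interpretation FX: right_module A FX by (rule A.right_module_free_module)
interpretation TF: right_module K TF unfolding tensor_free_def by (rule B.right_module_free_module)

lemma basis_TF: "\<lbrakk>f \<in> carrier FX; c \<in> carrier K\<rbrakk> \<Longrightarrow> basis_vec K (f, c) \<in> carrier TF"
  unfolding tensor_free_def by (rule basis_vec_closed[OF B.ring_axioms]) (simp add: T_simps)

lemma relators_TF: "tensor_relators K A FX T \<subseteq> carrier TF"
proof -
  note [simp del] = free_module_simps
  have T: "right_module A T" by (rule right_module_T)
  have "\<iota> c \<in> carrier A" "c \<odot>\<^bsub>A\<^esub> \<one>\<^bsub>A\<^esub> \<in> carrier A" if "c \<in> carrier K" for c
    using that smult_unit by auto
  then show ?thesis
    unfolding tensor_relators_def Let_def
    by (auto simp: T_simps intro!: TF.minus_closed TF.a_closed TF.smult_closed basis_TF FX.smult_closed)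
qed

lemma span_submodule: "submodule TS K TF"
proof (rule submoduleI[OF TF.right_module_axioms])
  have W: "submodule (carrier TF) K TF" by (rule submodule_carrier[OF TF.right_module_axioms])
  show "TS \<subseteq> carrier TF" using W relators_TF by (auto simp: tensor_span_def)
qed (auto simp: tensor_span_def dest: submoduleD)

lemma relators_span: "r \<in> tensor_relators K A FX T \<Longrightarrow> r \<in> TS"
  by (auto simp: tensor_span_def)

lemma span_least: "\<lbrakk>submodule W K TF; tensor_relators K A FX T \<subseteq> W\<rbrakk> \<Longrightarrow> TS \<subseteq> W"
  by (auto simp: tensor_span_def)

definition pure_tensor :: "('x \<Rightarrow> 'a) \<Rightarrow> 'k \<Rightarrow> (('x \<Rightarrow> 'a) \<times> 'k \<Rightarrow> 'k) set" where
  "pure_tensor f c = TS +>\<^bsub>TF\<^esub> basis_vec K (f, c)"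

lemma right_module_tensor: "right_module K (tensor K A FX T)"
  unfolding tensor_def by (rule right_module_quotient[OF TF.right_module_axioms span_submodule])

interpretation Q: right_module K "tensor K A FX T" by (rule right_module_tensor)

lemma coset_linear: "(\<lambda>u. TS +>\<^bsub>TF\<^esub> u) \<in> linear_maps K TF (tensor K A FX T)"
  unfolding tensor_def
  by (rule linear_mapsI)
    (auto simp: quotient_carrier_iff quotient_simps[OF TF.right_module_axioms span_submodule])

lemma coset_eqI:
  assumes "u \<ominus>\<^bsub>TF\<^esub> v \<in> tensor_relators K A FX T" "u \<in> carrier TF" "v \<in> carrier TF"
  shows "TS +>\<^bsub>TF\<^esub> u = TS +>\<^bsub>TF\<^esub> v"
  using relators_span[OF assms(1)] assms(2,3)
    coset_eq_iff[OF submodule_abelian_subgroup[OF span_submodule TF.abelian_group]] by simp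

lemma pure_tensor_closed:
  "\<lbrakk>f \<in> carrier FX; c \<in> carrier K\<rbrakk> \<Longrightarrow> pure_tensor f c \<in> carrier (tensor K A FX T)"
  unfolding pure_tensor_def by (rule linear_closed[OF coset_linear basis_TF])

lemma pure_tensor_add:
  assumes "f \<in> carrier FX" "g \<in> carrier FX" "c \<in> carrier K"
  shows "pure_tensor (f \<oplus>\<^bsub>FX\<^esub> g) c = pure_tensor f c \<oplus>\<^bsub>tensor K A FX T\<^esub> pure_tensor g c"
proof -
  note e = basis_TF[OF assms(1,3)] basis_TF[OF assms(2,3)]
  have "basis_vec K (f \<oplus>\<^bsub>FX\<^esub> g, c) \<ominus>\<^bsub>TF\<^esub> (basis_vec K (f, c) \<oplus>\<^bsub>TF\<^esub> basis_vec K (g, c))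
      \<in> tensor_relators K A FX T"
    unfolding tensor_relators_def Let_def using assms T_simps by blast
  from coset_eqI[OF this basis_TF[OF FX.a_closed[OF assms(1,2)] assms(3)] TF.a_closed[OF e]]
  show ?thesis unfolding pure_tensor_def by (simp only: linear_add[OF coset_linear e])
qed

lemma pure_tensor_balanced:
  assumes "a \<in> carrier A" "f \<in> carrier FX" "c \<in> carrier K"
  shows "pure_tensor (a \<odot>\<^bsub>FX\<^esub> f) c = pure_tensor f (\<alpha> a \<otimes>\<^bsub>K\<^esub> c)"
proof -
  have "basis_vec K (a \<odot>\<^bsub>FX\<^esub> f, c) \<ominus>\<^bsub>TF\<^esub> basis_vec K (f, a \<odot>\<^bsub>T\<^esub> c) \<in> tensor_relators K A FX T"
    unfolding tensor_relators_def Let_def using assms T_simps by blast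
  then have "basis_vec K (a \<odot>\<^bsub>FX\<^esub> f, c) \<ominus>\<^bsub>TF\<^esub> basis_vec K (f, \<alpha> a \<otimes>\<^bsub>K\<^esub> c) \<in> tensor_relators K A FX T"
    using assms T_simps by simp
  from coset_eqI[OF this basis_TF[OF FX.smult_closed[OF assms(1,2)] assms(3)] basis_TF]
  show ?thesis unfolding pure_tensor_def using assms by simp
qed

lemma pure_tensor_smult:
  assumes "f \<in> carrier FX" "b \<in> carrier K" "c \<in> carrier K"
  shows "pure_tensor (\<iota> b \<odot>\<^bsub>FX\<^esub> f) c = b \<odot>\<^bsub>tensor K A FX T\<^esub> pure_tensor f c"
proof -
  note e = basis_TF[OF assms(1,3)]
  have "basis_vec K ((b \<odot>\<^bsub>A\<^esub> \<one>\<^bsub>A\<^esub>) \<odot>\<^bsub>FX\<^esub> f, c) \<ominus>\<^bsub>TF\<^esub> b \<odot>\<^bsub>TF\<^esub> basis_vec K (f, c) \<in> tensor_relators K A FX T"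
    unfolding tensor_relators_def Let_def using assms T_simps by blast
  then have "basis_vec K (\<iota> b \<odot>\<^bsub>FX\<^esub> f, c) \<ominus>\<^bsub>TF\<^esub> b \<odot>\<^bsub>TF\<^esub> basis_vec K (f, c) \<in> tensor_relators K A FX T"
    by (simp only: smult_unit[OF assms(2)])
  from coset_eqI[OF this basis_TF[OF FX.smult_closed[OF section_closed[OF assms(2)] assms(1)] assms(3)]
      TF.smult_closed[OF assms(2) e]]
  show ?thesis unfolding pure_tensor_def by (simp only: linear_smult[OF coset_linear assms(2) e])
qed

text \<open>The isomorphism \<open>f \<otimes> c \<mapsto> \<alpha> f \<cdot> c\<close> from the
  tensor product to \<open>K\<^sup>X\<close>, before passage to the quotient.\<close>

definition tensor_value :: "(('x \<Rightarrow> 'a) \<times> 'k \<Rightarrow> 'k) \<Rightarrow> 'x \<Rightarrow> 'k" where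
  "tensor_value = lin_ext K (free_module K X) (\<lambda>(f, c) x. \<alpha> (f x) \<otimes>\<^bsub>K\<^esub> c)"

lemma tensor_value_arg:
  assumes "f \<in> carrier FX" "c \<in> carrier K"
  shows "(\<lambda>x. \<alpha> (f x) \<otimes>\<^bsub>K\<^esub> c) \<in> carrier (free_module K X)"
  using right_module.smult_closed[OF B.right_module_free_module assms(2) push_closed[OF assms(1)]]
  by simp

lemma tensor_value_linear: "tensor_value \<in> linear_maps K TF (free_module K X)"
  unfolding tensor_value_def tensor_free_def
  by (rule lin_ext_linear[OF B.right_module_free_module])
    (auto simp: T_simps intro: tensor_value_arg)

lemma tensor_value_basis:
  "\<lbrakk>f \<in> carrier FX; c \<in> carrier K\<rbrakk> \<Longrightarrow> tensor_value (basis_vec K (f, c)) = (\<lambda>x. \<alpha> (f x) \<otimes>\<^bsub>K\<^esub> c)"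
  unfolding tensor_value_def
  using lin_ext_basis_vec[OF B.right_module_free_module, of "\<lambda>(f, c) x. \<alpha> (f x) \<otimes>\<^bsub>K\<^esub> c" "(f, c)" X]
    tensor_value_arg by auto

lemma tensor_value_span:
  assumes "w \<in> TS" shows "tensor_value w = \<zero>\<^bsub>free_module K X\<^esub>"
proof -
  let ?KX = "free_module K X"
  interpret KX: right_module K ?KX by (rule B.right_module_free_module)
  let ?ker = "{w \<in> carrier TF. tensor_value w = \<zero>\<^bsub>?KX\<^esub>}"
  have diff: "tensor_value (u \<ominus>\<^bsub>TF\<^esub> v) = \<zero>\<^bsub>?KX\<^esub>"
    if "u \<in> carrier TF" "v \<in> carrier TF" "tensor_value u = tensor_value v" for u v
    unfolding linear_minus[OF tensor_value_linear TF.abelian_group KX.abelian_group that(1,2)] that(3)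
    unfolding a_minus_def by (rule KX.r_neg[OF linear_closed[OF tensor_value_linear that(2)]])
  have val: "tensor_value (basis_vec K (f, c)) = c \<odot>\<^bsub>?KX\<^esub> (\<lambda>x. \<alpha> (f x))"
    if "f \<in> carrier FX" "c \<in> carrier K" for f c
    using tensor_value_basis[OF that] by simp
  note push_add = A.free_module_value[THEN ring_hom_add[OF hom]]
  have "tensor_relators K A FX T \<subseteq> ?ker"
  proof
    fix r assume r: "r \<in> tensor_relators K A FX T"
    have rc: "r \<in> carrier TF" using relators_TF r by blast
    from r have "tensor_value r = \<zero>\<^bsub>?KX\<^esub>"
      unfolding tensor_relators_def Let_def T_simps(1-3)
    \<comment> \<open>The four cases are the families of relators: additivity in each factor,
      balancing over \<open>A\<close>, and the action of \<open>K\<close> through the unit of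
      \<open>A\<close>.\<close>
    proof (elim UnE CollectE exE conjE, goal_cases)
      case (1 f g c)
      note l = 1(2-4) 1(1)
      have "tensor_value (basis_vec K (f \<oplus>\<^bsub>FX\<^esub> g, c))
          = tensor_value (basis_vec K (f, c)) \<oplus>\<^bsub>?KX\<^esub> tensor_value (basis_vec K (g, c))"
        using l A.free_module_value[OF l(1)] A.free_module_value[OF l(2)] A.free_module_add_closed[OF l(1,2)]
        by (simp add: tensor_value_basis hom_simps B.l_distr)
      then show ?thesis unfolding l(4)
        by (intro diff basis_TF TF.a_closed FX.a_closed l)
          (simp only: linear_add[OF tensor_value_linear basis_TF[OF l(1,3)] basis_TF[OF l(2,3)]])
    next
      case (2 f c c')
      note r = 2(2-4) 2(1)
      have "tensor_value (basis_vec K (f, c \<oplus>\<^bsub>K\<^esub> c'))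
          = tensor_value (basis_vec K (f, c)) \<oplus>\<^bsub>?KX\<^esub> tensor_value (basis_vec K (f, c'))"
        using r A.free_module_value[OF r(1)] by (simp add: tensor_value_basis B.r_distr)
      then show ?thesis unfolding r(4)
        by (intro diff basis_TF TF.a_closed B.a_closed r)
          (simp only: linear_add[OF tensor_value_linear basis_TF[OF r(1,2)] basis_TF[OF r(1,3)]])
    next
      case (3 a f c)
      note b = 3(2-4) 3(1)
      have "tensor_value (basis_vec K (a \<odot>\<^bsub>FX\<^esub> f, c)) = tensor_value (basis_vec K (f, \<alpha> a \<otimes>\<^bsub>K\<^esub> c))"
        using b A.free_module_value[OF b(2)] FX.smult_closed[OF b(1,2)]
        by (simp add: tensor_value_basis hom_simps B.m_assoc)
      then show ?thesis unfolding b(4) T_simps(4)[OF b(1,3)]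
        by (intro diff basis_TF FX.smult_closed B.m_closed hom_closed b)
    next
      case (4 b f c)
      note s = 4(2-4) 4(1)
      have \<iota>b: "\<iota> b \<in> carrier A" using s by simp
      have "tensor_value (basis_vec K (\<iota> b \<odot>\<^bsub>FX\<^esub> f, c)) = b \<odot>\<^bsub>?KX\<^esub> tensor_value (basis_vec K (f, c))"
        using s A.free_module_value[OF s(2)] FX.smult_closed[OF \<iota>b s(2)]
        by (simp add: tensor_value_basis hom_simps K.m_ac)
      then show ?thesis unfolding s(4) smult_unit[OF s(1)]
        by (intro diff basis_TF FX.smult_closed TF.smult_closed \<iota>b s)
          (simp only: linear_smult[OF tensor_value_linear s(1) basis_TF[OF s(2,3)]])
    qed
    then show "r \<in> ?ker" using rc by simp
  qed
  from span_least[OF linear_kernel_submodule[OF TF.right_module_axioms KX.right_module_axioms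
      tensor_value_linear] this] assms
  show ?thesis by blast
qed

text \<open>The inverse isomorphism \<open>g \<mapsto> \<iota> g \<otimes> 1\<close>.\<close>

definition tensor_section :: "('x \<Rightarrow> 'k) \<Rightarrow> (('x \<Rightarrow> 'a) \<times> 'k \<Rightarrow> 'k) set" where
  "tensor_section g = pure_tensor (\<lambda>x. \<iota> (g x)) \<one>\<^bsub>K\<^esub>"

lemma tensor_section_linear: "tensor_section \<in> linear_maps K (free_module K X) (tensor K A FX T)"
proof (rule linear_mapsI)
  fix g assume g: "g \<in> carrier (free_module K X)"
  note gl = lift_closed[OF g] and gv = B.free_module_value[OF g]
  show "tensor_section g \<in> carrier (tensor K A FX T)"
    unfolding tensor_section_def by (rule pure_tensor_closed[OF gl]) simp
  {
    fix h assume h: "h \<in> carrier (free_module K X)"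
    have "(\<lambda>x. \<iota> ((g \<oplus>\<^bsub>free_module K X\<^esub> h) x)) = (\<lambda>x. \<iota> (g x)) \<oplus>\<^bsub>FX\<^esub> (\<lambda>x. \<iota> (h x))"
      using gv B.free_module_value[OF h] by (simp add: ring_hom_add[OF \<iota>_hom])
    then show "tensor_section (g \<oplus>\<^bsub>free_module K X\<^esub> h)
        = tensor_section g \<oplus>\<^bsub>tensor K A FX T\<^esub> tensor_section h"
      unfolding tensor_section_def by (simp only: pure_tensor_add[OF gl lift_closed[OF h] B.one_closed])
  next
    fix c assume c: "c \<in> carrier K"
    have "(\<lambda>x. \<iota> ((c \<odot>\<^bsub>free_module K X\<^esub> g) x)) = \<iota> c \<odot>\<^bsub>FX\<^esub> (\<lambda>x. \<iota> (g x))"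
      using gv c by (simp add: ring_hom_mult[OF \<iota>_hom])
    then show "tensor_section (c \<odot>\<^bsub>free_module K X\<^esub> g) = c \<odot>\<^bsub>tensor K A FX T\<^esub> tensor_section g"
      unfolding tensor_section_def by (simp only: pure_tensor_smult[OF gl c B.one_closed])
  }
qed

text \<open>By balancing, \<open>x a \<otimes> 1\<close> depends on \<open>a\<close> only through
  \<open>\<alpha> a\<close>, and \<open>\<iota> (\<alpha> a)\<close> has the same augmentation as
  \<open>a\<close>.\<close>

lemma tensor_section_push:
  assumes f: "f \<in> carrier FX"
  shows "tensor_section (\<lambda>x. \<alpha> (f x)) = pure_tensor f \<one>\<^bsub>K\<^esub>"
proof (rule additive_eqI[OF A.ring_axioms Q.abelian_group _ _ _ f])
  have "(\<lambda>f x. \<alpha> (f x)) \<in> additive_maps FX (free_module K X)"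
    using A.free_module_value by (intro additive_mapsI) (auto simp: hom_simps intro: push_closed)
  from additive_comp[OF this linear_additive[OF tensor_section_linear]]
  show "(\<lambda>f. tensor_section (\<lambda>x. \<alpha> (f x))) \<in> additive_maps FX (tensor K A FX T)" .
  show "(\<lambda>f. pure_tensor f \<one>\<^bsub>K\<^esub>) \<in> additive_maps FX (tensor K A FX T)"
    by (intro additive_mapsI pure_tensor_closed pure_tensor_add B.one_closed)
  fix x a assume x: "x \<in> X" and a: "a \<in> carrier A"
  note e = basis_vec_closed[OF A.ring_axioms x]
  have \<tau>: "pure_tensor (single A x b) \<one>\<^bsub>K\<^esub> = pure_tensor (basis_vec A x) (\<alpha> b)" if b: "b \<in> carrier A" for b
    using pure_tensor_balanced[OF b e B.one_closed] b
    by (simp only: single_smult[OF A.ring_axioms b] hom_closed B.r_one)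
  have "(\<lambda>y. \<iota> (\<alpha> (single A x a y))) = single A x (\<iota> (\<alpha> a))"
    by (auto simp: single_def)
  then show "tensor_section (\<lambda>y. \<alpha> (single A x a y)) = pure_tensor (single A x a) \<one>\<^bsub>K\<^esub>"
    unfolding tensor_section_def using a by (simp add: \<tau>)
qed

text \<open>On a generator \<open>f \<otimes> c\<close> the left side is
  \<open>c (f \<otimes> 1)\<close> by the previous lemma; the action of \<open>c\<close> moves into
  \<open>f\<close> through \<open>\<iota>\<close> and out to the second factor by balancing.\<close>

lemma tensor_section_value:
  assumes u: "u \<in> carrier TF" shows "tensor_section (tensor_value u) = TS +>\<^bsub>TF\<^esub> u"
proof (rule linear_eqI[OF B.ring_axioms Q.abelian_group _ _ _ u[unfolded tensor_free_def]])
  show "(\<lambda>u. tensor_section (tensor_value u)) \<in> linear_maps K (free_module K (carrier FX \<times> carrier T)) (tensor K A FX T)"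
    using linear_comp[OF tensor_value_linear tensor_section_linear] by (simp add: tensor_free_def)
  show "(\<lambda>u. TS +>\<^bsub>TF\<^esub> u) \<in> linear_maps K (free_module K (carrier FX \<times> carrier T)) (tensor K A FX T)"
    using coset_linear by (simp add: tensor_free_def)
  fix p assume "p \<in> carrier FX \<times> carrier T"
  then obtain f c where p: "p = (f, c)" "f \<in> carrier FX" "c \<in> carrier K" by (auto simp: T_simps)
  have "tensor_section (tensor_value (basis_vec K p)) = tensor_section (c \<odot>\<^bsub>free_module K X\<^esub> (\<lambda>x. \<alpha> (f x)))"
    using p by (simp add: tensor_value_basis)
  also have "\<dots> = c \<odot>\<^bsub>tensor K A FX T\<^esub> tensor_section (\<lambda>x. \<alpha> (f x))"
    by (rule linear_smult[OF tensor_section_linear p(3) push_closed[OF p(2)]])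
  also have "\<dots> = pure_tensor (\<iota> c \<odot>\<^bsub>FX\<^esub> f) \<one>\<^bsub>K\<^esub>"
    by (simp only: tensor_section_push[OF p(2)] pure_tensor_smult[OF p(2,3) B.one_closed])
  also have "\<dots> = pure_tensor f c"
    using p by (simp only: pure_tensor_balanced[OF section_closed[OF p(3)] p(2) B.one_closed]
      hom_section B.r_one)
  finally show "tensor_section (tensor_value (basis_vec K p)) = TS +>\<^bsub>TF\<^esub> basis_vec K p"
    by (simp add: pure_tensor_def p)
qed

text \<open>Since \<open>tensor_section\<close> inverts \<open>tensor_value\<close> modulo the span,
  nothing outside the span is killed. Membership in a submodule defined as an intersection thus
  becomes a test on values.\<close>

lemma span_iff:
  assumes u: "u \<in> carrier TF" shows "u \<in> TS \<longleftrightarrow> tensor_value u = \<zero>\<^bsub>free_module K X\<^esub>"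
proof
  interpret W: abelian_subgroup TS TF by (rule submodule_abelian_subgroup[OF span_submodule TF.abelian_group])
  assume z: "tensor_value u = \<zero>\<^bsub>free_module K X\<^esub>"
  have "TS +>\<^bsub>TF\<^esub> u = \<zero>\<^bsub>tensor K A FX T\<^esub>"
    unfolding tensor_section_value[OF u, symmetric] z
    by (rule linear_zero[OF tensor_section_linear B.abelian_group_free_module Q.abelian_group])
  also have "\<dots> = TS" by (simp add: tensor_def quotient_module_def)
  finally show "u \<in> TS" using W.a_rcos_self[OF u] by simp
qed (rule tensor_value_span)

lemma tensor_value_pure:
  assumes g: "g \<in> carrier (free_module K X)"
  shows "tensor_value (basis_vec K (\<lambda>x. \<iota> (g x), \<one>\<^bsub>K\<^esub>)) = g"
  using g by (simp add: tensor_value_basis lift_closed)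

lemma tensor_section_bij:
  "bij_betw tensor_section (carrier (free_module K X)) (carrier (tensor K A FX T))"
  unfolding bij_betw_def
proof (intro conjI equalityI subsetI inj_onI)
  fix g h assume g: "g \<in> carrier (free_module K X)" and h: "h \<in> carrier (free_module K X)"
    and eq: "tensor_section g = tensor_section h"
  interpret KX: right_module K "free_module K X" by (rule B.right_module_free_module)
  have e: "basis_vec K (\<lambda>x. \<iota> (g x), \<one>\<^bsub>K\<^esub>) \<in> carrier TF" if "g \<in> carrier (free_module K X)" for g
    using that by (intro basis_TF lift_closed) auto
  have "basis_vec K (\<lambda>x. \<iota> (g x), \<one>\<^bsub>K\<^esub>) \<ominus>\<^bsub>TF\<^esub> basis_vec K (\<lambda>x. \<iota> (h x), \<one>\<^bsub>K\<^esub>) \<in> TS"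
    using eq coset_eq_iff[OF submodule_abelian_subgroup[OF span_submodule TF.abelian_group] e[OF g] e[OF h]]
    by (simp add: tensor_section_def pure_tensor_def)
  from tensor_value_span[OF this] have z: "g \<ominus>\<^bsub>free_module K X\<^esub> h = \<zero>\<^bsub>free_module K X\<^esub>"
    by (simp only: linear_minus[OF tensor_value_linear TF.abelian_group KX.abelian_group e[OF g] e[OF h]]
      tensor_value_pure[OF g] tensor_value_pure[OF h])
  have "g x \<ominus>\<^bsub>K\<^esub> h x = \<zero>\<^bsub>K\<^esub>" for x
    using fun_cong[OF z, of x] by (simp add: B.free_module_minus[OF g h])
  then have "g x = h x" for x
    using B.minus_equality[of "g x" "\<ominus>\<^bsub>K\<^esub> h x"] B.free_module_value[OF g] B.free_module_value[OF h]
    by (simp add: a_minus_def)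
  then show "g = h" ..
next
  fix U assume "U \<in> carrier (tensor K A FX T)"
  then obtain u where u: "u \<in> carrier TF" "U = TS +>\<^bsub>TF\<^esub> u"
    unfolding tensor_def by (auto simp: quotient_carrier_iff)
  then show "U \<in> tensor_section ` carrier (free_module K X)"
    using tensor_section_value[OF u(1)] linear_closed[OF tensor_value_linear u(1)] by blast
qed (use linear_closed[OF tensor_section_linear] in auto)

end

text \<open>Naturality of the identification with \<open>K\<^sup>X\<close>: under it,
  \<open>\<phi> \<otimes> id\<close> becomes the coordinatewise reduction of
  \<open>\<phi>\<close>.\<close>

lemma tensor_map_section:
  fixes X :: "'x set" and Y :: "'y set"
  assumes \<phi>: "\<phi> \<in> linear_maps A (free_module A X) (free_module A Y)" and g: "g \<in> carrier (free_module K X)"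
  shows "tensor_map K A (free_module A Y) T \<phi> (tensor_section X g) = tensor_section Y (base_change \<alpha> \<iota> \<phi> g)"
proof -
  let ?FX = "free_module A X" and ?FY = "free_module A Y"
  let ?TX = "tensor_free K ?FX T" and ?TY = "tensor_free K ?FY T"
  let ?SX = "tensor_span K A ?FX T" and ?SY = "tensor_span K A ?FY T"
  interpret TX: right_module K ?TX unfolding tensor_free_def by (rule B.right_module_free_module)
  interpret TY: right_module K ?TY unfolding tensor_free_def by (rule B.right_module_free_module)
  let ?v = "\<lambda>(m, n). basis_vec K (\<phi> m, n)"
  define L where "L = lin_ext K ?TY ?v"
  have v: "?v p \<in> carrier ?TY" if "p \<in> carrier ?FX \<times> carrier T" for p
    using that linear_closed[OF \<phi>] by (auto simp: T_simps intro: basis_TF)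
  have L: "L \<in> linear_maps K ?TX ?TY"
    unfolding L_def tensor_free_def[of K ?FX] using v by (intro lin_ext_linear TY.right_module_axioms) auto
  have L_basis: "L (basis_vec K (f, c)) = basis_vec K (\<phi> f, c)" if "f \<in> carrier ?FX" "c \<in> carrier K" for f c
    unfolding L_def using v[of "(f, c)"] that
    by (subst lin_ext_basis_vec[OF TY.right_module_axioms]) (auto simp: T_simps)
  have val: "tensor_value Y (L u) = base_change \<alpha> \<iota> \<phi> (tensor_value X u)" if u: "u \<in> carrier ?TX" for u
  proof (rule linear_eqI[OF B.ring_axioms B.abelian_group_free_module _ _ _ u[unfolded tensor_free_def]])
    show "(\<lambda>u. tensor_value Y (L u)) \<in> linear_maps K (free_module K (carrier ?FX \<times> carrier T)) (free_module K Y)"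
      using linear_comp[OF L tensor_value_linear] by (simp add: tensor_free_def)
    show "(\<lambda>u. base_change \<alpha> \<iota> \<phi> (tensor_value X u))
        \<in> linear_maps K (free_module K (carrier ?FX \<times> carrier T)) (free_module K Y)"
      using linear_comp[OF tensor_value_linear base_change_linear[OF \<phi>]] by (simp add: tensor_free_def)
    fix p assume "p \<in> carrier ?FX \<times> carrier T"
    then obtain f c where p: "p = (f, c)" "f \<in> carrier ?FX" "c \<in> carrier K" by (auto simp: T_simps)
    have "tensor_value Y (L (basis_vec K p)) = c \<odot>\<^bsub>free_module K Y\<^esub> (\<lambda>y. \<alpha> (\<phi> f y))"
      using p linear_closed[OF \<phi>] by (simp add: L_basis tensor_value_basis)
    also have "\<dots> = c \<odot>\<^bsub>free_module K Y\<^esub> base_change \<alpha> \<iota> \<phi> (\<lambda>x. \<alpha> (f x))"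
      by (simp only: base_change_push[OF \<phi> p(2)])
    also have "\<dots> = base_change \<alpha> \<iota> \<phi> (c \<odot>\<^bsub>free_module K X\<^esub> (\<lambda>x. \<alpha> (f x)))"
      by (rule linear_smult[OF base_change_linear[OF \<phi>] p(3) push_closed[OF p(2)], symmetric])
    also have "c \<odot>\<^bsub>free_module K X\<^esub> (\<lambda>x. \<alpha> (f x)) = tensor_value X (basis_vec K p)"
      using p by (simp add: tensor_value_basis)
    finally show "tensor_value Y (L (basis_vec K p)) = base_change \<alpha> \<iota> \<phi> (tensor_value X (basis_vec K p))" .
  qed
  \<comment> \<open>Well-definedness on cosets: both spans are kernels of
    \<open>tensor_value\<close>, which \<open>val\<close> intertwines with a linear map.\<close>
  have im: "L ` ?SX \<subseteq> ?SY"
  proof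
    fix w assume "w \<in> L ` ?SX"
    then obtain u where u: "u \<in> ?SX" "w = L u" by auto
    have uc: "u \<in> carrier ?TX" using submoduleD(1)[OF span_submodule] u by blast
    have "tensor_value Y (L u) = \<zero>\<^bsub>free_module K Y\<^esub>"
      unfolding val[OF uc] tensor_value_span[OF u(1)]
      by (rule linear_zero[OF base_change_linear[OF \<phi>] B.abelian_group_free_module B.abelian_group_free_module])
    then show "w \<in> ?SY" using span_iff[OF linear_closed[OF L uc]] u by simp
  qed
  let ?e = "basis_vec K (\<lambda>x. \<iota> (g x), \<one>\<^bsub>K\<^esub>)"
  have e: "?e \<in> carrier ?TX" by (rule basis_TF[OF lift_closed[OF g] B.one_closed])
  have "tensor_map K A ?FY T \<phi> (tensor_section X g) = ?SY +>\<^bsub>?TY\<^esub> L ?e"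
    unfolding tensor_map_def tensor_section_def pure_tensor_def L_def[symmetric]
    by (rule induced_coset[OF submodule_abelian_subgroup[OF span_submodule TX.abelian_group]
          submodule_abelian_subgroup[OF span_submodule TY.abelian_group] linear_additive[OF L] im e])
  also have "\<dots> = tensor_section Y (tensor_value Y (L ?e))"
    by (rule tensor_section_value[OF linear_closed[OF L e], symmetric])
  also have "tensor_value Y (L ?e) = base_change \<alpha> \<iota> \<phi> g"
    by (simp only: val[OF e] tensor_value_pure[OF g])
  finally show ?thesis .
qed

theorem Tor_reduced:
  "graded_isomorphic K
    (homology (\<lambda>i. free_module K (res_gens A T i)) (\<lambda>i. base_change \<alpha> \<iota> (res_diff A)))
    (Tor K A T T)"
  "right_module K (Tor K A T T i)"
proof -
  let ?X = "res_gens A T"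
  interpret R: free_resolution A T ?X "\<lambda>_. res_diff A" "res_aug A T"
    by (rule free_resolution_res[OF right_module_T])
  have C: "chain_complex K (\<lambda>i. free_module K (?X i)) (\<lambda>i. base_change \<alpha> \<iota> (res_diff A))"
    by (rule R.chain_complex_base_change[OF ring_surjection_axioms])
  note T = chain_complex_transport[OF C, where D = "\<lambda>i. tensor K A (free_module A (?X i)) T"
      and s = "\<lambda>i. tensor_section (?X i)"
      and d' = "\<lambda>i. tensor_map K A (free_module A (?X i)) T (res_diff A)",
      OF right_module_tensor tensor_section_linear tensor_section_bij tensor_map_section[OF R.d_linear]]
  show "graded_isomorphic K
    (homology (\<lambda>i. free_module K (?X i)) (\<lambda>i. base_change \<alpha> \<iota> (res_diff A))) (Tor K A T T)"
    unfolding Tor_def res_module_def by (rule T(2))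
  show "right_module K (Tor K A T T i)"
    unfolding Tor_def res_module_def by (rule chain_complex.right_module_homology[OF T(1)])
qed

end


section \<open>Twisted monoid algebras\<close>

text \<open>\<open>w_cocycle\<close> is the 2-cocycle identity, that is, associativity of the
  twisted product on basis elements; \<open>w_one\<close> normalises the cocycle so that the unit of
  \<open>D\<close> stays a unit.\<close>

locale twisted_monoid = K: cring K + D: monoid D
  for K :: "('k, 'r) ring_scheme" and D :: "'d monoid" and w :: "'d \<Rightarrow> 'd \<Rightarrow> 'k" +
  assumes w_closed [simp]: "\<And>x y. \<lbrakk>x \<in> carrier D; y \<in> carrier D\<rbrakk> \<Longrightarrow> w x y \<in> carrier K"
    and w_cocycle: "\<And>x y z. \<lbrakk>x \<in> carrier D; y \<in> carrier D; z \<in> carrier D\<rbrakk> \<Longrightarrow>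
      w x y \<otimes>\<^bsub>K\<^esub> w (x \<otimes>\<^bsub>D\<^esub> y) z = w y z \<otimes>\<^bsub>K\<^esub> w x (y \<otimes>\<^bsub>D\<^esub> z)"
    and w_one: "\<And>x. x \<in> carrier D \<Longrightarrow> w \<one>\<^bsub>D\<^esub> x = \<one>\<^bsub>K\<^esub>" "\<And>x. x \<in> carrier D \<Longrightarrow> w x \<one>\<^bsub>D\<^esub> = \<one>\<^bsub>K\<^esub>"
begin

section \<open>The ring structure of a twisted monoid algebra\<close>

definition A :: "('k, 'd \<Rightarrow> 'k) module" where "A = twisted_monoid_algebra K D w"

abbreviation (input) F where "F \<equiv> free_module K (carrier D)"

lemma A_simps:
  "carrier A = carrier F" "zero A = zero F" "add A = add F" "smult A = smult F" "one A = single K \<one>\<^bsub>D\<^esub> \<one>\<^bsub>K\<^esub>"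
  by (simp_all add: A_def twisted_monoid_algebra_def basis_vec_single)

lemma abelian_group_A: "abelian_group A"
  using K.abelian_group_free_module[of "carrier D"]
  unfolding abelian_group_def abelian_monoid_def abelian_group_axioms_def A_simps by assumption

lemma single_A: "\<lbrakk>x \<in> carrier D; c \<in> carrier K\<rbrakk> \<Longrightarrow> single K x c \<in> carrier A"
  unfolding A_simps by (rule K.single_closed)

text \<open>The defining sum runs over pairs of points in the two supports. Fixed finite sets in
  their place make the sums for different factors comparable, which distributivity requires.\<close>

lemma mult_superset:
  assumes a: "a \<in> carrier F" and b: "b \<in> carrier F"
    and S: "finite S" "{x. a x \<noteq> \<zero>\<^bsub>K\<^esub>} \<subseteq> S" "S \<subseteq> carrier D"
    and T: "finite T" "{x. b x \<noteq> \<zero>\<^bsub>K\<^esub>} \<subseteq> T" "T \<subseteq> carrier D"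
  shows "(a \<otimes>\<^bsub>A\<^esub> b) z
    = finsum K (\<lambda>(x, y). w x y \<otimes>\<^bsub>K\<^esub> (a x \<otimes>\<^bsub>K\<^esub> b y)) {(x, y). x \<in> S \<and> y \<in> T \<and> x \<otimes>\<^bsub>D\<^esub> y = z}"
proof -
  let ?f = "\<lambda>(x, y). w x y \<otimes>\<^bsub>K\<^esub> (a x \<otimes>\<^bsub>K\<^esub> b y)"
  let ?P = "{(x, y). a x \<noteq> \<zero>\<^bsub>K\<^esub> \<and> b y \<noteq> \<zero>\<^bsub>K\<^esub> \<and> x \<otimes>\<^bsub>D\<^esub> y = z}"
  let ?Q = "{(x, y). x \<in> S \<and> y \<in> T \<and> x \<otimes>\<^bsub>D\<^esub> y = z}"
  have fin: "finite ?Q"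
    by (rule finite_subset[OF _ finite_cartesian_product[OF S(1) T(1)]]) auto
  have sub: "?P \<subseteq> ?Q" using S T by blast
  have SD: "x \<in> carrier D" if "x \<in> S" for x using S that by blast
  have TD: "x \<in> carrier D" if "x \<in> T" for x using T that by blast
  have zero: "?f p = \<zero>\<^bsub>K\<^esub>" if "p \<in> ?Q - ?P" for p
  proof -
    obtain x y where p: "p = (x, y)" by (cases p)
    then have xy: "x \<in> S" "y \<in> T" and z: "a x = \<zero>\<^bsub>K\<^esub> \<or> b y = \<zero>\<^bsub>K\<^esub>" using that by auto
    show ?thesis
      using z SD[OF xy(1)] TD[OF xy(2)] K.free_module_value[OF a, of x] K.free_module_value[OF b, of y]
      by (elim disjE) (simp_all add: p)
  qed
  have closed: "?f \<in> ?Q \<rightarrow> carrier K"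
    using SD TD K.free_module_value[OF a] K.free_module_value[OF b] by auto
  have "finsum K ?f ?P = finsum K ?f ?Q"
    by (rule K.add.finprod_mono_neutral_cong_left[OF fin sub zero refl closed])
  then show ?thesis by (simp add: A_def twisted_monoid_algebra_def)
qed

lemma mult_closed:
  assumes a: "a \<in> carrier F" and b: "b \<in> carrier F"
  shows "a \<otimes>\<^bsub>A\<^esub> b \<in> carrier F"
proof -
  let ?S = "{x. a x \<noteq> \<zero>\<^bsub>K\<^esub>}" and ?T = "{x. b x \<noteq> \<zero>\<^bsub>K\<^esub>}"
  note S = free_module_support[OF a] and T = free_module_support[OF b]
  note m = mult_superset[OF a b S(1) subset_refl S(2) T(1) subset_refl T(2)]
  show ?thesis
  proof (rule free_module_carrierI)
    show "finite ((\<lambda>(x, y). x \<otimes>\<^bsub>D\<^esub> y) ` (?S \<times> ?T))" using S T by simp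
    show "(\<lambda>(x, y). x \<otimes>\<^bsub>D\<^esub> y) ` (?S \<times> ?T) \<subseteq> carrier D" using S T by (auto intro!: D.m_closed)
    fix z
    have "x \<in> carrier D" if "x \<in> ?S" for x using S that by auto
    moreover have "x \<in> carrier D" if "x \<in> ?T" for x using T that by auto
    ultimately show "(a \<otimes>\<^bsub>A\<^esub> b) z \<in> carrier K"
      unfolding m using K.free_module_value[OF a] K.free_module_value[OF b]
      by (auto intro!: K.finsum_closed)
    assume "z \<notin> (\<lambda>(x, y). x \<otimes>\<^bsub>D\<^esub> y) ` (?S \<times> ?T)"
    then have e: "{(x, y). x \<in> ?S \<and> y \<in> ?T \<and> x \<otimes>\<^bsub>D\<^esub> y = z} = {}" by auto
    show "(a \<otimes>\<^bsub>A\<^esub> b) z = \<zero>\<^bsub>K\<^esub>" by (simp only: m e K.finsum_empty)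
  qed
qed

lemma mult_single:
  assumes "x \<in> carrier D" "y \<in> carrier D" "c \<in> carrier K" "d \<in> carrier K"
  shows "single K x c \<otimes>\<^bsub>A\<^esub> single K y d = single K (x \<otimes>\<^bsub>D\<^esub> y) (w x y \<otimes>\<^bsub>K\<^esub> (c \<otimes>\<^bsub>K\<^esub> d))"
proof
  fix z
  have eq: "(single K x c \<otimes>\<^bsub>A\<^esub> single K y d) z
      = finsum K (\<lambda>(x', y'). w x' y' \<otimes>\<^bsub>K\<^esub> (single K x c x' \<otimes>\<^bsub>K\<^esub> single K y d y'))
          {(x', y'). x' \<in> {x} \<and> y' \<in> {y} \<and> x' \<otimes>\<^bsub>D\<^esub> y' = z}"
    using assms by (intro mult_superset K.single_closed) (auto simp: single_def)
  have "{(x', y'). x' \<in> {x} \<and> y' \<in> {y} \<and> x' \<otimes>\<^bsub>D\<^esub> y' = z} = (if x \<otimes>\<^bsub>D\<^esub> y = z then {(x, y)} else {})"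
    by auto
  then show "(single K x c \<otimes>\<^bsub>A\<^esub> single K y d) z = single K (x \<otimes>\<^bsub>D\<^esub> y) (w x y \<otimes>\<^bsub>K\<^esub> (c \<otimes>\<^bsub>K\<^esub> d)) z"
    unfolding eq using assms by (auto simp: single_def)
qed

lemma mult_add:
  assumes a: "a \<in> carrier F" and a': "a' \<in> carrier F" and b: "b \<in> carrier F"
  shows "(a \<oplus>\<^bsub>F\<^esub> a') \<otimes>\<^bsub>A\<^esub> b = (a \<otimes>\<^bsub>A\<^esub> b) \<oplus>\<^bsub>F\<^esub> (a' \<otimes>\<^bsub>A\<^esub> b)"
    and "b \<otimes>\<^bsub>A\<^esub> (a \<oplus>\<^bsub>F\<^esub> a') = (b \<otimes>\<^bsub>A\<^esub> a) \<oplus>\<^bsub>F\<^esub> (b \<otimes>\<^bsub>A\<^esub> a')"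
proof -
  let ?S = "{x. a x \<noteq> \<zero>\<^bsub>K\<^esub>} \<union> {x. a' x \<noteq> \<zero>\<^bsub>K\<^esub>}" and ?T = "{x. b x \<noteq> \<zero>\<^bsub>K\<^esub>}"
  have S: "finite ?S" "?S \<subseteq> carrier D" using free_module_support[OF a] free_module_support[OF a'] by auto
  note T = free_module_support[OF b]
  have sub: "{x. a x \<noteq> \<zero>\<^bsub>K\<^esub>} \<subseteq> ?S" "{x. a' x \<noteq> \<zero>\<^bsub>K\<^esub>} \<subseteq> ?S" "{x. (a \<oplus>\<^bsub>F\<^esub> a') x \<noteq> \<zero>\<^bsub>K\<^esub>} \<subseteq> ?S"
    by auto
  have aa: "a \<oplus>\<^bsub>F\<^esub> a' \<in> carrier F" using K.free_module_add_closed[OF a a'] by simp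
  note v = K.free_module_value[OF a] K.free_module_value[OF a'] K.free_module_value[OF b]
  have SD: "x \<in> carrier D" if "x \<in> ?S" for x using S that by blast
  have TD: "x \<in> carrier D" if "x \<in> ?T" for x using T that by blast
  show "(a \<oplus>\<^bsub>F\<^esub> a') \<otimes>\<^bsub>A\<^esub> b = (a \<otimes>\<^bsub>A\<^esub> b) \<oplus>\<^bsub>F\<^esub> (a' \<otimes>\<^bsub>A\<^esub> b)"
  proof
    fix z
    let ?P = "{(x, y). x \<in> ?S \<and> y \<in> ?T \<and> x \<otimes>\<^bsub>D\<^esub> y = z}"
    have "((a \<oplus>\<^bsub>F\<^esub> a') \<otimes>\<^bsub>A\<^esub> b) z
        = finsum K (\<lambda>p. (case p of (x, y) \<Rightarrow> w x y \<otimes>\<^bsub>K\<^esub> (a x \<otimes>\<^bsub>K\<^esub> b y)) \<oplus>\<^bsub>K\<^esub>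
            (case p of (x, y) \<Rightarrow> w x y \<otimes>\<^bsub>K\<^esub> (a' x \<otimes>\<^bsub>K\<^esub> b y))) ?P"
      unfolding mult_superset[OF aa b S(1) sub(3) S(2) T(1) subset_refl T(2)]
      using v SD TD by (intro K.finsum_cong') (auto simp: K.l_distr K.r_distr)
    also have "\<dots> = (a \<otimes>\<^bsub>A\<^esub> b) z \<oplus>\<^bsub>K\<^esub> (a' \<otimes>\<^bsub>A\<^esub> b) z"
      unfolding mult_superset[OF a b S(1) sub(1) S(2) T(1) subset_refl T(2)]
        mult_superset[OF a' b S(1) sub(2) S(2) T(1) subset_refl T(2)]
      using v SD TD by (intro K.finsum_addf) auto
    finally show "((a \<oplus>\<^bsub>F\<^esub> a') \<otimes>\<^bsub>A\<^esub> b) z = ((a \<otimes>\<^bsub>A\<^esub> b) \<oplus>\<^bsub>F\<^esub> (a' \<otimes>\<^bsub>A\<^esub> b)) z" by simp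
  qed
  show "b \<otimes>\<^bsub>A\<^esub> (a \<oplus>\<^bsub>F\<^esub> a') = (b \<otimes>\<^bsub>A\<^esub> a) \<oplus>\<^bsub>F\<^esub> (b \<otimes>\<^bsub>A\<^esub> a')"
  proof
    fix z
    let ?P = "{(x, y). x \<in> ?T \<and> y \<in> ?S \<and> x \<otimes>\<^bsub>D\<^esub> y = z}"
    have "(b \<otimes>\<^bsub>A\<^esub> (a \<oplus>\<^bsub>F\<^esub> a')) z
        = finsum K (\<lambda>p. (case p of (x, y) \<Rightarrow> w x y \<otimes>\<^bsub>K\<^esub> (b x \<otimes>\<^bsub>K\<^esub> a y)) \<oplus>\<^bsub>K\<^esub>
            (case p of (x, y) \<Rightarrow> w x y \<otimes>\<^bsub>K\<^esub> (b x \<otimes>\<^bsub>K\<^esub> a' y))) ?P"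
      unfolding mult_superset[OF b aa T(1) subset_refl T(2) S(1) sub(3) S(2)]
      using v SD TD by (intro K.finsum_cong') (auto simp: K.l_distr K.r_distr)
    also have "\<dots> = (b \<otimes>\<^bsub>A\<^esub> a) z \<oplus>\<^bsub>K\<^esub> (b \<otimes>\<^bsub>A\<^esub> a') z"
      unfolding mult_superset[OF b a T(1) subset_refl T(2) S(1) sub(1) S(2)]
        mult_superset[OF b a' T(1) subset_refl T(2) S(1) sub(2) S(2)]
      using v SD TD by (intro K.finsum_addf) auto
    finally show "(b \<otimes>\<^bsub>A\<^esub> (a \<oplus>\<^bsub>F\<^esub> a')) z = ((b \<otimes>\<^bsub>A\<^esub> a) \<oplus>\<^bsub>F\<^esub> (b \<otimes>\<^bsub>A\<^esub> a')) z" by simp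
  qed
qed

lemma mult_additive:
  "b \<in> carrier F \<Longrightarrow> (\<lambda>a. a \<otimes>\<^bsub>A\<^esub> b) \<in> additive_maps F F"
  "b \<in> carrier F \<Longrightarrow> (\<lambda>a. b \<otimes>\<^bsub>A\<^esub> a) \<in> additive_maps F F"
proof -
  assume b: "b \<in> carrier F"
  show "(\<lambda>a. a \<otimes>\<^bsub>A\<^esub> b) \<in> additive_maps F F"
    using b by (intro additive_mapsI mult_closed mult_add(1))
  show "(\<lambda>a. b \<otimes>\<^bsub>A\<^esub> a) \<in> additive_maps F F"
    using b by (intro additive_mapsI mult_closed mult_add(2))
qed

text \<open>Algebra elements are finite sums of scaled basis elements, so identities between
  biadditive expressions, such as multiplicativity of a map, reduce to pairs of scaled basis
  elements.\<close>

lemma biadditive_eqI: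
  assumes N: "abelian_group N"
    and "\<And>b. b \<in> carrier F \<Longrightarrow> (\<lambda>a. f a b) \<in> additive_maps F N" "\<And>a. a \<in> carrier F \<Longrightarrow> f a \<in> additive_maps F N"
    and "\<And>b. b \<in> carrier F \<Longrightarrow> (\<lambda>a. g a b) \<in> additive_maps F N" "\<And>a. a \<in> carrier F \<Longrightarrow> g a \<in> additive_maps F N"
    and eq: "\<And>x c y d. \<lbrakk>x \<in> carrier D; c \<in> carrier K; y \<in> carrier D; d \<in> carrier K\<rbrakk> \<Longrightarrow>
      f (single K x c) (single K y d) = g (single K x c) (single K y d)"
    and a: "a \<in> carrier F" and b: "b \<in> carrier F"
  shows "f a b = g a b"
proof (rule additive_eqI[OF K.ring_axioms N assms(2)[OF b] assms(4)[OF b] _ a])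
  fix x c assume x: "x \<in> carrier D" and c: "c \<in> carrier K"
  note s = K.single_closed[OF x c]
  show "f (single K x c) b = g (single K x c) b"
    by (rule additive_eqI[OF K.ring_axioms N assms(3)[OF s] assms(5)[OF s] eq[OF x c] b])
qed

lemma ring_A: "ring A"
proof (rule ringI[OF abelian_group_A])
  interpret F: abelian_group F by (rule K.abelian_group_free_module)
  note ab = F.abelian_group_axioms
  have one: "single K \<one>\<^bsub>D\<^esub> \<one>\<^bsub>K\<^esub> \<in> carrier F" by (rule K.single_closed) auto
  have id: "(\<lambda>a. a) \<in> additive_maps F F" by (rule linear_additive[OF linear_id])
  show "monoid A"
  proof (rule monoidI)
    show "a \<otimes>\<^bsub>A\<^esub> b \<in> carrier A" if "a \<in> carrier A" "b \<in> carrier A" for a b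
      using that unfolding A_simps by (rule mult_closed)
    show "\<one>\<^bsub>A\<^esub> \<in> carrier A" using one by (simp only: A_simps)
    show "\<one>\<^bsub>A\<^esub> \<otimes>\<^bsub>A\<^esub> a = a" if "a \<in> carrier A" for a
      unfolding A_simps(5)
      by (rule additive_eqI[OF K.ring_axioms ab mult_additive(2)[OF one] id _ that[unfolded A_simps]])
        (simp add: mult_single w_one)
    show "a \<otimes>\<^bsub>A\<^esub> \<one>\<^bsub>A\<^esub> = a" if "a \<in> carrier A" for a
      unfolding A_simps(5)
      by (rule additive_eqI[OF K.ring_axioms ab mult_additive(1)[OF one] id _ that[unfolded A_simps]])
        (simp add: mult_single w_one)
    fix a b c assume abc: "a \<in> carrier A" "b \<in> carrier A" "c \<in> carrier A"
    note [simp] = mult_closed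
    show "(a \<otimes>\<^bsub>A\<^esub> b) \<otimes>\<^bsub>A\<^esub> c = a \<otimes>\<^bsub>A\<^esub> (b \<otimes>\<^bsub>A\<^esub> c)"
    proof (rule additive_eqI[OF K.ring_axioms ab, where f = "\<lambda>a. (a \<otimes>\<^bsub>A\<^esub> b) \<otimes>\<^bsub>A\<^esub> c"
          and g = "\<lambda>a. a \<otimes>\<^bsub>A\<^esub> (b \<otimes>\<^bsub>A\<^esub> c)"])
      show "(\<lambda>a. (a \<otimes>\<^bsub>A\<^esub> b) \<otimes>\<^bsub>A\<^esub> c) \<in> additive_maps F F" "(\<lambda>a. a \<otimes>\<^bsub>A\<^esub> (b \<otimes>\<^bsub>A\<^esub> c)) \<in> additive_maps F F"
        by (rule additive_comp[OF mult_additive(1) mult_additive(1)] mult_additive(1) mult_closed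
            abc[unfolded A_simps])+
      show "a \<in> carrier F" using abc by (simp only: A_simps)
      fix x p assume x: "x \<in> carrier D" "p \<in> carrier K"
      note s = K.single_closed[OF x]
      show "(single K x p \<otimes>\<^bsub>A\<^esub> b) \<otimes>\<^bsub>A\<^esub> c = single K x p \<otimes>\<^bsub>A\<^esub> (b \<otimes>\<^bsub>A\<^esub> c)"
      proof (rule biadditive_eqI[OF ab, where f = "\<lambda>b c. (single K x p \<otimes>\<^bsub>A\<^esub> b) \<otimes>\<^bsub>A\<^esub> c"
            and g = "\<lambda>b c. single K x p \<otimes>\<^bsub>A\<^esub> (b \<otimes>\<^bsub>A\<^esub> c)"])
        show "b \<in> carrier F" "c \<in> carrier F" using abc by (simp_all only: A_simps)
        show "(\<lambda>b. (single K x p \<otimes>\<^bsub>A\<^esub> b) \<otimes>\<^bsub>A\<^esub> c) \<in> additive_maps F F"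
            "(\<lambda>b. single K x p \<otimes>\<^bsub>A\<^esub> (b \<otimes>\<^bsub>A\<^esub> c)) \<in> additive_maps F F"
            "(\<lambda>b. (single K x p \<otimes>\<^bsub>A\<^esub> c) \<otimes>\<^bsub>A\<^esub> b) \<in> additive_maps F F"
            "(\<lambda>b. single K x p \<otimes>\<^bsub>A\<^esub> (c \<otimes>\<^bsub>A\<^esub> b)) \<in> additive_maps F F" if c: "c \<in> carrier F" for c
          by (rule additive_comp[OF mult_additive(2)[OF s] mult_additive(1)[OF c]]
            additive_comp[OF mult_additive(1)[OF c] mult_additive(2)[OF s]]
            mult_additive(2)[OF mult_closed[OF s c]]
            additive_comp[OF mult_additive(2)[OF c] mult_additive(2)[OF s]])+
        fix y q z r assume yz: "y \<in> carrier D" "q \<in> carrier K" "z \<in> carrier D" "r \<in> carrier K"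
        \<comment> \<open>Both bracketings of \<open>x\<close>, \<open>y\<close>, \<open>z\<close>
          give the same element of \<open>D\<close>; the coefficients agree by the cocycle
          identity.\<close>
        have "w (x \<otimes>\<^bsub>D\<^esub> y) z \<otimes>\<^bsub>K\<^esub> ((w x y \<otimes>\<^bsub>K\<^esub> (p \<otimes>\<^bsub>K\<^esub> q)) \<otimes>\<^bsub>K\<^esub> r)
            = (w x y \<otimes>\<^bsub>K\<^esub> w (x \<otimes>\<^bsub>D\<^esub> y) z) \<otimes>\<^bsub>K\<^esub> (p \<otimes>\<^bsub>K\<^esub> q \<otimes>\<^bsub>K\<^esub> r)"
          using x yz by (simp add: K.m_ac)
        also have "\<dots> = w x (y \<otimes>\<^bsub>D\<^esub> z) \<otimes>\<^bsub>K\<^esub> (p \<otimes>\<^bsub>K\<^esub> (w y z \<otimes>\<^bsub>K\<^esub> (q \<otimes>\<^bsub>K\<^esub> r)))"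
          using x yz by (simp only: w_cocycle) (simp add: K.m_ac)
        finally show "(single K x p \<otimes>\<^bsub>A\<^esub> single K y q) \<otimes>\<^bsub>A\<^esub> single K z r
            = single K x p \<otimes>\<^bsub>A\<^esub> (single K y q \<otimes>\<^bsub>A\<^esub> single K z r)"
          using x yz by (simp add: mult_single D.m_assoc)
      qed
    qed
  qed
qed (simp_all only: A_simps mult_add)

definition unit_map :: "'k \<Rightarrow> 'd \<Rightarrow> 'k" where "unit_map c = single K \<one>\<^bsub>D\<^esub> c"

lemma unit_map_hom: "unit_map \<in> ring_hom K A"
proof (rule ring_hom_memI)
  fix c assume c: "c \<in> carrier K"
  show "unit_map c \<in> carrier A" using c by (simp add: unit_map_def single_A)
  fix d assume d: "d \<in> carrier K"
  show "unit_map (c \<otimes>\<^bsub>K\<^esub> d) = unit_map c \<otimes>\<^bsub>A\<^esub> unit_map d"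
    using c d by (simp add: unit_map_def mult_single w_one)
  show "unit_map (c \<oplus>\<^bsub>K\<^esub> d) = unit_map c \<oplus>\<^bsub>A\<^esub> unit_map d"
    using c d by (auto simp: unit_map_def A_simps single_def)
qed (simp add: unit_map_def A_simps)

end

text \<open>\<open>E\<close> is a submonoid whose complement is an ideal, on which the twisting is trivial.\<close>

locale twisted_monoid_face = twisted_monoid K D w
  for K :: "('k, 'r) ring_scheme" and D :: "'d monoid" and w :: "'d \<Rightarrow> 'd \<Rightarrow> 'k" +
  fixes E :: "'d set"
  assumes E_sub: "E \<subseteq> carrier D" and E_one: "\<one>\<^bsub>D\<^esub> \<in> E"
    and E_mult: "\<And>x y. \<lbrakk>x \<in> carrier D; y \<in> carrier D\<rbrakk> \<Longrightarrow> x \<otimes>\<^bsub>D\<^esub> y \<in> E \<longleftrightarrow> x \<in> E \<and> y \<in> E"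
    and E_w: "\<And>x y. \<lbrakk>x \<in> E; y \<in> E\<rbrakk> \<Longrightarrow> w x y = \<one>\<^bsub>K\<^esub>"
begin

section \<open>The augmentation attached to a face\<close>

definition augmentation :: "('d \<Rightarrow> 'k) \<Rightarrow> 'k" where
  "augmentation a = (\<Oplus>\<^bsub>K\<^esub>x\<in>{x \<in> E. a x \<noteq> \<zero>\<^bsub>K\<^esub>}. a x)"

lemma augmentation_superset:
  assumes "a \<in> carrier F" "finite S" "{x. a x \<noteq> \<zero>\<^bsub>K\<^esub>} \<subseteq> S"
  shows "augmentation a = (\<Oplus>\<^bsub>K\<^esub>x\<in>S \<inter> E. a x)"
  unfolding augmentation_def using assms K.free_module_value[OF assms(1)]
  by (intro K.add.finprod_mono_neutral_cong_left) auto

lemma augmentation_additive: "augmentation \<in> additive_maps F K"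
proof (rule additive_mapsI)
  fix a assume a: "a \<in> carrier F"
  note Sa = free_module_support(1)[OF a]
  show "augmentation a \<in> carrier K"
    unfolding augmentation_def using K.free_module_value[OF a] by (auto intro: K.finsum_closed)
  fix b assume b: "b \<in> carrier F"
  note Sb = free_module_support(1)[OF b]
  let ?S = "{x. a x \<noteq> \<zero>\<^bsub>K\<^esub>} \<union> {x. b x \<noteq> \<zero>\<^bsub>K\<^esub>}"
  have fin: "finite ?S" using Sa Sb by simp
  have ab: "a \<oplus>\<^bsub>F\<^esub> b \<in> carrier F" using K.free_module_add_closed[OF a b] by simp
  have "augmentation (a \<oplus>\<^bsub>F\<^esub> b) = (\<Oplus>\<^bsub>K\<^esub>x\<in>?S \<inter> E. a x \<oplus>\<^bsub>K\<^esub> b x)"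
    by (subst augmentation_superset[OF ab fin]) auto
  also have "\<dots> = (\<Oplus>\<^bsub>K\<^esub>x\<in>?S \<inter> E. a x) \<oplus>\<^bsub>K\<^esub> (\<Oplus>\<^bsub>K\<^esub>x\<in>?S \<inter> E. b x)"
    using fin K.free_module_value[OF a] K.free_module_value[OF b] by (intro K.finsum_addf) auto
  also have "(\<Oplus>\<^bsub>K\<^esub>x\<in>?S \<inter> E. a x) = augmentation a"
    by (rule augmentation_superset[OF a fin, symmetric]) auto
  also have "(\<Oplus>\<^bsub>K\<^esub>x\<in>?S \<inter> E. b x) = augmentation b"
    by (rule augmentation_superset[OF b fin, symmetric]) auto
  finally show "augmentation (a \<oplus>\<^bsub>F\<^esub> b) = augmentation a \<oplus>\<^bsub>K\<^esub> augmentation b" .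
qed

lemma augmentation_single:
  assumes "x \<in> carrier D" "c \<in> carrier K"
  shows "augmentation (single K x c) = (if x \<in> E then c else \<zero>\<^bsub>K\<^esub>)"
proof -
  have "augmentation (single K x c) = (\<Oplus>\<^bsub>K\<^esub>y\<in>{x} \<inter> E. single K x c y)"
    using assms by (intro augmentation_superset K.single_closed) (auto simp: single_def)
  also have "\<dots> = (if x \<in> E then c else \<zero>\<^bsub>K\<^esub>)" using assms by (auto simp: single_def)
  finally show ?thesis .
qed

text \<open>Sending the elements outside \<open>E\<close> to zero is multiplicative because they
  span an ideal; on \<open>E\<close> the twist is trivial, so basis elements can all go to
  one.\<close>

lemma augmentation_hom: "augmentation \<in> ring_hom A K"
proof (rule ring_hom_memI)
  show "augmentation a \<in> carrier K" if "a \<in> carrier A" for a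
    using that additive_closed[OF augmentation_additive] by (simp only: A_simps)
  show "augmentation (a \<oplus>\<^bsub>A\<^esub> b) = augmentation a \<oplus>\<^bsub>K\<^esub> augmentation b" if "a \<in> carrier A" "b \<in> carrier A" for a b
    using that additive_add[OF augmentation_additive] by (simp only: A_simps)
  show "augmentation \<one>\<^bsub>A\<^esub> = \<one>\<^bsub>K\<^esub>" by (simp only: A_simps) (simp add: augmentation_single E_one)
  fix a b assume ab: "a \<in> carrier A" "b \<in> carrier A"
  note closed = additive_closed[OF augmentation_additive] and add = additive_add[OF augmentation_additive]
  show "augmentation (a \<otimes>\<^bsub>A\<^esub> b) = augmentation a \<otimes>\<^bsub>K\<^esub> augmentation b"
  proof (rule biadditive_eqI[OF K.is_abelian_group, where f = "\<lambda>a b. augmentation (a \<otimes>\<^bsub>A\<^esub> b)"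
        and g = "\<lambda>a b. augmentation a \<otimes>\<^bsub>K\<^esub> augmentation b"])
    show "a \<in> carrier F" "b \<in> carrier F" using ab by (simp_all only: A_simps)
    show "(\<lambda>a. augmentation (a \<otimes>\<^bsub>A\<^esub> b)) \<in> additive_maps F K"
      "(\<lambda>a. augmentation (b \<otimes>\<^bsub>A\<^esub> a)) \<in> additive_maps F K" if "b \<in> carrier F" for b
      by (rule additive_comp[OF mult_additive(1)[OF that] augmentation_additive]
        additive_comp[OF mult_additive(2)[OF that] augmentation_additive])+
    show "(\<lambda>a. augmentation a \<otimes>\<^bsub>K\<^esub> augmentation b) \<in> additive_maps F K"
      "(\<lambda>a. augmentation b \<otimes>\<^bsub>K\<^esub> augmentation a) \<in> additive_maps F K" if "b \<in> carrier F" for b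
      using closed that add
      by (auto intro!: additive_mapsI simp: K.l_distr K.r_distr simp del: free_module_simps)
    fix x c y d assume "x \<in> carrier D" "c \<in> carrier K" "y \<in> carrier D" "d \<in> carrier K"
    then show "augmentation (single K x c \<otimes>\<^bsub>A\<^esub> single K y d)
        = augmentation (single K x c) \<otimes>\<^bsub>K\<^esub> augmentation (single K y d)"
      by (simp add: mult_single augmentation_single E_mult E_w)
  qed
qed

lemma augmented_algebra: "augmented_algebra A K augmentation unit_map (trivial_module K E)"
proof (intro augmented_algebra.intro augmented_algebra_axioms.intro ring_surjection.intro
    ring_surjection_axioms.intro ring_A K.ring_axioms K.is_cring augmentation_hom unit_map_hom)
  show "augmentation (unit_map b) = b" if "b \<in> carrier K" for b
    using that by (simp add: unit_map_def augmentation_single E_one)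
  show "unit_map b \<in> carrier A" if "b \<in> carrier K" for b
    using that by (simp add: unit_map_def single_A)
  show "unit_map \<zero>\<^bsub>K\<^esub> = \<zero>\<^bsub>A\<^esub>" by (simp add: unit_map_def A_simps)
  show "c \<odot>\<^bsub>A\<^esub> \<one>\<^bsub>A\<^esub> = unit_map c" if "c \<in> carrier K" for c
    using that by (auto simp: unit_map_def A_simps single_def)
qed (simp_all add: trivial_module_def augmentation_def)

section \<open>The quotient algebra spanned by a face\<close>

definition restrict_face :: "('d \<Rightarrow> 'k) \<Rightarrow> 'd \<Rightarrow> 'k" where
  "restrict_face a = (\<lambda>x. if x \<in> E then a x else \<zero>\<^bsub>K\<^esub>)"

abbreviation (input) DE where "DE \<equiv> D\<lparr>carrier := E\<rparr>"

lemma face_closed: "x \<in> E \<Longrightarrow> x \<in> carrier D"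
  using E_sub by blast

lemma monoid_face: "monoid DE"
  by (rule monoidI) (simp_all add: D.m_assoc face_closed E_one E_mult)

interpretation face: twisted_monoid K DE "\<lambda>x y. \<one>\<^bsub>K\<^esub>"
  by (intro twisted_monoid.intro twisted_monoid_axioms.intro K.is_cring monoid_face) auto

text \<open>\<open>E\<close> regarded as a face of itself, which supplies the augmentation and the
  trivial module of the quotient algebra.\<close>

interpretation face: twisted_monoid_face K DE "\<lambda>x y. \<one>\<^bsub>K\<^esub>" E
  by (intro twisted_monoid_face.intro twisted_monoid_face_axioms.intro face.twisted_monoid_axioms)
    (simp_all add: E_one E_mult face_closed)

lemma face_A: "face.A = group_algebra K DE"
  by (simp add: face.A_def group_algebra_def)

lemma face_augmentation: "a \<in> carrier A \<Longrightarrow> augmentation a = face.augmentation (restrict_face a)"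
  unfolding augmentation_def face.augmentation_def restrict_face_def
  using K.free_module_value[of a "carrier D"]
  by (intro K.finsum_cong') (auto simp: A_simps)

lemma restrict_face_closed:
  assumes "a \<in> carrier F" shows "restrict_face a \<in> carrier (free_module K E)"
  using free_module_support(1)[OF assms] K.free_module_value[OF assms]
  by (intro free_module_carrierI[of _ _ _ "{x. a x \<noteq> \<zero>\<^bsub>K\<^esub>} \<inter> E"]) (auto simp: restrict_face_def)

lemma restrict_face_single:
  "restrict_face (single K x c) = (if x \<in> E then single K x c else (\<lambda>y. \<zero>\<^bsub>K\<^esub>))"
  by (auto simp: restrict_face_def single_def)

lemma restrict_face_additive: "restrict_face \<in> additive_maps F (free_module K E)"
  by (rule additive_mapsI[OF restrict_face_closed]) (auto simp: restrict_face_def)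

lemma restrict_face_hom: "restrict_face \<in> ring_hom A face.A"
proof (rule ring_hom_memI)
  have fF: "free_module K (carrier DE) = free_module K E" by simp
  show "restrict_face a \<in> carrier face.A" if "a \<in> carrier A" for a
    using that restrict_face_closed by (simp only: A_simps face.A_simps fF)
  show "restrict_face (a \<oplus>\<^bsub>A\<^esub> b) = restrict_face a \<oplus>\<^bsub>face.A\<^esub> restrict_face b"
    if "a \<in> carrier A" "b \<in> carrier A" for a b
    using that additive_add[OF restrict_face_additive] by (simp only: A_simps face.A_simps fF)
  show "restrict_face \<one>\<^bsub>A\<^esub> = \<one>\<^bsub>face.A\<^esub>"
    by (simp only: A_simps face.A_simps) (simp add: restrict_face_single E_one)
  fix a b assume ab: "a \<in> carrier A" "b \<in> carrier A"
  note comp = additive_comp[OF restrict_face_additive]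
  note fm = face.mult_additive[unfolded fF]
  show "restrict_face (a \<otimes>\<^bsub>A\<^esub> b) = restrict_face a \<otimes>\<^bsub>face.A\<^esub> restrict_face b"
  proof (rule biadditive_eqI[OF K.abelian_group_free_module, where f = "\<lambda>a b. restrict_face (a \<otimes>\<^bsub>A\<^esub> b)"
        and g = "\<lambda>a b. restrict_face a \<otimes>\<^bsub>face.A\<^esub> restrict_face b"])
    show "a \<in> carrier F" "b \<in> carrier F" using ab by (simp_all only: A_simps)
    show "(\<lambda>a. restrict_face (a \<otimes>\<^bsub>A\<^esub> b)) \<in> additive_maps F (free_module K E)"
      "(\<lambda>a. restrict_face (b \<otimes>\<^bsub>A\<^esub> a)) \<in> additive_maps F (free_module K E)" if "b \<in> carrier F" for b
      by (rule additive_comp[OF mult_additive(1)[OF that] restrict_face_additive]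
        additive_comp[OF mult_additive(2)[OF that] restrict_face_additive])+
    show "(\<lambda>a. restrict_face a \<otimes>\<^bsub>face.A\<^esub> restrict_face b) \<in> additive_maps F (free_module K E)"
      "(\<lambda>a. restrict_face b \<otimes>\<^bsub>face.A\<^esub> restrict_face a) \<in> additive_maps F (free_module K E)" if "b \<in> carrier F" for b
      by (rule comp[OF fm(1)[OF restrict_face_closed[OF that]]] comp[OF fm(2)[OF restrict_face_closed[OF that]]])+
    fix x c y d assume xy: "x \<in> carrier D" "c \<in> carrier K" "y \<in> carrier D" "d \<in> carrier K"
    have z: "z \<otimes>\<^bsub>face.A\<^esub> (\<lambda>x. \<zero>\<^bsub>K\<^esub>) = (\<lambda>x. \<zero>\<^bsub>K\<^esub>)" "(\<lambda>x. \<zero>\<^bsub>K\<^esub>) \<otimes>\<^bsub>face.A\<^esub> z = (\<lambda>x. \<zero>\<^bsub>K\<^esub>)" if "z \<in> carrier (free_module K E)" for z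
      using additive_zero[OF fm(2)[OF that] K.abelian_group_free_module K.abelian_group_free_module]
        additive_zero[OF fm(1)[OF that] K.abelian_group_free_module K.abelian_group_free_module] by simp_all
    have zc: "(\<lambda>x. \<zero>\<^bsub>K\<^esub>) \<in> carrier (free_module K E)"
      using abelian_groupE(2)[OF K.abelian_group_free_module[of E]] by simp
    show "restrict_face (single K x c \<otimes>\<^bsub>A\<^esub> single K y d)
        = restrict_face (single K x c) \<otimes>\<^bsub>face.A\<^esub> restrict_face (single K y d)"
    \<comment> \<open>If a factor lies outside \<open>E\<close>, so does the product, and both sides
      are zero.\<close>
    proof (cases "x \<in> E \<and> y \<in> E")
      case True
      then have "single K x c \<otimes>\<^bsub>face.A\<^esub> single K y d = single K (x \<otimes>\<^bsub>D\<^esub> y) (\<one>\<^bsub>K\<^esub> \<otimes>\<^bsub>K\<^esub> (c \<otimes>\<^bsub>K\<^esub> d))"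
        using face.mult_single[of x y c d] xy by simp
      then show ?thesis using True xy by (simp add: mult_single restrict_face_single E_mult E_w)
    next
      case False
      then have "restrict_face (single K x c) = (\<lambda>x. \<zero>\<^bsub>K\<^esub>) \<or> restrict_face (single K y d) = (\<lambda>x. \<zero>\<^bsub>K\<^esub>)"
        by (auto simp: restrict_face_single)
      then have "restrict_face (single K x c) \<otimes>\<^bsub>face.A\<^esub> restrict_face (single K y d) = (\<lambda>x. \<zero>\<^bsub>K\<^esub>)"
        using z restrict_face_closed[OF K.single_closed[OF xy(1,2)]]
          restrict_face_closed[OF K.single_closed[OF xy(3,4)]] by metis
      moreover have "x \<otimes>\<^bsub>D\<^esub> y \<notin> E" using False xy E_mult by blast
      then have "restrict_face (single K x c \<otimes>\<^bsub>A\<^esub> single K y d) = (\<lambda>x. \<zero>\<^bsub>K\<^esub>)"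
        using xy by (simp add: mult_single restrict_face_single)
      ultimately show ?thesis by simp
    qed
  qed
qed

text \<open>A function supported on \<open>E\<close> is already an element of \<open>A\<close>, so
  the identity serves as the section.\<close>

lemma restrict_face_surjection: "ring_surjection A face.A restrict_face (\<lambda>b. b)"
proof (intro ring_surjection.intro ring_surjection_axioms.intro ring_A face.ring_A restrict_face_hom)
  show "b \<in> carrier A" if "b \<in> carrier face.A" for b
    using that K.free_module_mono[OF E_sub] by (auto simp: A_simps face.A_simps)
  show "restrict_face b = b" if "b \<in> carrier face.A" for b
    using that by (auto simp: restrict_face_def face.A_simps free_module_carrier)
qed (simp add: A_simps face.A_simps)

text \<open>The kernel of restriction is the free module on the complement of \<open>E\<close>, and
  by additivity it is enough to kill the multiples of its basis elements.\<close>

lemma restrict_face_kernel: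
  assumes \<eta>: "\<eta> \<in> carrier A"
    and kill: "\<And>x c. \<lbrakk>x \<in> carrier D - E; c \<in> carrier K\<rbrakk> \<Longrightarrow> single K x c \<otimes>\<^bsub>A\<^esub> \<eta> = \<zero>\<^bsub>A\<^esub>"
    and a: "a \<in> carrier A" "restrict_face a = \<zero>\<^bsub>face.A\<^esub>"
  shows "a \<otimes>\<^bsub>A\<^esub> \<eta> = \<zero>\<^bsub>A\<^esub>"
proof -
  have aF: "a \<in> carrier F" using a(1) by (simp only: A_simps)
  have "a x = \<zero>\<^bsub>K\<^esub>" if "x \<in> E" for x
    using fun_cong[OF a(2), of x] that by (simp add: restrict_face_def face.A_simps)
  then have aE: "a \<in> carrier (free_module K (carrier D - E))"
    using aF by (auto simp: free_module_carrier)
  have sub: "carrier (free_module K (carrier D - E)) \<subseteq> carrier F" by (rule K.free_module_mono) auto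
  have \<eta>F: "\<eta> \<in> carrier F" using \<eta> by (simp only: A_simps)
  interpret F: abelian_group F by (rule K.abelian_group_free_module)
  show ?thesis
  proof (rule additive_eqI[OF K.ring_axioms F.abelian_group_axioms _ _ _ aE])
    show "(\<lambda>a. a \<otimes>\<^bsub>A\<^esub> \<eta>) \<in> additive_maps (free_module K (carrier D - E)) F"
      using mult_additive(1)[OF \<eta>F] sub by (auto simp: additive_maps_def)
    show "(\<lambda>a. \<zero>\<^bsub>A\<^esub>) \<in> additive_maps (free_module K (carrier D - E)) F"
      unfolding A_simps by (rule additive_mapsI[OF F.zero_closed F.l_zero[OF F.zero_closed, symmetric]])
  qed (rule kill)
qed

text \<open>The canonical resolution over \<open>A\<close>, restricted to the face, is a resolution
  over the quotient algebra on the same generators. Reduction to \<open>K\<close> in two steps or in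
  one gives the same complex, and comparison with the canonical resolution of the quotient algebra
  finishes the proof.\<close>

theorem Tor_face:
  assumes \<eta>: "\<eta> \<in> carrier A" "restrict_face \<eta> = \<one>\<^bsub>face.A\<^esub>"
    and kill: "\<And>x c. \<lbrakk>x \<in> carrier D - E; c \<in> carrier K\<rbrakk> \<Longrightarrow> single K x c \<otimes>\<^bsub>A\<^esub> \<eta> = \<zero>\<^bsub>A\<^esub>"
  shows "graded_isomorphic K (Tor K A (trivial_module K E) (trivial_module K E))
    (Tor K face.A (trivial_module K E) (trivial_module K E))"
proof -
  let ?T = "trivial_module K E"
  interpret A: augmented_algebra A K augmentation unit_map ?T by (rule augmented_algebra)
  interpret B: augmented_algebra face.A K face.augmentation face.unit_map ?T by (rule face.augmented_algebra)
  have R: "free_resolution A ?T (res_gens A ?T) (\<lambda>_. res_diff A) (res_aug A ?T)"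
    by (rule free_resolution_res[OF A.right_module_T])
  interpret R: free_resolution A ?T "res_gens A ?T" "\<lambda>_. res_diff A" "res_aug A ?T" by (rule R)
  have "free_resolution face.A ?T (res_gens A ?T) (\<lambda>_. base_change restrict_face (\<lambda>b. b) (res_diff A)) (\<lambda>g. res_aug A ?T (\<lambda>x. g x))"
  proof (rule free_resolution_base_change[OF R restrict_face_surjection B.right_module_T _ _ _ _ \<eta>
        restrict_face_kernel[OF \<eta>(1) kill]])
    show "a \<odot>\<^bsub>?T\<^esub> x = restrict_face a \<odot>\<^bsub>?T\<^esub> x" if "a \<in> carrier A" "x \<in> carrier ?T" for a x
    proof -
      have "x \<in> carrier K" using that by (simp add: trivial_module_def)
      then show ?thesis
        using that face_augmentation[OF that(1)] A.T_simps(4)[of a x] B.T_simps(4)[of "restrict_face a" x]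
          ring_hom_closed[OF restrict_face_hom that(1)]
        by simp
    qed
  qed simp_all
  from comparison[OF this free_resolution_res[OF B.right_module_T] B.ring_surjection_axioms]
  have "graded_isomorphic K
    (homology (\<lambda>i. free_module K (res_gens A ?T i))
      (\<lambda>i. base_change face.augmentation face.unit_map (base_change restrict_face (\<lambda>b. b) (res_diff A))))
    (homology (\<lambda>i. free_module K (res_gens face.A ?T i)) (\<lambda>i. base_change face.augmentation face.unit_map (res_diff face.A)))" .
  also have "homology (\<lambda>i. free_module K (res_gens A ?T i))
      (\<lambda>i. base_change face.augmentation face.unit_map (base_change restrict_face (\<lambda>b. b) (res_diff A)))
    = homology (\<lambda>i. free_module K (res_gens A ?T i)) (\<lambda>i. base_change augmentation unit_map (res_diff A))"
    by (rule homology_cong, rule base_change_base_change[OF restrict_face_surjection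
          B.ring_surjection_axioms A.ring_surjection_axioms _ R.d_linear]) (rule face_augmentation)
  finally have red: "graded_isomorphic K
    (homology (\<lambda>i. free_module K (res_gens A ?T i)) (\<lambda>i. base_change augmentation unit_map (res_diff A)))
    (homology (\<lambda>i. free_module K (res_gens face.A ?T i)) (\<lambda>i. base_change face.augmentation face.unit_map (res_diff face.A)))" .
  have mod: "right_module K (homology (\<lambda>i. free_module K (res_gens A ?T i)) (\<lambda>i. base_change augmentation unit_map (res_diff A)) i)" for i
    by (rule chain_complex.right_module_homology[OF R.chain_complex_base_change[OF A.ring_surjection_axioms]])
  show ?thesis
    by (rule graded_isomorphic_trans[OF graded_isomorphic_sym[OF A.Tor_reduced(1) mod]
          graded_isomorphic_trans[OF red B.Tor_reduced(1)]])
qed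

end


section \<open>The bar resolution\<close>

text \<open>The sign \<open>(-1)\<^sup>j\<close>, in the form in which it occurs in
  \<open>bar_diff\<close>.\<close>

definition alt :: "('a, 'm) ring_scheme \<Rightarrow> nat \<Rightarrow> 'a \<Rightarrow> 'a" where
  "alt M j v = (if even j then v else \<ominus>\<^bsub>M\<^esub> v)"

lemma (in abelian_group) alt_simps [simp]:
  "alt G 0 v = v"
  "v \<in> carrier G \<Longrightarrow> alt G j v \<in> carrier G"
  "v \<in> carrier G \<Longrightarrow> alt G (Suc (Suc j)) v = alt G j v"
  "v \<in> carrier G \<Longrightarrow> alt G j (alt G j v) = v"
  "v \<in> carrier G \<Longrightarrow> alt G (Suc j) v = \<ominus> alt G j v"
  by (auto simp: alt_def)

lemma additive_alt:
  assumes "f \<in> additive_maps M N" "abelian_group M" "abelian_group N" "v \<in> carrier M"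
  shows "f (alt M j v) = alt N j (f v)"
  using additive_neg[OF assms] by (simp add: alt_def)

locale bar_resolution = K: cring K + G: monoid G
  for K :: "('k, 'r) ring_scheme" and G :: "'g monoid"
begin

interpretation T: twisted_monoid K G "\<lambda>x y. \<one>\<^bsub>K\<^esub>"
  by (intro twisted_monoid.intro twisted_monoid_axioms.intro K.is_cring G.monoid_axioms) auto

interpretation T: twisted_monoid_face K G "\<lambda>x y. \<one>\<^bsub>K\<^esub>" "carrier G"
  by (intro twisted_monoid_face.intro twisted_monoid_face_axioms.intro T.twisted_monoid_axioms) auto

abbreviation (input) B where "B \<equiv> group_algebra K G"
abbreviation (input) triv where "triv \<equiv> group_trivial K G"
abbreviation (input) \<alpha> where "\<alpha> \<equiv> T.augmentation"
abbreviation (input) \<iota> where "\<iota> \<equiv> T.unit_map"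

lemma T_A: "T.A = B"
  by (simp add: T.A_def group_algebra_def)

lemma augmented: "augmented_algebra B K \<alpha> \<iota> triv"
  using T.augmented_algebra by (simp add: T_A group_trivial_def)

interpretation B: augmented_algebra B K \<alpha> \<iota> triv
  by (rule augmented)

lemmas B_simps = T.A_simps[unfolded T_A]
lemmas mult_single = T.mult_single[unfolded T_A]
lemmas single_B = T.single_A[unfolded T_A]

section \<open>Cells and boundary of the bar resolution\<close>

definition cells :: "nat \<Rightarrow> 'g list set" where
  "cells i = {l. set l \<subseteq> carrier G \<and> length l = i}"

abbreviation (input) BX where "BX i \<equiv> free_module B (cells i)"

lemma BX_abelian: "abelian_group (free_module B Y)"
  by (rule B.A.abelian_group_free_module)

lemma face_cells:
  assumes "l \<in> cells (Suc i)" "j \<le> Suc i"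
  shows "bar_face G j l \<in> cells i"
proof -
  have l: "set l \<subseteq> carrier G" "length l = Suc i" using assms by (auto simp: cells_def)
  have nth: "k < length l \<Longrightarrow> l ! k \<in> carrier G" for k using l nth_mem by blast
  have "set (tl l) \<subseteq> carrier G" "set (butlast l) \<subseteq> carrier G"
    using l by (auto dest: in_set_butlastD list.set_sel(2)[rotated])
  moreover have "set (take (j - 1) l) \<subseteq> carrier G" "set (drop (j + 1) l) \<subseteq> carrier G"
    using l set_take_subset set_drop_subset by (metis subset_trans)+
  ultimately show ?thesis
    using l assms(2) nth[of "j - 1"] nth[of j] by (auto simp: cells_def bar_face_def)
qed

lemma cells_snoc: "l @ [g] \<in> cells (Suc i) \<longleftrightarrow> l \<in> cells i \<and> g \<in> carrier G"
  by (auto simp: cells_def)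

lemma cells_Suc:
  assumes "l \<in> cells (Suc i)"
  shows "l = butlast l @ [last l]" "butlast l \<in> cells i" "last l \<in> carrier G"
proof -
  have "l \<noteq> []" using assms by (auto simp: cells_def)
  then show l: "l = butlast l @ [last l]" by simp
  show "butlast l \<in> cells i" "last l \<in> carrier G" using assms l cells_snoc by metis+
qed

lemma cells_0: "cells 0 = {[]}" by (auto simp: cells_def)

definition delta :: "'g \<Rightarrow> 'g \<Rightarrow> 'k" where "delta g = single K g \<one>\<^bsub>K\<^esub>"

lemma delta_closed: "g \<in> carrier G \<Longrightarrow> delta g \<in> carrier B"
  by (simp add: delta_def single_B)

text \<open>As the modules are right modules, it is the last entry of a cell that acts as a scalar:
  the last face carries the coefficient \<open>delta (last l)\<close>, the others have coefficient
  one up to sign.\<close>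

definition bar_boundary :: "nat \<Rightarrow> 'g list \<Rightarrow> 'g list \<Rightarrow> 'g \<Rightarrow> 'k" where
  "bar_boundary i l =
    (\<Oplus>\<^bsub>BX i\<^esub>j\<in>{..i}. alt (BX i) j (basis_vec B (bar_face G j l)))
      \<oplus>\<^bsub>BX i\<^esub> alt (BX i) (Suc i) (single B (butlast l) (delta (last l)))"

lemma bar_boundary_terms:
  assumes "l \<in> cells (Suc i)"
  shows "j \<le> i \<Longrightarrow> basis_vec B (bar_face G j l) \<in> carrier (BX i)"
    "single B (butlast l) (delta (last l)) \<in> carrier (BX i)"
  using assms cells_Suc[OF assms]
  by (auto intro!: basis_vec_closed B.A.ring_axioms face_cells B.A.single_closed delta_closed)

text \<open>Stated for additive maps because it is applied to multiplication by a scalar, to that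
  followed by the contracting homotopy, and to the reduction along the augmentation.\<close>

lemma bar_boundary_image:
  assumes l: "l \<in> cells (Suc i)" and h: "h \<in> additive_maps (BX i) N" and N: "abelian_group N"
  shows "h (bar_boundary i l) = (\<Oplus>\<^bsub>N\<^esub>j\<in>{..i}. alt N j (h (basis_vec B (bar_face G j l))))
      \<oplus>\<^bsub>N\<^esub> alt N (Suc i) (h (single B (butlast l) (delta (last l))))"
proof -
  interpret X: abelian_group "BX i" by (rule BX_abelian)
  interpret N: abelian_group N by (rule N)
  note t = bar_boundary_terms[OF l]
  have c: "(\<lambda>j. alt (BX i) j (basis_vec B (bar_face G j l))) \<in> {..i} \<rightarrow> carrier (BX i)"
    using t(1) by (auto simp del: free_module_simps)
  have "h (bar_boundary i l) = h (\<Oplus>\<^bsub>BX i\<^esub>j\<in>{..i}. alt (BX i) j (basis_vec B (bar_face G j l)))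
      \<oplus>\<^bsub>N\<^esub> h (alt (BX i) (Suc i) (single B (butlast l) (delta (last l))))"
    unfolding bar_boundary_def by (rule additive_add[OF h X.finsum_closed[OF c] X.alt_simps(2)[OF t(2)]])
  also have "h (alt (BX i) (Suc i) (single B (butlast l) (delta (last l))))
      = alt N (Suc i) (h (single B (butlast l) (delta (last l))))"
    by (rule additive_alt[OF h BX_abelian N t(2)])
  also have "h (\<Oplus>\<^bsub>BX i\<^esub>j\<in>{..i}. alt (BX i) j (basis_vec B (bar_face G j l)))
      = (\<Oplus>\<^bsub>N\<^esub>j\<in>{..i}. h (alt (BX i) j (basis_vec B (bar_face G j l))))"
    by (rule additive_finsum[OF h BX_abelian N c])
  also have "\<dots> = (\<Oplus>\<^bsub>N\<^esub>j\<in>{..i}. alt N j (h (basis_vec B (bar_face G j l))))"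
    using t(1) additive_closed[OF h]
    by (intro N.finsum_cong') (auto simp: additive_alt[OF h BX_abelian N])
  finally show ?thesis .
qed

lemma bar_boundary_closed: "l \<in> cells (Suc i) \<Longrightarrow> bar_boundary i l \<in> carrier (BX i)"
proof -
  assume l: "l \<in> cells (Suc i)"
  interpret X: abelian_group "BX i" by (rule BX_abelian)
  show ?thesis unfolding bar_boundary_def
    using bar_boundary_terms[OF l] by (intro X.a_closed X.finsum_closed X.alt_simps) auto
qed

definition bar_d :: "nat \<Rightarrow> ('g list \<Rightarrow> 'g \<Rightarrow> 'k) \<Rightarrow> 'g list \<Rightarrow> 'g \<Rightarrow> 'k" where
  "bar_d i = lin_ext B (BX i) (bar_boundary i)"

lemma bar_d_linear: "bar_d i \<in> linear_maps B (BX (Suc i)) (BX i)"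
  unfolding bar_d_def using bar_boundary_closed by (intro lin_ext_linear B.A.right_module_free_module) auto

lemma bar_d_single:
  "\<lbrakk>l \<in> cells (Suc i); b \<in> carrier B\<rbrakk> \<Longrightarrow> bar_d i (single B l b) = b \<odot>\<^bsub>BX i\<^esub> bar_boundary i l"
  unfolding bar_d_def
  by (rule lin_ext_single[OF B.A.right_module_free_module]) (rule bar_boundary_closed)

text \<open>The contracting homotopy sends \<open>[g\<^sub>1|\<dots>|g\<^sub>i] g\<close> to \<open>[g\<^sub>1|\<dots>|g\<^sub>i|g]\<close> and is only \<open>K\<close>-linear.\<close>

definition bar_s :: "nat \<Rightarrow> ('g list \<Rightarrow> 'g \<Rightarrow> 'k) \<Rightarrow> 'g list \<Rightarrow> 'g \<Rightarrow> 'k" where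
  "bar_s i f = (\<lambda>l. if l \<in> cells (Suc i) then \<iota> (f (butlast l) (last l)) else \<zero>\<^bsub>B\<^esub>)"

lemma BX_value: "f \<in> carrier (BX i) \<Longrightarrow> f l g \<in> carrier K"
  using K.free_module_value[of "f l" "carrier G" g] B.A.free_module_value[of f "cells i" l]
  by (simp only: B_simps)

lemma bar_s_closed:
  assumes f: "f \<in> carrier (BX i)" shows "bar_s i f \<in> carrier (BX (Suc i))"
proof (rule free_module_carrierI)
  \<comment> \<open>A cell \<open>l @ [g]\<close> can support \<open>bar_s i f\<close> only if
    \<open>g\<close> occurs in the coefficient of \<open>f\<close> at \<open>l\<close>; the two
    layers of finite supports combine into a finite set.\<close>
  let ?S = "\<Union>l\<in>{l. f l \<noteq> \<zero>\<^bsub>B\<^esub>}. (\<lambda>g. l @ [g]) ` {g. f l g \<noteq> \<zero>\<^bsub>K\<^esub>}"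
  have fl: "f l \<in> carrier (free_module K (carrier G))" for l
    using B.A.free_module_value[OF f] by (simp only: B_simps)
  have "finite {g. f l g \<noteq> \<zero>\<^bsub>K\<^esub>}" for l using free_module_support(1)[OF fl] .
  then show "finite ?S" using free_module_support(1)[OF f] by auto
  have "g \<in> carrier G" if "f l g \<noteq> \<zero>\<^bsub>K\<^esub>" for l g using free_module_support(2)[OF fl, of l] that by auto
  then show "?S \<subseteq> cells (Suc i)" using free_module_support(2)[OF f] by (auto simp: cells_snoc)
  show "bar_s i f l \<in> carrier B" if "l \<in> cells (Suc i)" for l
    using that BX_value[OF f] by (simp add: bar_s_def)
  show "bar_s i f l = \<zero>\<^bsub>B\<^esub>" if l: "l \<notin> ?S" for l
  proof (cases "l \<in> cells (Suc i)")
    case True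
    note l' = cells_Suc[OF True]
    have "f (butlast l) (last l) = \<zero>\<^bsub>K\<^esub>"
    proof (rule ccontr)
      assume nz: "f (butlast l) (last l) \<noteq> \<zero>\<^bsub>K\<^esub>"
      then have "f (butlast l) \<noteq> \<zero>\<^bsub>B\<^esub>" by (auto simp: B_simps)
      then have "butlast l @ [last l] \<in> ?S" using nz by blast
      then show False using l l'(1) by simp
    qed
    then show ?thesis using B.section_zero by (simp add: bar_s_def)
  qed (simp add: bar_s_def)
qed

lemma bar_s_additive: "bar_s i \<in> additive_maps (BX i) (BX (Suc i))"
proof (rule additive_mapsI[OF bar_s_closed])
  fix f h assume f: "f \<in> carrier (BX i)" and h: "h \<in> carrier (BX i)"
  show "bar_s i (f \<oplus>\<^bsub>BX i\<^esub> h) = bar_s i f \<oplus>\<^bsub>BX (Suc i)\<^esub> bar_s i h"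
  proof
    fix l
    let ?a = "f (butlast l) (last l)" and ?b = "h (butlast l) (last l)"
    have "(f \<oplus>\<^bsub>BX i\<^esub> h) (butlast l) (last l) = ?a \<oplus>\<^bsub>K\<^esub> ?b" by (simp add: B_simps)
    moreover have "\<iota> (?a \<oplus>\<^bsub>K\<^esub> ?b) = \<iota> ?a \<oplus>\<^bsub>B\<^esub> \<iota> ?b"
      by (rule ring_hom_add[OF B.\<iota>_hom BX_value[OF f] BX_value[OF h]])
    ultimately show "bar_s i (f \<oplus>\<^bsub>BX i\<^esub> h) l = (bar_s i f \<oplus>\<^bsub>BX (Suc i)\<^esub> bar_s i h) l"
      by (cases "l \<in> cells (Suc i)") (simp_all add: bar_s_def)
  qed
qed

lemma bar_s_single:
  assumes l: "l \<in> cells i" and g: "g \<in> carrier G" and c: "c \<in> carrier K"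
  shows "bar_s i (single B l (single K g c)) = single B (l @ [g]) (\<iota> c)"
proof
  fix m
  show "bar_s i (single B l (single K g c)) m = single B (l @ [g]) (\<iota> c) m"
  proof (cases "m \<in> cells (Suc i)")
    case True
    note m = cells_Suc[OF True]
    have "m = l @ [g] \<longleftrightarrow> butlast m = l \<and> last m = g" using m(1) by (metis butlast_snoc last_snoc)
    then show ?thesis
      using True c B.section_zero by (auto simp: bar_s_def single_def B_simps)
  next
    case False
    then have "m \<noteq> l @ [g]" using l g by (auto simp: cells_snoc)
    then show ?thesis using False by (simp add: bar_s_def single_def)
  qed
qed

lemma single_unit: "\<lbrakk>l \<in> Y; c \<in> carrier K\<rbrakk> \<Longrightarrow> \<iota> c \<odot>\<^bsub>free_module B Y\<^esub> basis_vec B l = single B l (\<iota> c)"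
  by (rule single_smult[OF B.A.ring_axioms B.section_closed])

lemma smult_single:
  "\<lbrakk>b \<in> carrier B; b' \<in> carrier B\<rbrakk> \<Longrightarrow> b \<odot>\<^bsub>free_module B Y\<^esub> single B l b' = single B l (b' \<otimes>\<^bsub>B\<^esub> b)"
  by (auto simp: single_def)

text \<open>\<open>bar_s\<close> is not linear over the algebra, so identities that involve it are
  tested on cells with coefficients \<open>single K g c\<close>.\<close>

lemma bar_additive_eqI:
  assumes N: "abelian_group N" and f: "f \<in> additive_maps (BX i) N" and h: "h \<in> additive_maps (BX i) N"
    and eq: "\<And>l g c. \<lbrakk>l \<in> cells i; g \<in> carrier G; c \<in> carrier K\<rbrakk> \<Longrightarrow>
      f (single B l (single K g c)) = h (single B l (single K g c))"
    and u: "u \<in> carrier (BX i)"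
  shows "f u = h u"
proof (rule additive_eqI[OF B.A.ring_axioms N f h _ u])
  fix l b assume l: "l \<in> cells i" and b: "b \<in> carrier B"
  have s: "(\<lambda>b. single B l b) \<in> additive_maps (free_module K (carrier G)) (BX i)"
  proof (rule additive_mapsI)
    show "single B l b \<in> carrier (BX i)" if "b \<in> carrier (free_module K (carrier G))" for b
      using that l by (intro B.A.single_closed) (simp_all only: B_simps)
    show "single B l (b \<oplus>\<^bsub>free_module K (carrier G)\<^esub> b') = single B l b \<oplus>\<^bsub>BX i\<^esub> single B l b'" for b b'
      by (auto simp: single_def B_simps)
  qed
  show "f (single B l b) = h (single B l b)"
    by (rule additive_eqI[OF K.ring_axioms N additive_comp[OF s f] additive_comp[OF s h] eq[OF l]
          b[unfolded B_simps]])
qed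

lemma bar_face_snoc:
  assumes "l \<in> cells (Suc i)" "j \<le> i"
  shows "bar_face G j (l @ [g]) = bar_face G j l @ [g]"
  using assms by (auto simp: bar_face_def cells_def nth_append tl_append split: list.split)

lemma bar_face_snoc_last:
  assumes "l \<in> cells (Suc i)"
  shows "bar_face G (Suc i) (l @ [g]) = butlast l @ [last l \<otimes>\<^bsub>G\<^esub> g]"
proof -
  have "l \<noteq> []" "length l = Suc i" using assms by (auto simp: cells_def)
  then show ?thesis
    by (simp add: bar_face_def nth_append butlast_conv_take last_conv_nth)
qed

text \<open>The faces of \<open>l @ [g]\<close> up to \<open>i\<close> are those of \<open>l\<close>
  with \<open>g\<close> appended. Face \<open>Suc i\<close> multiplies the last two entries and
  matches the last face of \<open>l\<close>, whose scalar meets \<open>g\<close>. The last face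
  returns \<open>l\<close> with the scalar \<open>g\<close> and the sign
  \<open>(-1)\<^sup>i\<close>.\<close>

lemma bar_homotopy_single:
  assumes l: "l \<in> cells (Suc i)" and g: "g \<in> carrier G" and c: "c \<in> carrier K"
  shows "bar_d (Suc i) (bar_s (Suc i) (single B l (single K g c)))
    = bar_s i (bar_d i (single B l (single K g c))) \<oplus>\<^bsub>BX (Suc i)\<^esub> alt (BX (Suc i)) i (single B l (single K g c))"
proof -
  let ?X = "BX (Suc i)" and ?gc = "single K g c"
  interpret X: right_module B ?X by (rule B.A.right_module_free_module)
  interpret Y: right_module B "BX i" by (rule B.A.right_module_free_module)
  have gc: "?gc \<in> carrier B" using g c by (rule single_B)
  have \<iota>c: "\<iota> c \<in> carrier B" using c by simp
  note l' = cells_Suc[OF l]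
  have lg: "l @ [g] \<in> cells (Suc (Suc i))" using l g by (simp add: cells_snoc)
  have gcu: "delta h \<otimes>\<^bsub>B\<^esub> ?gc = single K (h \<otimes>\<^bsub>G\<^esub> g) c" "delta h \<otimes>\<^bsub>B\<^esub> \<iota> c = single K h c" if "h \<in> carrier G" for h
    using that g c unfolding delta_def T.unit_map_def by (simp_all add: mult_single)
  have L: "(\<lambda>v. bar_s i (?gc \<odot>\<^bsub>BX i\<^esub> v)) \<in> additive_maps (BX i) ?X"
  proof (rule additive_comp[OF _ bar_s_additive])
    show "(\<lambda>v. ?gc \<odot>\<^bsub>BX i\<^esub> v) \<in> additive_maps (BX i) (BX i)"
      using gc by (intro additive_mapsI Y.smult_closed Y.smult_r_distr)
  qed
  have R: "(\<lambda>v. \<iota> c \<odot>\<^bsub>?X\<^esub> v) \<in> additive_maps ?X ?X"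
    using \<iota>c by (intro additive_mapsI X.smult_closed X.smult_r_distr)
  have L_face: "bar_s i (?gc \<odot>\<^bsub>BX i\<^esub> basis_vec B (bar_face G j l)) = single B (bar_face G j l @ [g]) (\<iota> c)"
    if "j \<le> i" for j
    unfolding single_smult[OF B.A.ring_axioms gc]
    using that face_cells[OF l, of j] by (intro bar_s_single g c) simp
  have L_last: "bar_s i (?gc \<odot>\<^bsub>BX i\<^esub> single B (butlast l) (delta (last l)))
      = single B (butlast l @ [last l \<otimes>\<^bsub>G\<^esub> g]) (\<iota> c)"
    unfolding smult_single[OF gc delta_closed[OF l'(3)]] gcu[OF l'(3)]
    using l' g by (intro bar_s_single c) auto
  have R_face: "\<iota> c \<odot>\<^bsub>?X\<^esub> basis_vec B (bar_face G j (l @ [g])) = single B (bar_face G j (l @ [g])) (\<iota> c)" for j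
    by (rule single_smult[OF B.A.ring_axioms \<iota>c])
  have R_last: "\<iota> c \<odot>\<^bsub>?X\<^esub> single B (butlast (l @ [g])) (delta (last (l @ [g]))) = single B l ?gc"
    by (simp only: butlast_snoc last_snoc smult_single[OF \<iota>c delta_closed[OF g]] gcu(2)[OF g])
  let ?t = "\<lambda>j. alt ?X j (single B (bar_face G j l @ [g]) (\<iota> c))"
  let ?e = "single B (butlast l @ [last l \<otimes>\<^bsub>G\<^esub> g]) (\<iota> c)"
  have t: "?t \<in> {..i} \<rightarrow> carrier ?X"
  proof
    fix j assume "j \<in> {..i}"
    then have "bar_face G j l @ [g] \<in> cells (Suc i)" using face_cells[OF l, of j] g by (simp add: cells_snoc)
    then show "?t j \<in> carrier ?X" using \<iota>c by (intro X.alt_simps B.A.single_closed)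
  qed
  have e: "?e \<in> carrier ?X" using l' g \<iota>c by (intro B.A.single_closed) (auto simp: cells_snoc)
  have lgc: "single B l ?gc \<in> carrier ?X" using l gc by (rule B.A.single_closed)
  have left: "bar_s i (bar_d i (single B l ?gc)) = (\<Oplus>\<^bsub>?X\<^esub>j\<in>{..i}. ?t j) \<oplus>\<^bsub>?X\<^esub> alt ?X (Suc i) ?e"
  proof -
    have "bar_s i (bar_d i (single B l ?gc)) = (\<Oplus>\<^bsub>?X\<^esub>j\<in>{..i}. alt ?X j (bar_s i (?gc \<odot>\<^bsub>BX i\<^esub> basis_vec B (bar_face G j l))))
        \<oplus>\<^bsub>?X\<^esub> alt ?X (Suc i) (bar_s i (?gc \<odot>\<^bsub>BX i\<^esub> single B (butlast l) (delta (last l))))"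
      unfolding bar_d_single[OF l gc] by (rule bar_boundary_image[OF l L X.abelian_group])
    also have "(\<Oplus>\<^bsub>?X\<^esub>j\<in>{..i}. alt ?X j (bar_s i (?gc \<odot>\<^bsub>BX i\<^esub> basis_vec B (bar_face G j l)))) = (\<Oplus>\<^bsub>?X\<^esub>j\<in>{..i}. ?t j)"
      using t by (intro X.finsum_cong') (simp_all only: L_face atMost_iff)
    finally show ?thesis by (simp only: L_last)
  qed
  have "bar_d (Suc i) (bar_s (Suc i) (single B l ?gc)) = \<iota> c \<odot>\<^bsub>?X\<^esub> bar_boundary (Suc i) (l @ [g])"
    unfolding bar_s_single[OF l g c] by (rule bar_d_single[OF lg \<iota>c])
  also have "\<dots> = (\<Oplus>\<^bsub>?X\<^esub>j\<in>{..Suc i}. alt ?X j (single B (bar_face G j (l @ [g])) (\<iota> c)))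
      \<oplus>\<^bsub>?X\<^esub> alt ?X (Suc (Suc i)) (single B l ?gc)"
    unfolding bar_boundary_image[OF lg R X.abelian_group] R_face R_last ..
  also have "(\<Oplus>\<^bsub>?X\<^esub>j\<in>{..Suc i}. alt ?X j (single B (bar_face G j (l @ [g])) (\<iota> c)))
      = alt ?X (Suc i) ?e \<oplus>\<^bsub>?X\<^esub> (\<Oplus>\<^bsub>?X\<^esub>j\<in>{..i}. ?t j)"
  proof -
    have "(\<Oplus>\<^bsub>?X\<^esub>j\<in>{..Suc i}. alt ?X j (single B (bar_face G j (l @ [g])) (\<iota> c)))
        = alt ?X (Suc i) (single B (bar_face G (Suc i) (l @ [g])) (\<iota> c))
          \<oplus>\<^bsub>?X\<^esub> (\<Oplus>\<^bsub>?X\<^esub>j\<in>{..i}. alt ?X j (single B (bar_face G j (l @ [g])) (\<iota> c)))"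
    proof (rule X.finsum_Suc, rule Pi_I)
      fix j assume "j \<in> {..Suc i}"
      then show "alt ?X j (single B (bar_face G j (l @ [g])) (\<iota> c)) \<in> carrier ?X"
        using face_cells[OF lg, of j] \<iota>c by (intro X.alt_simps B.A.single_closed) auto
    qed
    also have "(\<Oplus>\<^bsub>?X\<^esub>j\<in>{..i}. alt ?X j (single B (bar_face G j (l @ [g])) (\<iota> c))) = (\<Oplus>\<^bsub>?X\<^esub>j\<in>{..i}. ?t j)"
      using t by (intro X.finsum_cong') (simp_all only: bar_face_snoc[OF l] atMost_iff)
    finally show ?thesis by (simp only: bar_face_snoc_last[OF l])
  qed
  also have "alt ?X (Suc (Suc i)) (single B l ?gc) = alt ?X i (single B l ?gc)"
    by (rule X.alt_simps(3)[OF lgc])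
  finally show ?thesis
    unfolding left using X.a_comm[OF X.alt_simps(2)[OF e] X.finsum_closed[OF t]] by (simp only:)
qed

lemma bar_homotopy:
  assumes u: "u \<in> carrier (BX (Suc i))"
  shows "bar_d (Suc i) (bar_s (Suc i) u) = bar_s i (bar_d i u) \<oplus>\<^bsub>BX (Suc i)\<^esub> alt (BX (Suc i)) i u"
proof (rule bar_additive_eqI[OF BX_abelian _ _ _ u, where f = "\<lambda>u. bar_d (Suc i) (bar_s (Suc i) u)"
      and h = "\<lambda>u. bar_s i (bar_d i u) \<oplus>\<^bsub>BX (Suc i)\<^esub> alt (BX (Suc i)) i u"])
  interpret X: abelian_group "BX (Suc i)" by (rule BX_abelian)
  show "(\<lambda>u. bar_d (Suc i) (bar_s (Suc i) u)) \<in> additive_maps (BX (Suc i)) (BX (Suc i))"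
    by (rule additive_comp[OF bar_s_additive linear_additive[OF bar_d_linear]])
  have sd: "(\<lambda>u. bar_s i (bar_d i u)) \<in> additive_maps (BX (Suc i)) (BX (Suc i))"
    by (rule additive_comp[OF linear_additive[OF bar_d_linear] bar_s_additive])
  show "(\<lambda>u. bar_s i (bar_d i u) \<oplus>\<^bsub>BX (Suc i)\<^esub> alt (BX (Suc i)) i u) \<in> additive_maps (BX (Suc i)) (BX (Suc i))"
  proof (rule additive_mapsI)
    fix u v assume u: "u \<in> carrier (BX (Suc i))" and v: "v \<in> carrier (BX (Suc i))"
    show "bar_s i (bar_d i u) \<oplus>\<^bsub>BX (Suc i)\<^esub> alt (BX (Suc i)) i u \<in> carrier (BX (Suc i))"
      by (rule X.a_closed[OF additive_closed[OF sd u] X.alt_simps(2)[OF u]])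
    have "alt (BX (Suc i)) i (u \<oplus>\<^bsub>BX (Suc i)\<^esub> v) = alt (BX (Suc i)) i u \<oplus>\<^bsub>BX (Suc i)\<^esub> alt (BX (Suc i)) i v"
      unfolding alt_def using X.minus_add[OF u v] by (cases "even i") (simp_all only: if_True if_False)
    then show "bar_s i (bar_d i (u \<oplus>\<^bsub>BX (Suc i)\<^esub> v)) \<oplus>\<^bsub>BX (Suc i)\<^esub> alt (BX (Suc i)) i (u \<oplus>\<^bsub>BX (Suc i)\<^esub> v)
        = (bar_s i (bar_d i u) \<oplus>\<^bsub>BX (Suc i)\<^esub> alt (BX (Suc i)) i u)
          \<oplus>\<^bsub>BX (Suc i)\<^esub> (bar_s i (bar_d i v) \<oplus>\<^bsub>BX (Suc i)\<^esub> alt (BX (Suc i)) i v)"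
      using additive_add[OF sd u v] additive_closed[OF sd u] additive_closed[OF sd v]
        X.alt_simps(2)[OF u, of i] X.alt_simps(2)[OF v, of i]
      by (simp only: X.a_ac X.a_closed)
  qed
qed (rule bar_homotopy_single)

section \<open>Augmentation and exactness of the bar resolution\<close>

definition bar_aug :: "('g list \<Rightarrow> 'g \<Rightarrow> 'k) \<Rightarrow> 'k" where "bar_aug u = \<alpha> (u [])"

lemma bar_aug_single: "bar_aug (single B [] b) = \<alpha> b"
  by (simp add: bar_aug_def single_def)

lemma bar_aug_linear: "bar_aug \<in> linear_maps B (BX 0) triv"
proof (rule linear_mapsI)
  fix u assume "u \<in> carrier (BX 0)"
  note u = B.A.free_module_value[OF this]
  show "bar_aug u \<in> carrier triv" using u by (simp add: bar_aug_def B.T_simps)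
  show "bar_aug (u \<oplus>\<^bsub>BX 0\<^esub> v) = bar_aug u \<oplus>\<^bsub>triv\<^esub> bar_aug v" if "v \<in> carrier (BX 0)" for v
    using u B.A.free_module_value[OF that] by (simp add: bar_aug_def B.T_simps B.hom_simps)
  show "bar_aug (b \<odot>\<^bsub>BX 0\<^esub> u) = b \<odot>\<^bsub>triv\<^esub> bar_aug u" if "b \<in> carrier B" for b
    using u that by (simp add: bar_aug_def B.T_simps B.hom_simps K.m_comm)
qed

text \<open>In degree 0 the augmentation followed by the unit takes the place of \<open>s d\<close>.
  The sign comes from the boundary \<open>[] - [] g\<close> of the cell \<open>[g]\<close>.\<close>

lemma bar_homotopy_0:
  assumes u: "u \<in> carrier (BX 0)"
  shows "bar_d 0 (bar_s 0 u) = single B [] (\<iota> (bar_aug u)) \<ominus>\<^bsub>BX 0\<^esub> u"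
proof (rule bar_additive_eqI[OF BX_abelian _ _ _ u])
  interpret X: right_module B "BX 0" by (rule B.A.right_module_free_module)
  have nil: "[] \<in> cells 0" by (simp add: cells_0)
  show "(\<lambda>u. bar_d 0 (bar_s 0 u)) \<in> additive_maps (BX 0) (BX 0)"
    by (rule additive_comp[OF bar_s_additive linear_additive[OF bar_d_linear]])
  have s: "single B [] (\<iota> c) \<in> carrier (BX 0)" if "c \<in> carrier K" for c
    using that nil by (intro B.A.single_closed) auto
  have aug: "bar_aug u \<in> carrier K" if "u \<in> carrier (BX 0)" for u
    using linear_closed[OF bar_aug_linear that] by (simp only: B.T_simps)
  show "(\<lambda>u. single B [] (\<iota> (bar_aug u)) \<ominus>\<^bsub>BX 0\<^esub> u) \<in> additive_maps (BX 0) (BX 0)"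
  proof (rule additive_mapsI)
    fix u v assume u: "u \<in> carrier (BX 0)" and v: "v \<in> carrier (BX 0)"
    show "single B [] (\<iota> (bar_aug u)) \<ominus>\<^bsub>BX 0\<^esub> u \<in> carrier (BX 0)"
      using u by (intro X.minus_closed s aug)
    have "single B [] (\<iota> (bar_aug (u \<oplus>\<^bsub>BX 0\<^esub> v)))
        = single B [] (\<iota> (bar_aug u)) \<oplus>\<^bsub>BX 0\<^esub> single B [] (\<iota> (bar_aug v))"
      unfolding linear_add[OF bar_aug_linear u v] B.T_simps
      using aug[OF u] aug[OF v] by (auto simp: ring_hom_add[OF B.\<iota>_hom] single_def)
    then show "single B [] (\<iota> (bar_aug (u \<oplus>\<^bsub>BX 0\<^esub> v))) \<ominus>\<^bsub>BX 0\<^esub> (u \<oplus>\<^bsub>BX 0\<^esub> v)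
        = (single B [] (\<iota> (bar_aug u)) \<ominus>\<^bsub>BX 0\<^esub> u) \<oplus>\<^bsub>BX 0\<^esub> (single B [] (\<iota> (bar_aug v)) \<ominus>\<^bsub>BX 0\<^esub> v)"
      using u v s[OF aug[OF u]] s[OF aug[OF v]]
      by (simp only: a_minus_def X.minus_add X.a_ac X.a_closed X.a_inv_closed)
  qed
  fix l g c assume l: "l \<in> cells 0" and g: "g \<in> carrier G" and c: "c \<in> carrier K"
  have \<iota>c: "\<iota> c \<in> carrier B" using c by simp
  have g1: "[g] \<in> cells (Suc 0)" using g by (simp add: cells_def)
  have lnil: "l = []" using l by (simp add: cells_0)
  have "bar_d 0 (bar_s 0 (single B [] (single K g c))) = \<iota> c \<odot>\<^bsub>BX 0\<^esub> bar_boundary 0 [g]"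
    using bar_s_single[OF nil g c] bar_d_single[OF g1 \<iota>c] by simp
  also have "\<dots> = \<iota> c \<odot>\<^bsub>BX 0\<^esub> basis_vec B [] \<ominus>\<^bsub>BX 0\<^esub> \<iota> c \<odot>\<^bsub>BX 0\<^esub> single B [] (delta g)"
  proof -
    have R: "(\<lambda>v. \<iota> c \<odot>\<^bsub>BX 0\<^esub> v) \<in> additive_maps (BX 0) (BX 0)"
      using \<iota>c by (intro additive_mapsI X.smult_closed X.smult_r_distr)
    have e: "\<iota> c \<odot>\<^bsub>BX 0\<^esub> basis_vec B [] \<in> carrier (BX 0)"
      by (rule X.smult_closed[OF \<iota>c basis_vec_closed[OF B.A.ring_axioms nil]])
    have f: "bar_face G 0 [g] = []" by (simp add: bar_face_def)
    have a: "alt (BX 0) 0 v = v" "alt (BX 0) (Suc 0) v = \<ominus>\<^bsub>BX 0\<^esub> v" for v by (simp_all add: alt_def)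
    have "(\<lambda>j. alt (BX 0) j (\<iota> c \<odot>\<^bsub>BX 0\<^esub> basis_vec B (bar_face G j [g]))) \<in> {0} \<rightarrow> carrier (BX 0)"
      using e by (simp add: f a del: free_module_simps)
    note sum = X.finsum_0[OF this]
    have bl: "butlast [g] = []" "last [g] = g" by simp_all
    show ?thesis
      unfolding bar_boundary_image[OF g1 R X.abelian_group] a_minus_def sum a f bl ..
  qed
  also have "\<iota> c \<odot>\<^bsub>BX 0\<^esub> basis_vec B [] = single B [] (\<iota> c)" by (rule single_unit[OF nil c])
  also have "\<iota> c \<odot>\<^bsub>BX 0\<^esub> single B [] (delta g) = single B [] (single K g c)"
    unfolding smult_single[OF \<iota>c delta_closed[OF g]]
    using g c unfolding delta_def T.unit_map_def by (simp add: mult_single)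
  also have "single B [] (\<iota> c) = single B [] (\<iota> (bar_aug (single B l (single K g c))))"
    using g c by (simp add: bar_aug_single lnil T.augmentation_single)
  finally show "bar_d 0 (bar_s 0 (single B l (single K g c)))
      = single B [] (\<iota> (bar_aug (single B l (single K g c)))) \<ominus>\<^bsub>BX 0\<^esub> single B l (single K g c)"
    by (simp only: lnil)
qed

text \<open>Basis vectors of positive degree lie in the image of \<open>bar_s\<close>, so a linear
  identity need only be checked there, where the homotopy formula applies. This takes the place of
  identities between iterated faces.\<close>

lemma basis_vec_bar_s:
  assumes "l \<in> cells (Suc i)"
  shows "basis_vec B l = bar_s i (single B (butlast l) (delta (last l)))"
proof -
  note l = cells_Suc[OF assms]
  have "bar_s i (single B (butlast l) (delta (last l))) = single B (butlast l @ [last l]) (\<iota> \<one>\<^bsub>K\<^esub>)"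
    unfolding delta_def using l by (intro bar_s_single) auto
  then show ?thesis using l(1) by (simp add: basis_vec_single ring_hom_one[OF B.\<iota>_hom])
qed

text \<open>The homotopy formula turns \<open>d s f\<close> into the difference of \<open>f\<close>
  and an element of degree 0 with the same augmentation.\<close>

lemma bar_aug_d:
  assumes u: "u \<in> carrier (BX (Suc 0))" shows "bar_aug (bar_d 0 u) = \<zero>\<^bsub>triv\<^esub>"
proof (rule linear_zero_on_basis[OF B.A.ring_axioms B.right_module_T linear_comp[OF bar_d_linear bar_aug_linear] _ u])
  fix l assume l: "l \<in> cells (Suc 0)"
  interpret triv: right_module B triv by (rule B.right_module_T)
  let ?f = "single B (butlast l) (delta (last l))"
  have f: "?f \<in> carrier (BX 0)" using cells_Suc[OF l] by (intro B.A.single_closed delta_closed)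
  have c: "bar_aug ?f \<in> carrier K" using linear_closed[OF bar_aug_linear f] by (simp only: B.T_simps)
  then have s: "single B [] (\<iota> (bar_aug ?f)) \<in> carrier (BX 0)"
    by (intro B.A.single_closed) (auto simp: cells_0)
  have "bar_aug (bar_d 0 (basis_vec B l)) = bar_aug (single B [] (\<iota> (bar_aug ?f))) \<ominus>\<^bsub>triv\<^esub> bar_aug ?f"
    unfolding basis_vec_bar_s[OF l] bar_homotopy_0[OF f]
    by (rule linear_minus[OF bar_aug_linear BX_abelian triv.abelian_group s f])
  also have "bar_aug (single B [] (\<iota> (bar_aug ?f))) = bar_aug ?f"
    using c by (simp only: bar_aug_single B.hom_section)
  also have "bar_aug ?f \<ominus>\<^bsub>triv\<^esub> bar_aug ?f = \<zero>\<^bsub>triv\<^esub>"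
    unfolding a_minus_def by (rule triv.r_neg[OF linear_closed[OF bar_aug_linear f]])
  finally show "bar_aug (bar_d 0 (basis_vec B l)) = \<zero>\<^bsub>triv\<^esub>" .
qed

text \<open>Applied twice, the homotopy formula gives
  \<open>d d s f = s d d f + (-1)\<^sup>i d f - (-1)\<^sup>i d f\<close>, and \<open>d d f\<close>
  vanishes one degree lower. At the bottom \<open>bar_aug_d\<close> replaces the induction
  hypothesis.\<close>

lemma bar_d_d:
  assumes u: "u \<in> carrier (BX (Suc (Suc i)))" shows "bar_d i (bar_d (Suc i) u) = \<zero>\<^bsub>BX i\<^esub>"
  using u
proof (induction i arbitrary: u)
  case 0
  show ?case
  proof (rule linear_zero_on_basis[OF B.A.ring_axioms B.A.right_module_free_module
        linear_comp[OF bar_d_linear bar_d_linear] _ 0])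
    fix l assume l: "l \<in> cells (Suc (Suc 0))"
    let ?f = "single B (butlast l) (delta (last l))" and ?X = "BX 0"
    interpret X: abelian_group ?X by (rule BX_abelian)
    interpret Y: abelian_group "BX (Suc 0)" by (rule BX_abelian)
    have f: "?f \<in> carrier (BX (Suc 0))" using cells_Suc[OF l] by (intro B.A.single_closed delta_closed)
    note df = linear_closed[OF bar_d_linear f]
    have "bar_d 0 (bar_d (Suc 0) (basis_vec B l)) = bar_d 0 (bar_s 0 (bar_d 0 ?f)) \<oplus>\<^bsub>?X\<^esub> bar_d 0 ?f"
      unfolding basis_vec_bar_s[OF l] bar_homotopy[OF f]
      using linear_add[OF bar_d_linear bar_s_closed[OF df] f] by (simp only: Y.alt_simps)
    also have "bar_d 0 (bar_s 0 (bar_d 0 ?f)) = \<ominus>\<^bsub>?X\<^esub> bar_d 0 ?f"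
    proof -
      have "\<iota> (bar_aug (bar_d 0 ?f)) = \<zero>\<^bsub>B\<^esub>" by (simp only: bar_aug_d[OF f] B.T_simps B.section_zero)
      then show ?thesis
        unfolding bar_homotopy_0[OF df] a_minus_def
        using df X.l_zero[OF X.a_inv_closed[OF df]] by simp
    qed
    also have "\<ominus>\<^bsub>?X\<^esub> bar_d 0 ?f \<oplus>\<^bsub>?X\<^esub> bar_d 0 ?f = \<zero>\<^bsub>?X\<^esub>" by (rule X.l_neg[OF df])
    finally show "bar_d 0 (bar_d (Suc 0) (basis_vec B l)) = \<zero>\<^bsub>?X\<^esub>" .
  qed
next
  case (Suc i)
  show ?case
  proof (rule linear_zero_on_basis[OF B.A.ring_axioms B.A.right_module_free_module
        linear_comp[OF bar_d_linear bar_d_linear] _ Suc.prems])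
    fix l assume l: "l \<in> cells (Suc (Suc (Suc i)))"
    let ?f = "single B (butlast l) (delta (last l))" and ?X = "BX (Suc i)"
    interpret X: abelian_group ?X by (rule BX_abelian)
    interpret Y: abelian_group "BX (Suc (Suc i))" by (rule BX_abelian)
    have f: "?f \<in> carrier (BX (Suc (Suc i)))" using cells_Suc[OF l] by (intro B.A.single_closed delta_closed)
    note df = linear_closed[OF bar_d_linear f]
    have "bar_d (Suc i) (bar_d (Suc (Suc i)) (basis_vec B l))
        = bar_d (Suc i) (bar_s (Suc i) (bar_d (Suc i) ?f)) \<oplus>\<^bsub>?X\<^esub> alt ?X (Suc i) (bar_d (Suc i) ?f)"
      unfolding basis_vec_bar_s[OF l] bar_homotopy[OF f]
      using linear_add[OF bar_d_linear bar_s_closed[OF df] Y.alt_simps(2)[OF f, of "Suc i"]]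
        additive_alt[OF linear_additive[OF bar_d_linear] BX_abelian BX_abelian f, of "Suc i"] by (simp only:)
    also have "bar_d (Suc i) (bar_s (Suc i) (bar_d (Suc i) ?f)) = alt ?X i (bar_d (Suc i) ?f)"
      unfolding bar_homotopy[OF df] Suc.IH[OF f]
        additive_zero[OF bar_s_additive BX_abelian BX_abelian]
      by (rule X.l_zero[OF X.alt_simps(2)[OF df]])
    also have "alt ?X i (bar_d (Suc i) ?f) \<oplus>\<^bsub>?X\<^esub> alt ?X (Suc i) (bar_d (Suc i) ?f) = \<zero>\<^bsub>?X\<^esub>"
      unfolding X.alt_simps(5)[OF df] by (rule X.r_neg[OF X.alt_simps(2)[OF df]])
    finally show "bar_d (Suc i) (bar_d (Suc (Suc i)) (basis_vec B l)) = \<zero>\<^bsub>?X\<^esub>" .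
  qed
qed

theorem free_resolution_bar: "free_resolution B triv cells bar_d bar_aug"
proof (intro free_resolution.intro B.right_module_T free_resolution_axioms.intro bar_d_linear bar_aug_linear)
  show "bar_aug ` carrier (BX 0) = carrier triv"
  proof (intro equalityI subsetI)
    fix c assume "c \<in> carrier triv"
    then have c: "c \<in> carrier K" by (simp only: B.T_simps)
    have "single B [] (\<iota> c) \<in> carrier (BX 0)" using c by (intro B.A.single_closed) (auto simp: cells_0)
    moreover have "bar_aug (single B [] (\<iota> c)) = c" using c by (simp add: bar_aug_single)
    ultimately show "c \<in> bar_aug ` carrier (BX 0)" by (metis imageI)
  qed (use linear_closed[OF bar_aug_linear] in auto)
  fix i
  interpret X: abelian_group "BX i" by (rule BX_abelian)
  interpret Y: abelian_group "BX (Suc i)" by (rule BX_abelian)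
  show "bar_d i ` carrier (BX (Suc i)) = syzygies B cells bar_d triv bar_aug i" (is "_ = ?S i")
  proof (intro equalityI subsetI)
    fix z assume "z \<in> bar_d i ` carrier (BX (Suc i))"
    then show "z \<in> ?S i"
      using bar_aug_d bar_d_d linear_closed[OF bar_d_linear]
      by (cases i) (auto simp del: free_module_simps)
  next
    fix z assume z: "z \<in> ?S i"
    show "z \<in> bar_d i ` carrier (BX (Suc i))"
    proof (cases i)
      case 0
      then have zc: "z \<in> carrier (BX 0)" and aug: "bar_aug z = \<zero>\<^bsub>triv\<^esub>" using z by auto
      interpret X0: abelian_group "BX 0" by (rule BX_abelian)
      interpret X1: abelian_group "BX (Suc 0)" by (rule BX_abelian)
      note sz = bar_s_closed[OF zc]
      have "\<iota> (bar_aug z) = \<zero>\<^bsub>B\<^esub>" by (simp only: aug B.T_simps B.section_zero)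
      then have "bar_d 0 (bar_s 0 z) = \<ominus>\<^bsub>BX 0\<^esub> z"
        unfolding bar_homotopy_0[OF zc] a_minus_def
        using X0.l_zero[OF X0.a_inv_closed[OF zc]] by simp
      then have "bar_d 0 (\<ominus>\<^bsub>BX (Suc 0)\<^esub> bar_s 0 z) = z"
        using additive_neg[OF linear_additive[OF bar_d_linear] BX_abelian BX_abelian sz] X0.minus_minus[OF zc]
        by (simp only:)
      then show ?thesis using X1.a_inv_closed[OF sz] 0 by (metis imageI)
    next
      case (Suc j)
      then have zc: "z \<in> carrier (BX (Suc j))" and dz: "bar_d j z = \<zero>\<^bsub>BX j\<^esub>" using z by auto
      interpret X0: abelian_group "BX (Suc j)" by (rule BX_abelian)
      interpret X1: abelian_group "BX (Suc (Suc j))" by (rule BX_abelian)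
      note sz = bar_s_closed[OF zc]
      have "bar_d (Suc j) (bar_s (Suc j) z) = alt (BX (Suc j)) j z"
        unfolding bar_homotopy[OF zc] dz additive_zero[OF bar_s_additive BX_abelian BX_abelian]
        by (rule X0.l_zero[OF X0.alt_simps(2)[OF zc]])
      \<comment> \<open>\<open>s z\<close> is a preimage of \<open>z\<close> up to the sign
        \<open>(-1)\<^sup>j\<close>, which is moved to the argument.\<close>
      then have "bar_d (Suc j) (alt (BX (Suc (Suc j))) j (bar_s (Suc j) z)) = z"
        using additive_alt[OF linear_additive[OF bar_d_linear] BX_abelian BX_abelian sz, of j]
          X0.alt_simps(4)[OF zc, of j] by (simp only:)
      then show ?thesis using X1.alt_simps(2)[OF sz, of j] Suc by (metis imageI)
    qed
  qed
qed

text \<open>The augmentation sends the scalar \<open>delta (last l)\<close> to one, so the last term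
  of the boundary becomes the face that drops the last entry.\<close>

lemma bar_diff_base_change:
  assumes z: "z \<in> carrier (free_module K (cells (Suc i)))"
  shows "base_change \<alpha> \<iota> (bar_d i) z = bar_diff K G i z"
proof -
  let ?X = "free_module K (cells i)"
  interpret X: right_module K ?X by (rule K.right_module_free_module)
  have mod: "bar_module K G i = ?X" by (simp add: bar_module_def cells_def)
  let ?v = "\<lambda>l. \<Oplus>\<^bsub>?X\<^esub>j\<in>{..Suc i}. alt ?X j (basis_vec K (bar_face G j l))"
  have diff: "bar_diff K G i = lin_ext K ?X ?v"
    by (simp only: bar_diff_def Let_def mod alt_def)
  have terms: "(\<lambda>j. alt ?X j (basis_vec K (bar_face G j l))) \<in> {..Suc i} \<rightarrow> carrier ?X"
    if "l \<in> cells (Suc i)" for l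
    using face_cells[OF that] by (auto intro!: X.alt_simps basis_vec_closed K.ring_axioms simp del: free_module_simps)
  have v: "?v l \<in> carrier ?X" if "l \<in> cells (Suc i)" for l
    by (rule X.finsum_closed[OF terms[OF that]])
  show ?thesis unfolding diff
  proof (rule linear_eqI[OF K.ring_axioms X.abelian_group B.base_change_linear[OF bar_d_linear] _ _ z])
    show "lin_ext K ?X ?v \<in> linear_maps K (free_module K (cells (Suc i))) ?X"
      using v by (intro lin_ext_linear X.right_module_axioms) auto
    fix l assume l: "l \<in> cells (Suc i)"
    have push_single: "(\<lambda>x. \<alpha> (single B m b x)) = single K m (\<alpha> b)" if "b \<in> carrier B" for m b
      by (rule B.push_single[OF that])
    have push: "(\<lambda>u x. \<alpha> (u x)) \<in> additive_maps (BX i) ?X"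
      using B.A.free_module_value by (intro additive_mapsI B.push_closed) (auto simp: B.hom_simps)
    have push_basis: "(\<lambda>x. \<alpha> (basis_vec B m x)) = basis_vec K m" for m
      by (simp add: basis_vec_single push_single B.hom_simps)
    have \<alpha>_delta: "\<alpha> (delta g) = \<one>\<^bsub>K\<^esub>" if "g \<in> carrier G" for g
      using that by (simp add: delta_def T.augmentation_single)
    have "base_change \<alpha> \<iota> (bar_d i) (basis_vec K l) = base_change \<alpha> \<iota> (bar_d i) (\<lambda>x. \<alpha> (basis_vec B l x))"
      by (simp only: push_basis)
    also have "\<dots> = (\<lambda>x. \<alpha> (bar_d i (basis_vec B l) x))"
      by (rule B.base_change_push[OF bar_d_linear basis_vec_closed[OF B.A.ring_axioms l]])
    also have "bar_d i (basis_vec B l) = bar_boundary i l"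
      unfolding bar_d_def by (rule lin_ext_basis_vec[OF B.A.right_module_free_module]) (rule bar_boundary_closed[OF l])
    also have "(\<lambda>x. \<alpha> (bar_boundary i l x)) = (\<Oplus>\<^bsub>?X\<^esub>j\<in>{..i}. alt ?X j (basis_vec K (bar_face G j l)))
        \<oplus>\<^bsub>?X\<^esub> alt ?X (Suc i) (basis_vec K (butlast l))"
      unfolding bar_boundary_image[OF l push X.abelian_group] push_basis
        push_single[OF delta_closed[OF cells_Suc(3)[OF l]]] \<alpha>_delta[OF cells_Suc(3)[OF l]]
        basis_vec_single[of K "butlast l"] ..
    also have "butlast l = bar_face G (Suc i) l" using l by (simp add: bar_face_def cells_def)
    also have "(\<Oplus>\<^bsub>?X\<^esub>j\<in>{..i}. alt ?X j (basis_vec K (bar_face G j l)))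
        \<oplus>\<^bsub>?X\<^esub> alt ?X (Suc i) (basis_vec K (bar_face G (Suc i) l)) = ?v l"
    proof -
      have "(\<lambda>j. alt ?X j (basis_vec K (bar_face G j l))) \<in> {..i} \<rightarrow> carrier ?X"
        "alt ?X (Suc i) (basis_vec K (bar_face G (Suc i) l)) \<in> carrier ?X"
        using terms[OF l] unfolding Pi_iff by (auto simp del: free_module_simps X.alt_simps)
      then show ?thesis
        unfolding X.finsum_Suc[OF terms[OF l]] by (intro X.a_comm X.finsum_closed)
    qed
    also have "\<dots> = lin_ext K ?X ?v (basis_vec K l)"
      by (rule lin_ext_basis_vec[where v = ?v and x = l, OF X.right_module_axioms v[OF l], symmetric])
    finally show "base_change \<alpha> \<iota> (bar_d i) (basis_vec K l) = lin_ext K ?X ?v (basis_vec K l)" .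
  qed
qed

text \<open>The bar complex is the reduction of the bar resolution, and the comparison theorem
  matches it with the reduction of the canonical one.\<close>

theorem Tor_group_homology:
  "graded_isomorphic K (Tor K B triv triv) (group_homology K G)"
proof -
  interpret R: free_resolution B triv "res_gens B triv" "\<lambda>_. res_diff B" "res_aug B triv"
    by (rule free_resolution_res[OF B.right_module_T])
  have mod: "right_module K (homology (\<lambda>i. free_module K (res_gens B triv i)) (\<lambda>i. base_change \<alpha> \<iota> (res_diff B)) i)" for i
    by (rule chain_complex.right_module_homology[OF R.chain_complex_base_change[OF B.ring_surjection_axioms]])
  have bar: "group_homology K G = homology (\<lambda>i. free_module K (cells i)) (\<lambda>i. base_change \<alpha> \<iota> (bar_d i))"
  proof -
    have "bar_module K G = (\<lambda>i. free_module K (cells i))" by (auto simp: bar_module_def cells_def)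
    then show ?thesis
      unfolding group_homology_def by (simp only:) (rule homology_cong[OF bar_diff_base_change, symmetric])
  qed
  show ?thesis unfolding bar
    by (rule graded_isomorphic_trans[OF graded_isomorphic_sym[OF B.Tor_reduced(1) mod]
          comparison[OF R.free_resolution_axioms free_resolution_bar B.ring_surjection_axioms]])
qed

end


section \<open>Concatenation of partial braids\<close>

lemma end_node_eq: "pathfinish p = of_nat j \<Longrightarrow> end_node p = j"
  unfolding end_node_def by (intro the_equality) auto

lemma partial_braidD:
  assumes "partial_braid n f"
  shows "dom f \<subseteq> {1..n}"
    "f i = Some p \<Longrightarrow> path p"
    "f i = Some p \<Longrightarrow> pathstart p = of_nat i"
    "f i = Some p \<Longrightarrow> pathfinish p = of_nat (end_node p)"
    "f i = Some p \<Longrightarrow> end_node p \<in> {1..n}"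
    "\<lbrakk>f i = Some p; f j = Some q; i \<noteq> j; t \<in> {0..1}\<rbrakk> \<Longrightarrow> p t \<noteq> q t"
proof -
  have "pathfinish p = of_nat (end_node p) \<and> end_node p \<in> {1..n}" if "f i = Some p"
  proof -
    have "pathfinish p \<in> of_nat ` {1..n}" using assms that unfolding partial_braid_def by blast
    then obtain j where "j \<in> {1..n}" "pathfinish p = of_nat j" by blast
    then show ?thesis using end_node_eq by simp
  qed
  then show "f i = Some p \<Longrightarrow> pathfinish p = of_nat (end_node p)" "f i = Some p \<Longrightarrow> end_node p \<in> {1..n}"
    by auto
  have D: "dom f \<subseteq> {1..n}"
      "\<forall>i p. f i = Some p \<longrightarrow> path p \<and> pathstart p = of_nat i \<and> pathfinish p \<in> of_nat ` {1..n}"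
      "\<forall>i j p q. f i = Some p \<longrightarrow> f j = Some q \<longrightarrow> i \<noteq> j \<longrightarrow> (\<forall>t\<in>{0..1}. p t \<noteq> q t)"
    using assms unfolding partial_braid_def by simp_all
  show "dom f \<subseteq> {1..n}" by (rule D(1))
  show "f i = Some p \<Longrightarrow> path p" "f i = Some p \<Longrightarrow> pathstart p = of_nat i" using D(2) by blast+
  show "\<lbrakk>f i = Some p; f j = Some q; i \<noteq> j; t \<in> {0..1}\<rbrakk> \<Longrightarrow> p t \<noteq> q t" using D(3) by blast
qed

text \<open>The partial injection of nodes underlying the strands. It is invariant under isotopy,
  and the node sets and counts of a diagram depend on it alone.\<close>

definition ends :: "strands \<Rightarrow> nat \<rightharpoonup> nat" where
  "ends f = (\<lambda>i. map_option end_node (f i))"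

lemma dom_ends [simp]: "dom (ends f) = dom f"
  by (auto simp: ends_def dom_def)

lemma ran_ends: "ran (ends f) = end_node ` ran f"
  by (auto simp: ends_def ran_def image_iff)

lemma ends_range: "partial_braid n f \<Longrightarrow> ran (ends f) \<subseteq> {1..n}"
  using partial_braidD(5) by (fastforce simp: ends_def ran_def)

text \<open>Two strands with a common right node would meet at time 1.\<close>

lemma ends_inj:
  assumes "partial_braid n f" "ends f i = Some k" "ends f j = Some k" shows "i = j"
proof (rule ccontr)
  assume ne: "i \<noteq> j"
  obtain p q where pq: "f i = Some p" "f j = Some q" "end_node p = k" "end_node q = k"
    using assms(2,3) by (auto simp: ends_def)
  have "pathfinish p = pathfinish q"
    using partial_braidD(4)[OF assms(1) pq(1)] partial_braidD(4)[OF assms(1) pq(2)] pq by simp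
  then show False
    using partial_braidD(6)[OF assms(1) pq(1,2) ne, of 1] by (simp add: pathfinish_def)
qed

section \<open>Isotopy as an equivalence relation\<close>

lemma isotopyD:
  assumes "(f, g) \<in> isotopy n"
  shows "partial_braid n f" "partial_braid n g" "ends g = ends f"
proof -
  obtain H where H: "\<forall>s\<in>{0..1}. partial_braid n (H s) \<and> dom (H s) = dom f"
    "\<forall>i\<in>dom f. \<forall>s\<in>{0..1}. pathfinish (the (H s i)) = pathfinish (the (f i))" "H 0 = f" "H (1::real) = g"
    using assms unfolding isotopy_def by blast
  have z: "(0::real) \<in> {0..1}" "(1::real) \<in> {0..1}" by auto
  show f: "partial_braid n f" using bspec[OF H(1) z(1)] H(3) by simp
  show g: "partial_braid n g" using bspec[OF H(1) z(2)] H(4) by simp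
  have dom: "dom g = dom f" using bspec[OF H(1) z(2)] H(4) by simp
  show "ends g = ends f"
  proof
    fix i
    show "ends g i = ends f i"
    proof (cases "i \<in> dom f")
      case True
      then obtain p q where pq: "f i = Some p" "g i = Some q" using dom by blast
      have "pathfinish (the (H 1 i)) = pathfinish (the (f i))" using H(2) True z(2) by blast
      then have "pathfinish q = pathfinish p" using H(4) pq by simp
      then show ?thesis using pq by (simp add: ends_def end_node_def)
    next
      case False
      then have "f i = None" "g i = None" using dom by (metis domIff)+
      then show ?thesis by (simp add: ends_def)
    qed
  qed
qed

text \<open>Constancy of \<open>ends\<close> covers two conditions of the definition, the fixed
  domain and the fixed right endpoints.\<close>

lemma isotopyI:
  assumes "\<And>s. s \<in> {0..1} \<Longrightarrow> partial_braid n (H s)"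
    and "\<And>s. s \<in> {0..1} \<Longrightarrow> ends (H s) = ends f"
    and "\<And>i. i \<in> dom f \<Longrightarrow> continuous_on ({0..1} \<times> {0..1}) (\<lambda>(s, t). the (H s i) t)"
    and "H 0 = f" "H (1::real) = g"
  shows "(f, g) \<in> isotopy n"
proof -
  have z: "(0::real) \<in> {0..1}" by auto
  have f: "partial_braid n f" using assms(1)[OF z] assms(4) by simp
  have dom: "dom (H s) = dom f" if "s \<in> {0..1}" for s
    using assms(2)[OF that] dom_ends by metis
  have "pathfinish (the (H s i)) = pathfinish (the (f i))" if s: "s \<in> {0..1}" and i: "i \<in> dom f" for s i
  proof -
    obtain p q where pq: "f i = Some p" "H s i = Some q" using i dom[OF s] by blast
    then have "end_node q = end_node p" using fun_cong[OF assms(2)[OF s], of i] by (simp add: ends_def)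
    then show ?thesis
      using partial_braidD(4)[OF f pq(1)] partial_braidD(4)[OF assms(1)[OF s] pq(2)] pq by simp
  qed
  then show ?thesis
    unfolding isotopy_def using assms dom by (intro CollectI case_prodI exI[of _ H]) blast
qed

lemma isotopyE:
  assumes "(f, g) \<in> isotopy n"
  obtains H where "\<And>s. s \<in> {0..1} \<Longrightarrow> partial_braid n (H s)" "\<And>s. s \<in> {0..1} \<Longrightarrow> ends (H s) = ends f"
    "\<And>i. i \<in> dom f \<Longrightarrow> continuous_on ({0..1} \<times> {0..1}) (\<lambda>(s, t). the (H s i) t)"
    "H 0 = f" "H (1::real) = g"
proof -
  obtain H where H: "\<forall>s\<in>{0..1}. partial_braid n (H s) \<and> dom (H s) = dom f"
    "\<forall>i\<in>dom f. continuous_on ({0..1} \<times> {0..1}) (\<lambda>(s, t). the (H s i) t) \<and>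
        (\<forall>s\<in>{0..1}. pathfinish (the (H s i)) = pathfinish (the (f i)))" "H 0 = f" "H (1::real) = g"
    using assms unfolding isotopy_def by blast
  have "ends (H s) = ends f" if s: "s \<in> {0..1}" for s
  proof
    fix i
    have dom: "dom (H s) = dom f" using H(1) s by blast
    show "ends (H s) i = ends f i"
    proof (cases "i \<in> dom f")
      case True
      then obtain p q where pq: "f i = Some p" "H s i = Some q" using dom by blast
      have "pathfinish (the (H s i)) = pathfinish (the (f i))" using H(2) True s by blast
      then have "pathfinish q = pathfinish p" using pq by simp
      then show ?thesis using pq by (simp add: ends_def end_node_def)
    next
      case False
      then have "f i = None" "H s i = None" using dom by (metis domIff)+
      then show ?thesis by (simp add: ends_def)
    qed
  qed
  then show ?thesis using H by (intro that[of H]) auto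
qed

lemma isotopy_refl:
  assumes "partial_braid n f" shows "(f, f) \<in> isotopy n"
proof (rule isotopyI[where H = "\<lambda>_. f"])
  fix i assume "i \<in> dom f"
  then obtain p where p: "f i = Some p" by blast
  have "continuous_on {0..1} p" using partial_braidD(2)[OF assms p] by (simp add: path_def)
  then have "continuous_on ({0..1::real} \<times> {0..1}) (\<lambda>x. p (snd x))"
    by (rule continuous_on_compose2) (auto intro: continuous_intros)
  then show "continuous_on ({0..1} \<times> {0..1}) (\<lambda>(s::real, t). the (f i) t)"
    by (simp add: p case_prod_beta)
qed (use assms in auto)

lemma isotopy_sym:
  assumes "(f, g) \<in> isotopy n" shows "(g, f) \<in> isotopy n"
proof -
  obtain H where H: "\<And>s. s \<in> {0..1} \<Longrightarrow> partial_braid n (H s)" "\<And>s. s \<in> {0..1} \<Longrightarrow> ends (H s) = ends f"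
    "\<And>i. i \<in> dom f \<Longrightarrow> continuous_on ({0..1} \<times> {0..1}) (\<lambda>(s, t). the (H s i) t)"
    "H 0 = f" "H (1::real) = g" by (rule isotopyE[OF assms]) blast
  note gf = isotopyD(3)[OF assms]
  then have dom: "dom g = dom f" using dom_ends by metis
  show ?thesis
  proof (rule isotopyI[where H = "\<lambda>s. H (1 - s)"])
    fix i assume "i \<in> dom g"
    then have "continuous_on ({0..1} \<times> {0..1}) (\<lambda>(s, t). the (H s i) t)" using H(3) dom by simp
    then have "continuous_on ({0..1} \<times> {0..1}) (\<lambda>x. (\<lambda>(s, t). the (H s i) t) (1 - fst x, snd x))"
      by (rule continuous_on_compose2) (auto intro!: continuous_intros)
    then show "continuous_on ({0..1} \<times> {0..1}) (\<lambda>(s, t). the (H (1 - s) i) t)"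
      by (simp add: case_prod_beta)
  qed (use H gf in auto)
qed

lemma isotopy_trans:
  assumes fg: "(f, g) \<in> isotopy n" and gh: "(g, h) \<in> isotopy n" shows "(f, h) \<in> isotopy n"
proof -
  obtain H where H: "\<And>s. s \<in> {0..1} \<Longrightarrow> partial_braid n (H s)" "\<And>s. s \<in> {0..1} \<Longrightarrow> ends (H s) = ends f"
    "\<And>i. i \<in> dom f \<Longrightarrow> continuous_on ({0..1} \<times> {0..1}) (\<lambda>(s, t). the (H s i) t)"
    "H 0 = f" "H (1::real) = g" by (rule isotopyE[OF fg]) blast
  obtain J where J: "\<And>s. s \<in> {0..1} \<Longrightarrow> partial_braid n (J s)" "\<And>s. s \<in> {0..1} \<Longrightarrow> ends (J s) = ends g"
    "\<And>i. i \<in> dom g \<Longrightarrow> continuous_on ({0..1} \<times> {0..1}) (\<lambda>(s, t). the (J s i) t)"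
    "J 0 = g" "J (1::real) = h" by (rule isotopyE[OF gh]) blast
  note gf = isotopyD(3)[OF fg]
  then have dom: "dom g = dom f" using dom_ends by metis
  \<comment> \<open>The isotopies are run one after the other; at \<open>1/2\<close> both pass
    through \<open>g\<close>.\<close>
  let ?L = "\<lambda>s. if s \<le> 1/2 then H (2 * s) else J (2 * s - 1)"
  show ?thesis
  proof (rule isotopyI[where H = ?L])
    fix i assume i: "i \<in> dom f"
    have "continuous_on ({0..1} \<times> {0..1})
      (\<lambda>x. if fst x \<le> 1/2 then the (H (2 * fst x) i) (snd x) else the (J (2 * fst x - 1) i) (snd x))"
    proof (rule continuous_on_cases_le)
      have "continuous_on {x \<in> {0..1} \<times> {0..1}. fst x \<le> 1/2}
          (\<lambda>x. (\<lambda>(s, t). the (H s i) t) (2 * fst x, snd x))"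
        by (rule continuous_on_compose2[OF H(3)[OF i]]) (auto intro!: continuous_intros)
      then show "continuous_on {x \<in> {0..1} \<times> {0..1}. fst x \<le> 1/2} (\<lambda>x. the (H (2 * fst x) i) (snd x))"
        by simp
      have "continuous_on {x \<in> {0..1} \<times> {0..1}. 1/2 \<le> fst x}
          (\<lambda>x. (\<lambda>(s, t). the (J s i) t) (2 * fst x - 1, snd x))"
        by (rule continuous_on_compose2[OF J(3)]) (use i dom in \<open>auto intro!: continuous_intros\<close>)
      then show "continuous_on {x \<in> {0..1} \<times> {0..1}. 1/2 \<le> fst x} (\<lambda>x. the (J (2 * fst x - 1) i) (snd x))"
        by simp
      fix x :: "real \<times> real" assume "fst x = 1/2"
      then have "2 * fst x = 1" by simp
      then show "the (H (2 * fst x) i) (snd x) = the (J (2 * fst x - 1) i) (snd x)" by (simp add: H J)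
    qed (auto intro!: continuous_intros)
    then show "continuous_on ({0..1} \<times> {0..1}) (\<lambda>(s, t). the (?L s i) t)"
      by (rule continuous_on_eq) auto
  qed (use H J gf in auto)
qed

lemma equiv_isotopy: "equiv {f. partial_braid n f} (isotopy n)"
proof (rule equivI)
  show "isotopy n \<subseteq> {f. partial_braid n f} \<times> {f. partial_braid n f}"
    by (auto dest: isotopyD(1,2))
  show "refl_on {f. partial_braid n f} (isotopy n)"
    using isotopy_refl by (auto simp: refl_on_def)
  show "sym (isotopy n)" using isotopy_sym by (auto simp: sym_def)
  show "trans (isotopy n)" using isotopy_trans by (auto simp: trans_def)
qed

section \<open>Reparametrisation and concatenation\<close>

definition reparam :: "strands \<Rightarrow> (real \<Rightarrow> real) \<Rightarrow> strands" where
  "reparam f \<psi> = (\<lambda>i. map_option (\<lambda>p. p \<circ> \<psi>) (f i))"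

lemma partial_braid_reparam:
  assumes f: "partial_braid n f" and \<psi>: "continuous_on {0..1} \<psi>" "\<psi> ` {0..1} \<subseteq> {0..1}" "\<psi> 0 = 0" "\<psi> 1 = 1"
  shows "partial_braid n (reparam f \<psi>)" "ends (reparam f \<psi>) = ends f"
proof -
  have fin: "pathfinish (p \<circ> \<psi>) = pathfinish p" for p :: "real \<Rightarrow> complex"
    using \<psi> by (simp add: pathfinish_def)
  have "path (p \<circ> \<psi>) \<and> pathstart (p \<circ> \<psi>) = of_nat i \<and> pathfinish (p \<circ> \<psi>) \<in> of_nat ` {1..n}"
    if p: "f i = Some p" for i p
  proof -
    have "continuous_on (\<psi> ` {0..1}) p"
      using partial_braidD(2)[OF f p] \<psi>(2) by (auto simp: path_def intro: continuous_on_subset)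
    then have "path (p \<circ> \<psi>)" unfolding path_def by (rule continuous_on_compose[OF \<psi>(1)])
    then show ?thesis
      using partial_braidD(3-5)[OF f p] \<psi>(3) fin by (simp add: pathstart_def)
  qed
  moreover have "(p \<circ> \<psi>) t \<noteq> (q \<circ> \<psi>) t"
    if "f i = Some p" "f j = Some q" "i \<noteq> j" "t \<in> {0..1}" for i j p q t
    using partial_braidD(6)[OF f that(1-3) subsetD[OF \<psi>(2) imageI[OF that(4)]]] by simp
  ultimately show "partial_braid n (reparam f \<psi>)"
    using partial_braidD(1)[OF f] unfolding partial_braid_def reparam_def by (auto simp: dom_def)
  show "ends (reparam f \<psi>) = ends f"
    by (auto simp: ends_def reparam_def option.map_comp end_node_def fin comp_def[of end_node]
        intro!: option.map_cong)
qed

text \<open>\<open>\<psi>\<close> is joined to the identity by a straight line, which stays in the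
  interval by convexity. At each moment all strands are reparametrised by the same function, so they
  stay disjoint. The unit and associativity laws of the monoid reduce to this.\<close>

lemma isotopy_reparam:
  assumes f: "partial_braid n f" and \<psi>: "continuous_on {0..1} \<psi>" "\<psi> ` {0..1} \<subseteq> {0..1}" "\<psi> 0 = 0" "\<psi> 1 = 1"
  shows "(reparam f \<psi>, f) \<in> isotopy n"
proof -
  let ?\<phi> = "\<lambda>s t. (1 - s) * \<psi> t + s * t"
  have range: "?\<phi> s t \<in> {0..1}" if "s \<in> {0..1}" "t \<in> {0..1}" for s t
  proof -
    have "\<psi> t \<in> {0..1}" by (rule subsetD[OF \<psi>(2) imageI[OF that(2)]])
    then show ?thesis
      using that convexD[of "{0..1::real}" "\<psi> t" t "1 - s" s] by auto
  qed
  have cont: "continuous_on {0..1} (?\<phi> s)" for s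
    using \<psi>(1) by (intro continuous_intros)
  have rep: "partial_braid n (reparam f (?\<phi> s))" "ends (reparam f (?\<phi> s)) = ends f" if "s \<in> {0..1}" for s
    using range[OF that] \<psi>(3,4) by (intro partial_braid_reparam[OF f cont]; force)+
  show ?thesis
  proof (rule isotopyI[where H = "\<lambda>s. reparam f (?\<phi> s)"])
    show "partial_braid n (reparam f (?\<phi> s))" if "s \<in> {0..1}" for s by (rule rep(1)[OF that])
    show "ends (reparam f (?\<phi> s)) = ends (reparam f \<psi>)" if "s \<in> {0..1}" for s
      using rep(2)[OF that] partial_braid_reparam(2)[OF f \<psi>] by simp
    fix i assume "i \<in> dom (reparam f \<psi>)"
    then obtain p where p: "f i = Some p" by (auto simp: reparam_def)
    have c: "continuous_on {0..1} p" using partial_braidD(2)[OF f p] by (simp add: path_def)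
    have "continuous_on ({0..1::real} \<times> {0..1}) (\<lambda>x. \<psi> (snd x))"
      by (rule continuous_on_compose2[OF \<psi>(1)]) (auto intro: continuous_intros)
    then have "continuous_on ({0..1} \<times> {0..1}) (\<lambda>x. ?\<phi> (fst x) (snd x))"
      by (intro continuous_intros)
    then have "continuous_on ({0..1} \<times> {0..1}) (\<lambda>x. p (?\<phi> (fst x) (snd x)))"
      by (rule continuous_on_compose2[OF c]) (use range in auto)
    then show "continuous_on ({0..1} \<times> {0..1}) (\<lambda>(s, t). the (reparam f (?\<phi> s) i) t)"
      by (simp add: reparam_def p case_prod_beta)
  qed (auto simp: reparam_def comp_def option.map_ident)
qed

lemma concat_strands_Some:
  "concat_strands f g i = Some r \<longleftrightarrow> (\<exists>p q. f i = Some p \<and> g (end_node p) = Some q \<and> r = p +++ q)"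
  by (auto simp: concat_strands_def split: option.splits)

lemma end_node_join [simp]: "end_node (p +++ q) = end_node q"
  by (simp add: end_node_def)

lemma ends_concat: "ends (concat_strands f g) = ends g \<circ>\<^sub>m ends f"
  by (auto simp: ends_def concat_strands_def map_comp_def split: option.splits)

lemma partial_braid_concat:
  assumes f: "partial_braid n f" and g: "partial_braid n g"
  shows "partial_braid n (concat_strands f g)"
  unfolding partial_braid_def
proof (intro conjI allI impI ballI)
  show "dom (concat_strands f g) \<subseteq> {1..n}"
    using partial_braidD(1)[OF f] by (auto simp: dom_def concat_strands_Some)
next
  fix i r assume "concat_strands f g i = Some r"
  then obtain p q where pq: "f i = Some p" "g (end_node p) = Some q" "r = p +++ q"
    by (auto simp: concat_strands_Some)
  have match: "pathfinish p = pathstart q"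
    using partial_braidD(4)[OF f pq(1)] partial_braidD(3)[OF g pq(2)] by simp
  show "path r" using partial_braidD(2)[OF f pq(1)] partial_braidD(2)[OF g pq(2)] match pq(3) by simp
  show "pathstart r = of_nat i" using partial_braidD(3)[OF f pq(1)] pq(3) by simp
  show "pathfinish r \<in> of_nat ` {1..n}"
    using partial_braidD(4,5)[OF g pq(2)] pq(3) by simp
next
  fix i j r r' and t :: real
  assume "concat_strands f g i = Some r" "concat_strands f g j = Some r'" and ij: "i \<noteq> j" and t: "t \<in> {0..1}"
  then obtain p q p' q' where pq: "f i = Some p" "g (end_node p) = Some q" "r = p +++ q"
    "f j = Some p'" "g (end_node p') = Some q'" "r' = p' +++ q'"
    by (auto simp: concat_strands_Some)
  \<comment> \<open>In the second half the positions are those of two strands of \<open>g\<close>,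
    which are distinct because their left nodes are.\<close>
  have "end_node p \<noteq> end_node p'"
    using ends_inj[OF f, of i "end_node p" j] pq ij by (auto simp: ends_def)
  then show "r t \<noteq> r' t"
    using partial_braidD(6)[OF f pq(1,4) ij, of "2 * t"] partial_braidD(6)[OF g pq(2,5), of "2 * t - 1"] pq t
    by (auto simp: joinpaths_def)
qed

lemma isotopy_concat:
  assumes f: "(f, f') \<in> isotopy n" and g: "(g, g') \<in> isotopy n"
  shows "(concat_strands f g, concat_strands f' g') \<in> isotopy n"
proof -
  obtain H where H: "\<And>s. s \<in> {0..1} \<Longrightarrow> partial_braid n (H s)" "\<And>s. s \<in> {0..1} \<Longrightarrow> ends (H s) = ends f"
    "\<And>i. i \<in> dom f \<Longrightarrow> continuous_on ({0..1} \<times> {0..1}) (\<lambda>(s, t). the (H s i) t)"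
    "H 0 = f" "H (1::real) = f'" by (rule isotopyE[OF f]) blast
  obtain J where J: "\<And>s. s \<in> {0..1} \<Longrightarrow> partial_braid n (J s)" "\<And>s. s \<in> {0..1} \<Longrightarrow> ends (J s) = ends g"
    "\<And>i. i \<in> dom g \<Longrightarrow> continuous_on ({0..1} \<times> {0..1}) (\<lambda>(s, t). the (J s i) t)"
    "J 0 = g" "J (1::real) = g'" by (rule isotopyE[OF g]) blast
  show ?thesis
  proof (rule isotopyI[where H = "\<lambda>s. concat_strands (H s) (J s)"])
    show "partial_braid n (concat_strands (H s) (J s))" if "s \<in> {0..1}" for s
      by (rule partial_braid_concat[OF H(1)[OF that] J(1)[OF that]])
    show "ends (concat_strands (H s) (J s)) = ends (concat_strands f g)" if "s \<in> {0..1}" for s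
      by (simp only: ends_concat H(2)[OF that] J(2)[OF that])
    fix i assume "i \<in> dom (concat_strands f g)"
    then obtain p q where pq: "f i = Some p" "g (end_node p) = Some q" by (auto simp: concat_strands_Some)
    \<comment> \<open>The middle node does not move during the isotopy, so strand \<open>i\<close>
      of \<open>H s\<close> always continues in strand \<open>?k\<close> of
      \<open>J s\<close>.\<close>
    let ?k = "end_node p"
    have Hs: "H s i = Some (the (H s i)) \<and> end_node (the (H s i)) = ?k" if "s \<in> {0..1}" for s
      using fun_cong[OF H(2)[OF that], of i] pq by (auto simp: ends_def)
    have Js: "J s ?k = Some (the (J s ?k))" if "s \<in> {0..1}" for s
      using fun_cong[OF J(2)[OF that], of ?k] pq by (auto simp: ends_def)
    have LS: "the (concat_strands (H s) (J s) i) = the (H s i) +++ the (J s ?k)" if "s \<in> {0..1}" for s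
    proof -
      have "concat_strands (H s) (J s) i = Some (the (H s i) +++ the (J s ?k))"
        unfolding concat_strands_Some using Hs[OF that] Js[OF that] by metis
      then show ?thesis by simp
    qed
    have "continuous_on ({0..1} \<times> {0..1})
      (\<lambda>x. if snd x \<le> 1/2 then the (H (fst x) i) (2 * snd x) else the (J (fst x) ?k) (2 * snd x - 1))"
    proof (rule continuous_on_cases_le)
      have "continuous_on {x \<in> {0..1} \<times> {0..1}. snd x \<le> 1/2}
          (\<lambda>x. (\<lambda>(s, t). the (H s i) t) (fst x, 2 * snd x))"
        by (rule continuous_on_compose2[OF H(3)]) (use pq in \<open>auto intro!: continuous_intros\<close>)
      then show "continuous_on {x \<in> {0..1} \<times> {0..1}. snd x \<le> 1/2} (\<lambda>x. the (H (fst x) i) (2 * snd x))"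
        by simp
      have "continuous_on {x \<in> {0..1} \<times> {0..1}. 1/2 \<le> snd x}
          (\<lambda>x. (\<lambda>(s, t). the (J s ?k) t) (fst x, 2 * snd x - 1))"
        by (rule continuous_on_compose2[OF J(3)]) (use pq in \<open>auto intro!: continuous_intros\<close>)
      then show "continuous_on {x \<in> {0..1} \<times> {0..1}. 1/2 \<le> snd x} (\<lambda>x. the (J (fst x) ?k) (2 * snd x - 1))"
        by simp
      fix x :: "real \<times> real" assume x: "x \<in> {0..1} \<times> {0..1}" "snd x = 1/2"
      then have s: "fst x \<in> {0..1}" and "2 * snd x = 1" by auto
      have "the (H (fst x) i) 1 = of_nat ?k"
        using partial_braidD(4)[OF H(1)[OF s], of i "the (H (fst x) i)"] Hs[OF s] by (simp add: pathfinish_def)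
      moreover have "the (J (fst x) ?k) 0 = of_nat ?k"
        using partial_braidD(3)[OF J(1)[OF s], of ?k "the (J (fst x) ?k)"] Js[OF s] by (simp add: pathstart_def)
      ultimately show "the (H (fst x) i) (2 * snd x) = the (J (fst x) ?k) (2 * snd x - 1)"
        using \<open>2 * snd x = 1\<close> by simp
    qed (auto intro!: continuous_intros)
    then show "continuous_on ({0..1} \<times> {0..1}) (\<lambda>(s, t). the (concat_strands (H s) (J s) i) t)"
      by (rule continuous_on_eq) (auto simp: LS joinpaths_def)
  qed (simp_all add: H J)
qed


section \<open>The monoid of braided rook diagrams\<close>

abbreviation cls :: "nat \<Rightarrow> strands \<Rightarrow> diagram" where
  "cls n f \<equiv> isotopy n `` {f}"

lemma diagrams_iff: "X \<in> diagrams n \<longleftrightarrow> (\<exists>f. partial_braid n f \<and> X = cls n f)"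
  by (auto simp: diagrams_def quotient_def)

lemma cls_eq: "(f, g) \<in> isotopy n \<Longrightarrow> cls n f = cls n g"
  by (rule equiv_class_eq[OF equiv_isotopy])

lemma mem_cls: "partial_braid n f \<Longrightarrow> f \<in> cls n f"
  using isotopy_refl by blast

lemma left_nodes_cls:
  assumes "partial_braid n f" shows "left_nodes (cls n f) = dom (ends f)"
proof -
  have "dom g = dom (ends f)" if "g \<in> cls n f" for g
    using isotopyD(3)[of f g n] that dom_ends[of g] by simp
  then show ?thesis unfolding left_nodes_def using mem_cls[OF assms] by blast
qed

lemma right_nodes_cls:
  assumes "partial_braid n f" shows "right_nodes (cls n f) = ran (ends f)"
proof -
  have "end_node ` ran g = ran (ends f)" if "g \<in> cls n f" for g
    using isotopyD(3)[of f g n] that ran_ends[of g] by simp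
  then show ?thesis unfolding right_nodes_def using mem_cls[OF assms] by blast
qed

text \<open>All concatenations of representatives are isotopic, so the union of their classes in
  \<open>concat_diagrams\<close> is a single class.\<close>

lemma concat_diagrams_cls:
  assumes f: "partial_braid n f" and g: "partial_braid n g"
  shows "concat_diagrams n (cls n f) (cls n g) = cls n (concat_strands f g)"
proof -
  have "cls n (concat_strands f' g') = cls n (concat_strands f g)" if "f' \<in> cls n f" "g' \<in> cls n g" for f' g'
    using isotopy_concat[of f f' n g g'] that by (intro cls_eq[symmetric]) auto
  then show ?thesis
    unfolding concat_diagrams_def using mem_cls[OF f] mem_cls[OF g] by blast
qed

text \<open>Constant strands on \<open>S\<close>: all nodes give the identity diagram, smaller sets
  give the diagrams with deleted strands.\<close>

definition id_strands :: "nat set \<Rightarrow> strands" where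
  "id_strands S = (\<lambda>i. if i \<in> S then Some (\<lambda>t. of_nat i) else None)"

lemma end_node_const [simp]: "end_node (\<lambda>t. of_nat i) = i"
  by (rule end_node_eq) (simp add: pathfinish_def)

lemma ends_id: "ends (id_strands S) = (\<lambda>i. if i \<in> S then Some i else None)"
  by (auto simp: ends_def id_strands_def)

lemma ends_id_Some: "ends (id_strands S) k = Some j \<longleftrightarrow> j = k \<and> k \<in> S"
  unfolding ends_id by (cases "k \<in> S") (simp_all add: eq_commute)

lemma ends_id_strands: "dom (ends (id_strands S)) = S" "ran (ends (id_strands S)) = S"
proof -
  show "dom (ends (id_strands S)) = S" unfolding dom_def by (simp only: not_None_eq ends_id_Some) blast
  show "ran (ends (id_strands S)) = S" unfolding ran_def by (simp only: ends_id_Some) blast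
qed

lemma partial_braid_id: "S \<subseteq> {1..n} \<Longrightarrow> partial_braid n (id_strands S)"
  unfolding partial_braid_def id_strands_def
  by (auto simp: path_def pathstart_def pathfinish_def split: if_splits)

lemma id_diagram_cls: "id_diagram n = cls n (id_strands {1..n})"
  by (simp add: id_diagram_def id_strands_def)

text \<open>Followed by a constant strand, a strand is run at double speed and then stopped. The
  statement allows any \<open>S\<close> containing the right ends of \<open>f\<close>, so that it
  also covers composition with a diagram whose deleted strand starts at a node that \<open>f\<close>
  misses.\<close>

lemma concat_id_right:
  assumes f: "partial_braid n f" and S: "ran (ends f) \<subseteq> S"
  shows "(concat_strands f (id_strands S), f) \<in> isotopy n"
proof -
  \<comment> \<open>Strands are functions on all reals, so both sides have to agree outside the unit
    interval as well; \<open>min\<close> ensures this.\<close>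
  let ?\<psi> = "\<lambda>t::real. min 1 (2 * t)"
  have "concat_strands f (id_strands S) = reparam f ?\<psi>"
  proof
    fix i
    show "concat_strands f (id_strands S) i = reparam f ?\<psi> i"
    proof (cases "f i")
      case (Some p)
      have "ends f i = Some (end_node p)" using Some by (simp add: ends_def)
      then have "end_node p \<in> S" using S by (auto intro: ranI)
      moreover have "p +++ (\<lambda>t. of_nat (end_node p)) = p \<circ> ?\<psi>"
      proof
        fix t
        have "p 1 = of_nat (end_node p)" using partial_braidD(4)[OF f Some] by (simp add: pathfinish_def)
        moreover have "?\<psi> t = (if t \<le> 1/2 then 2 * t else 1)" by auto
        ultimately show "(p +++ (\<lambda>t. of_nat (end_node p))) t = (p \<circ> ?\<psi>) t" by (simp add: joinpaths_def)
      qed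
      ultimately show ?thesis
        using Some by (simp add: concat_strands_def id_strands_def reparam_def)
    qed (simp add: concat_strands_def reparam_def)
  qed
  moreover have "continuous_on {0..1} ?\<psi>" by (intro continuous_intros)
  moreover have "?\<psi> ` {0..1} \<subseteq> {0..1}" by (auto simp: image_subset_iff)
  ultimately show ?thesis using isotopy_reparam[OF f, of ?\<psi>] by (simp only:)
qed

lemma concat_id_left:
  assumes f: "partial_braid n f"
  shows "(concat_strands (id_strands {1..n}) f, f) \<in> isotopy n"
proof -
  \<comment> \<open>Here the strand waits at its left node during the first half.\<close>
  let ?\<psi> = "\<lambda>t::real. max 0 (2 * t - 1)"
  have "concat_strands (id_strands {1..n}) f = reparam f ?\<psi>"
  proof
    fix i
    show "concat_strands (id_strands {1..n}) f i = reparam f ?\<psi> i"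
    proof (cases "f i")
      case (Some p)
      then have "i \<in> {1..n}" using partial_braidD(1)[OF f] by auto
      moreover have "(\<lambda>t. of_nat i) +++ p = p \<circ> ?\<psi>"
      proof
        fix t
        have "p 0 = of_nat i" using partial_braidD(3)[OF f Some] by (simp add: pathstart_def)
        moreover have "?\<psi> t = (if t \<le> 1/2 then 0 else 2 * t - 1)" by auto
        ultimately show "((\<lambda>t. of_nat i) +++ p) t = (p \<circ> ?\<psi>) t" by (simp add: joinpaths_def)
      qed
      ultimately show ?thesis
        using Some by (simp add: concat_strands_def id_strands_def reparam_def)
    qed (auto simp: concat_strands_def reparam_def id_strands_def)
  qed
  moreover have "continuous_on {0..1} ?\<psi>" by (intro continuous_intros)
  moreover have "?\<psi> ` {0..1} \<subseteq> {0..1}" by (auto simp: image_subset_iff)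
  ultimately show ?thesis using isotopy_reparam[OF f, of ?\<psi>] by (simp only:)
qed

lemma concat_assoc:
  assumes f: "partial_braid n f" and g: "partial_braid n g" and h: "partial_braid n h"
  shows "(concat_strands (concat_strands f g) h, concat_strands f (concat_strands g h)) \<in> isotopy n"
proof -
  \<comment> \<open>The left bracketing changes strands at the times 1/4 and 1/2, the right one at
    1/2 and 3/4. The piecewise linear map between these has slopes 2, 1 and 1/2; being concave, it
    is a minimum of three lines.\<close>
  let ?\<psi> = "\<lambda>t::real. min (2 * t) (min (t + 1/4) ((t + 1)/2))"
  have join: "(p +++ q) +++ r = (p +++ (q +++ r)) \<circ> ?\<psi>" for p q r :: "real \<Rightarrow> complex"
  proof
    fix t :: real
    consider "t \<le> 1/4" | "1/4 < t" "t \<le> 1/2" | "1/2 < t" by linarith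
    then show "((p +++ q) +++ r) t = ((p +++ (q +++ r)) \<circ> ?\<psi>) t"
    proof cases
      case 1
      then have "?\<psi> t = 2 * t" by auto
      then show ?thesis using 1 by (simp add: joinpaths_def)
    next
      case 2
      then have "?\<psi> t = t + 1/4" by auto
      then show ?thesis using 2 by (simp add: joinpaths_def algebra_simps)
    next
      case 3
      then have "?\<psi> t = (t + 1)/2" by auto
      then show ?thesis using 3 by (simp add: joinpaths_def field_simps)
    qed
  qed
  have "concat_strands (concat_strands f g) h = reparam (concat_strands f (concat_strands g h)) ?\<psi>"
    by (rule ext) (auto simp: concat_strands_def reparam_def join split: option.splits)
  moreover have "continuous_on {0..1} ?\<psi>" by (intro continuous_intros) auto
  moreover have "?\<psi> ` {0..1} \<subseteq> {0..1}" by (auto simp: image_subset_iff min_le_iff_disj)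
  ultimately show ?thesis
    using isotopy_reparam[OF partial_braid_concat[OF f partial_braid_concat[OF g h]], of ?\<psi>]
    by (simp only:) simp
qed

lemma rook_monoid_simps:
  "carrier (rook_monoid n) = diagrams n" "mult (rook_monoid n) = concat_diagrams n"
  "one (rook_monoid n) = id_diagram n"
  by (simp_all add: rook_monoid_def)

lemma monoid_rook: "monoid (rook_monoid n)"
proof (rule monoidI, unfold rook_monoid_simps)
  show "id_diagram n \<in> diagrams n"
    unfolding diagrams_iff id_diagram_cls using partial_braid_id[of "{1..n}" n] by blast
  fix X assume "X \<in> diagrams n"
  then obtain f where f: "partial_braid n f" "X = cls n f" unfolding diagrams_iff by blast
  have id: "partial_braid n (id_strands {1..n})" by (rule partial_braid_id) simp
  show "concat_diagrams n (id_diagram n) X = X"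
    unfolding f(2) id_diagram_cls concat_diagrams_cls[OF id f(1)] by (rule cls_eq[OF concat_id_left[OF f(1)]])
  show "concat_diagrams n X (id_diagram n) = X"
    unfolding f(2) id_diagram_cls concat_diagrams_cls[OF f(1) id]
    by (rule cls_eq[OF concat_id_right[OF f(1) ends_range[OF f(1)]]])
  fix Y Z assume "Y \<in> diagrams n" "Z \<in> diagrams n"
  then obtain g h where g: "partial_braid n g" "Y = cls n g" and h: "partial_braid n h" "Z = cls n h"
    unfolding diagrams_iff by blast
  show "concat_diagrams n X Y \<in> diagrams n"
    unfolding f(2) g(2) concat_diagrams_cls[OF f(1) g(1)] diagrams_iff
    using partial_braid_concat[OF f(1) g(1)] by blast
  show "concat_diagrams n (concat_diagrams n X Y) Z = concat_diagrams n X (concat_diagrams n Y Z)"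
    unfolding f(2) g(2) h(2) concat_diagrams_cls[OF f(1) g(1)] concat_diagrams_cls[OF g(1) h(1)]
      concat_diagrams_cls[OF partial_braid_concat[OF f(1) g(1)] h(1)]
      concat_diagrams_cls[OF f(1) partial_braid_concat[OF g(1) h(1)]]
    by (rule cls_eq[OF concat_assoc[OF f(1) g(1) h(1)]])
qed

section \<open>Isolated middle nodes as a cocycle\<close>

lemma isolated_middle_cls:
  assumes "partial_braid n f" "partial_braid n g"
  shows "isolated_middle n (cls n f) (cls n g) = card ({1..n} - (ran (ends f) \<union> dom (ends g)))"
  unfolding isolated_middle_def right_nodes_cls[OF assms(1)] left_nodes_cls[OF assms(2)] by (rule refl)

text \<open>Both sides count the components of a triple product that meet no outer column; those meeting both
  middle columns are the strands of \<open>b\<close> starting in \<open>V\<close>.\<close>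

lemma isolated_count:
  fixes a b c :: "nat \<rightharpoonup> nat"
  assumes "finite N" "dom b \<subseteq> N" "ran b \<subseteq> N"
    and inj: "\<And>i j k. b i = Some k \<Longrightarrow> b j = Some k \<Longrightarrow> i = j"
  shows "card (N - (ran a \<union> dom b)) + card (N - (ran (b \<circ>\<^sub>m a) \<union> dom c))
    = card (N - (ran b \<union> dom c)) + card (N - (ran a \<union> dom (c \<circ>\<^sub>m b)))"
proof -
  define V where "V = {j \<in> dom b. j \<notin> ran a \<and> the (b j) \<notin> dom c}"
  let ?b = "\<lambda>j. the (b j)"
  have fin: "finite V" using assms(1,2) by (auto simp: V_def intro: finite_subset[of _ N])
  have ran_comp: "k \<in> ran (b \<circ>\<^sub>m a) \<longleftrightarrow> (\<exists>j. j \<in> ran a \<and> b j = Some k)" for k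
    by (auto simp: ran_def map_comp_Some_iff)
  \<comment> \<open>A node of the second middle column that \<open>c\<close> does not continue is
    isolated if \<open>b\<close> does not reach it, or if the strand of \<open>b\<close> reaching it
    starts in \<open>V\<close>. The first middle column is treated likewise, with \<open>V\<close>
    itself in place of its image.\<close>
  have "N - (ran (b \<circ>\<^sub>m a) \<union> dom c) = (N - (ran b \<union> dom c)) \<union> ?b ` V"
  proof (intro equalityI subsetI)
    fix k assume k: "k \<in> N - (ran (b \<circ>\<^sub>m a) \<union> dom c)"
    show "k \<in> (N - (ran b \<union> dom c)) \<union> ?b ` V"
    proof (cases "k \<in> ran b")
      case True
      then obtain j where j: "b j = Some k" by (auto simp: ran_def)
      then have "j \<notin> ran a" using k ran_comp by blast
      then have "j \<in> V" using j k unfolding V_def by (simp add: domI)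
      then show ?thesis using j by force
    qed (use k in auto)
  next
    fix k assume "k \<in> (N - (ran b \<union> dom c)) \<union> ?b ` V"
    then show "k \<in> N - (ran (b \<circ>\<^sub>m a) \<union> dom c)"
    proof
      assume "k \<in> N - (ran b \<union> dom c)"
      then show ?thesis using ran_comp by (auto simp: ran_def)
    next
      assume "k \<in> ?b ` V"
      then obtain j where "j \<in> V" "k = ?b j" by blast
      then have j: "j \<in> V" "b j = Some k" by (auto simp: V_def)
      then have "k \<in> N" using assms(3) by (auto simp: ran_def)
      moreover have "k \<notin> ran (b \<circ>\<^sub>m a)" using j inj ran_comp by (auto simp: V_def)
      ultimately show ?thesis using j by (auto simp: V_def)
    qed
  qed
  moreover have "(N - (ran b \<union> dom c)) \<inter> ?b ` V = {}" by (auto simp: V_def ran_def)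
  moreover have "card (?b ` V) = card V"
    using inj by (intro card_image inj_onI) (auto simp: V_def)
  ultimately have left: "card (N - (ran (b \<circ>\<^sub>m a) \<union> dom c)) = card (N - (ran b \<union> dom c)) + card V"
    using assms(1) fin by (simp add: card_Un_disjoint)
  have "j \<in> dom (c \<circ>\<^sub>m b) \<longleftrightarrow> j \<in> dom b \<and> the (b j) \<in> dom c" for j
    by (auto simp: dom_def map_comp_Some_iff)
  then have "N - (ran a \<union> dom (c \<circ>\<^sub>m b)) = (N - (ran a \<union> dom b)) \<union> V"
    using assms(2) unfolding V_def by blast
  moreover have "(N - (ran a \<union> dom b)) \<inter> V = {}" by (auto simp: V_def)
  ultimately have right: "card (N - (ran a \<union> dom (c \<circ>\<^sub>m b))) = card (N - (ran a \<union> dom b)) + card V"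
    using assms(1) fin by (simp add: card_Un_disjoint)
  show ?thesis using left right by simp
qed

text \<open>This is the cocycle identity for the powers of \<open>\<epsilon>\<close>, read in the
  exponents.\<close>

lemma isolated_middle_cocycle:
  assumes "X \<in> diagrams n" "Y \<in> diagrams n" "Z \<in> diagrams n"
  shows "isolated_middle n X Y + isolated_middle n (concat_diagrams n X Y) Z
    = isolated_middle n Y Z + isolated_middle n X (concat_diagrams n Y Z)"
proof -
  obtain f g h where f: "partial_braid n f" "X = cls n f" and g: "partial_braid n g" "Y = cls n g"
    and h: "partial_braid n h" "Z = cls n h" using assms unfolding diagrams_iff by blast
  note fg = partial_braid_concat[OF f(1) g(1)] and gh = partial_braid_concat[OF g(1) h(1)]
  have "dom (ends g) \<subseteq> {1..n}" using partial_braidD(1)[OF g(1)] by (simp only: dom_ends)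
  from isolated_count[OF finite_atLeastAtMost this ends_range[OF g(1)] ends_inj[OF g(1)]] show ?thesis
    unfolding f(2) g(2) h(2) concat_diagrams_cls[OF f(1) g(1)] concat_diagrams_cls[OF g(1) h(1)]
      isolated_middle_cls[OF f(1) g(1)] isolated_middle_cls[OF g(1) h(1)] isolated_middle_cls[OF fg h(1)]
      isolated_middle_cls[OF f(1) gh] ends_concat by this
qed

lemma isolated_middle_full: "left_nodes Y = {1..n} \<Longrightarrow> isolated_middle n X Y = 0"
proof -
  assume "left_nodes Y = {1..n}"
  then have "{1..n} - (right_nodes X \<union> left_nodes Y) = {}" by blast
  then show ?thesis by (simp only: isolated_middle_def card.empty)
qed

lemma isolated_middle_id:
  "X \<in> diagrams n \<Longrightarrow> isolated_middle n (id_diagram n) X = 0"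
  "X \<in> diagrams n \<Longrightarrow> isolated_middle n X (id_diagram n) = 0"
proof -
  have id: "partial_braid n (id_strands {1..n})" by (rule partial_braid_id) simp
  have "right_nodes (id_diagram n) = {1..n}"
    unfolding id_diagram_cls right_nodes_cls[OF id] by (rule ends_id_strands)
  then have "{1..n} - (right_nodes (id_diagram n) \<union> left_nodes X) = {}" by blast
  then show "isolated_middle n (id_diagram n) X = 0" by (simp only: isolated_middle_def card.empty)
  have "left_nodes (id_diagram n) = {1..n}"
    unfolding id_diagram_cls left_nodes_cls[OF id] by (rule ends_id_strands)
  then show "isolated_middle n X (id_diagram n) = 0" by (rule isolated_middle_full)
qed

section \<open>Diagrams without missing edges\<close>

definition full_diagrams :: "nat \<Rightarrow> diagram set" where
  "full_diagrams n = {X \<in> diagrams n. left_nodes X = {1..n}}"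

text \<open>\<open>ends\<close> is injective, so a diagram has as many left as right ends. Fullness
  is defined on the left, whereas annihilation by right multiplication sees the right nodes.\<close>

lemma full_iff_right:
  assumes "X \<in> diagrams n" shows "X \<in> full_diagrams n \<longleftrightarrow> right_nodes X = {1..n}"
proof -
  obtain f where f: "partial_braid n f" "X = cls n f" using assms unfolding diagrams_iff by blast
  have dom: "dom (ends f) \<subseteq> {1..n}" using partial_braidD(1)[OF f(1)] by simp
  have "inj_on (\<lambda>i. the (ends f i)) (dom (ends f))"
    using ends_inj[OF f(1)] by (intro inj_onI) (auto simp del: dom_ends)
  moreover have "ran (ends f) = (\<lambda>i. the (ends f i)) ` dom (ends f)"
    by (force simp: ran_def dom_def)
  ultimately have "card (ran (ends f)) = card (dom (ends f))" by (simp add: card_image)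
  then have "dom (ends f) = {1..n} \<longleftrightarrow> ran (ends f) = {1..n}"
    using dom ends_range[OF f(1)] card_subset_eq[of "{1..n}"] by (metis finite_atLeastAtMost)
  then show ?thesis
    using assms by (simp add: full_diagrams_def f(2) left_nodes_cls[OF f(1)] right_nodes_cls[OF f(1)] del: dom_ends)
qed

text \<open>A missing strand in either factor costs the product a strand, since a full
  \<open>X\<close> reaches every middle node. So the full diagrams form a submonoid and the others
  an ideal.\<close>

lemma full_concat:
  assumes "X \<in> diagrams n" "Y \<in> diagrams n"
  shows "concat_diagrams n X Y \<in> full_diagrams n \<longleftrightarrow> X \<in> full_diagrams n \<and> Y \<in> full_diagrams n"
proof -
  obtain f g where f: "partial_braid n f" "X = cls n f" and g: "partial_braid n g" "Y = cls n g"
    using assms unfolding diagrams_iff by blast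
  have XY: "concat_diagrams n X Y \<in> diagrams n"
    using monoid.m_closed[OF monoid_rook] assms by (simp add: rook_monoid_simps)
  have lX: "left_nodes X = dom (ends f)" and rX: "right_nodes X = ran (ends f)" and lY: "left_nodes Y = dom (ends g)"
    using f g by (simp_all only: left_nodes_cls right_nodes_cls)
  have lXY: "left_nodes (concat_diagrams n X Y) = {i \<in> dom (ends f). the (ends f i) \<in> dom (ends g)}"
    unfolding f(2) g(2) concat_diagrams_cls[OF f(1) g(1)] left_nodes_cls[OF partial_braid_concat[OF f(1) g(1)]]
      ends_concat by (auto simp: dom_def map_comp_Some_iff)
  have sub: "dom (ends f) \<subseteq> {1..n}" "dom (ends g) \<subseteq> {1..n}" "ran (ends f) \<subseteq> {1..n}"
    using partial_braidD(1)[OF f(1)] partial_braidD(1)[OF g(1)] ends_range[OF f(1)] by simp_all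
  show ?thesis
  proof
    assume full: "concat_diagrams n X Y \<in> full_diagrams n"
    then have eq: "{i \<in> dom (ends f). the (ends f i) \<in> dom (ends g)} = {1..n}"
      using lXY by (simp add: full_diagrams_def)
    then have "dom (ends f) = {1..n}" using sub by blast
    then have Xf: "X \<in> full_diagrams n" using assms lX by (simp add: full_diagrams_def)
    then have "ran (ends f) = {1..n}" using full_iff_right[OF assms(1)] rX by simp
    moreover have "ran (ends f) \<subseteq> dom (ends g)"
    proof
      fix k assume "k \<in> ran (ends f)"
      then obtain i where i: "ends f i = Some k" by (auto simp: ran_def)
      then have "i \<in> {1..n}" using sub(1) by blast
      then have "the (ends f i) \<in> dom (ends g)" using eq by blast
      then show "k \<in> dom (ends g)" using i by simp
    qed
    ultimately have "dom (ends g) = {1..n}" using sub by blast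
    then show "X \<in> full_diagrams n \<and> Y \<in> full_diagrams n"
      using Xf assms lY by (simp add: full_diagrams_def)
  next
    assume full: "X \<in> full_diagrams n \<and> Y \<in> full_diagrams n"
    then have "dom (ends f) = {1..n}" "dom (ends g) = {1..n}" using lX lY by (simp_all add: full_diagrams_def)
    moreover have "the (ends f i) \<in> {1..n}" if "i \<in> dom (ends f)" for i
      using that sub(3) by (auto simp: ran_def simp del: dom_ends)
    ultimately have "left_nodes (concat_diagrams n X Y) = {1..n}" unfolding lXY by blast
    then show "concat_diagrams n X Y \<in> full_diagrams n" using XY by (simp add: full_diagrams_def)
  qed
qed

lemma id_full: "id_diagram n \<in> full_diagrams n"
proof -
  have id: "partial_braid n (id_strands {1..n})" by (rule partial_braid_id) simp
  have "right_nodes (id_diagram n) = {1..n}"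
    unfolding id_diagram_cls right_nodes_cls[OF id] by (rule ends_id_strands)
  moreover have "id_diagram n \<in> diagrams n" using id unfolding id_diagram_cls diagrams_iff by blast
  ultimately show ?thesis by (simp add: full_iff_right)
qed

section \<open>Deleting a strand\<close>

definition delete_strand :: "nat \<Rightarrow> nat \<Rightarrow> diagram" where
  "delete_strand n j = cls n (id_strands ({1..n} - {j}))"

lemma delete_strand:
  assumes "j \<in> {1..n}"
  shows "delete_strand n j \<in> diagrams n" "delete_strand n j \<notin> full_diagrams n"
proof -
  have id: "partial_braid n (id_strands ({1..n} - {j}))" by (rule partial_braid_id) auto
  then show d: "delete_strand n j \<in> diagrams n" unfolding delete_strand_def diagrams_iff by blast
  have "right_nodes (delete_strand n j) = {1..n} - {j}"
    unfolding delete_strand_def right_nodes_cls[OF id] by (rule ends_id_strands)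
  then have "right_nodes (delete_strand n j) \<noteq> {1..n}" using assms by blast
  then show "delete_strand n j \<notin> full_diagrams n" by (simp only: full_iff_right[OF d] not_False_eq_True)
qed

text \<open>If \<open>X\<close> misses the right node \<open>j\<close>, the middle node
  \<open>j\<close> is the only one met by neither factor, which accounts for exactly one
  \<open>\<epsilon>\<close>. The inclusion says that right nodes missing from \<open>X\<close> stay
  missing.\<close>

lemma concat_delete_strand:
  assumes X: "X \<in> diagrams n" and j: "j \<in> {1..n}"
  shows "right_nodes (concat_diagrams n X (delete_strand n j)) \<subseteq> right_nodes X"
    and "j \<notin> right_nodes X \<Longrightarrow> concat_diagrams n X (delete_strand n j) = X"
    and "j \<notin> right_nodes X \<Longrightarrow> isolated_middle n X (delete_strand n j) = 1"
proof -
  obtain f where f: "partial_braid n f" "X = cls n f" using X unfolding diagrams_iff by blast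
  let ?g = "id_strands ({1..n} - {j})"
  have g: "partial_braid n ?g" by (rule partial_braid_id) auto
  have eq: "concat_diagrams n X (delete_strand n j) = cls n (concat_strands f ?g)"
    unfolding f(2) delete_strand_def by (rule concat_diagrams_cls[OF f(1) g])
  have rX: "right_nodes X = ran (ends f)" unfolding f(2) by (rule right_nodes_cls[OF f(1)])
  show "right_nodes (concat_diagrams n X (delete_strand n j)) \<subseteq> right_nodes X"
    unfolding eq right_nodes_cls[OF partial_braid_concat[OF f(1) g]] rX ends_concat
    unfolding ran_def map_comp_Some_iff ends_id_Some by blast
  assume "j \<notin> right_nodes X"
  then have nj: "j \<notin> ran (ends f)" by (simp only: rX not_False_eq_True)
  have sub: "ran (ends f) \<subseteq> {1..n} - {j}" using nj ends_range[OF f(1)] by blast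
  show "concat_diagrams n X (delete_strand n j) = X"
    unfolding eq using cls_eq[OF concat_id_right[OF f(1) sub]] f(2) by (simp only:)
  have "{1..n} - (ran (ends f) \<union> dom (ends ?g)) = {j}"
    unfolding ends_id_strands using nj j by blast
  then show "isolated_middle n X (delete_strand n j) = 1"
    unfolding f(2) delete_strand_def isolated_middle_cls[OF f(1) g] by simp
qed


section \<open>Inverting \<open>\<epsilon>\<close>\<close>

locale rook_algebra = K: cring K for K :: "('k, 'r) ring_scheme" +
  fixes n :: nat and \<epsilon> :: 'k
  assumes unit: "\<epsilon> \<in> Units K"
begin

abbreviation (input) wt where "wt \<equiv> \<lambda>X Y. \<epsilon> [^]\<^bsub>K\<^esub> isolated_middle n X Y"

lemma eps [simp]: "\<epsilon> \<in> carrier K"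
  using unit by (simp add: K.Units_closed)

text \<open>A product of full diagrams has no isolated middle node, so the powers of
  \<open>\<epsilon>\<close> are trivial on the face.\<close>

sublocale twisted_monoid_face K "rook_monoid n" wt "full_diagrams n"
proof (intro twisted_monoid_face.intro twisted_monoid.intro twisted_monoid_axioms.intro
    twisted_monoid_face_axioms.intro K.is_cring monoid_rook, unfold rook_monoid_simps)
  fix X Y Z
  assume XYZ: "X \<in> diagrams n" "Y \<in> diagrams n" "Z \<in> diagrams n"
  show "wt X Y \<otimes>\<^bsub>K\<^esub> wt (concat_diagrams n X Y) Z = wt Y Z \<otimes>\<^bsub>K\<^esub> wt X (concat_diagrams n Y Z)"
    by (simp only: K.nat_pow_mult eps isolated_middle_cocycle[OF XYZ])
next
  show "X \<in> full_diagrams n \<Longrightarrow> Y \<in> full_diagrams n \<Longrightarrow> wt X Y = \<one>\<^bsub>K\<^esub>" for X Y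
    by (simp add: full_diagrams_def isolated_middle_full)
  show "full_diagrams n \<subseteq> diagrams n" by (auto simp: full_diagrams_def)
  show "id_diagram n \<in> full_diagrams n" by (rule id_full)
  show "concat_diagrams n X Y \<in> full_diagrams n \<longleftrightarrow> X \<in> full_diagrams n \<and> Y \<in> full_diagrams n"
    if "X \<in> diagrams n" "Y \<in> diagrams n" for X Y
    using that by (rule full_concat)
qed (simp_all add: isolated_middle_id)

lemma A_rook: "A = braided_rook_algebra K n \<epsilon>"
  by (simp add: A_def braided_rook_algebra_def)

text \<open>With \<open>p\<^sub>j\<close> the identity without strand \<open>j\<close>, right multiplication by \<open>1 - \<epsilon>\<^sup>-\<^sup>1 p\<^sub>j\<close> kills the diagrams that
  miss the right node \<open>j\<close> and preserves the span of those that miss any other given node. The product of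
  these elements over \<open>j \<in> S\<close> therefore kills every diagram missing a node in \<open>S\<close>.\<close>

lemma ex_annihilator:
  assumes "finite S" "S \<subseteq> {1..n}"
  shows "\<exists>\<eta>\<in>carrier A. restrict_face \<eta> = restrict_face \<one>\<^bsub>A\<^esub> \<and>
    (\<forall>X\<in>diagrams n. \<forall>c\<in>carrier K. \<not> S \<subseteq> right_nodes X \<longrightarrow> single K X c \<otimes>\<^bsub>A\<^esub> \<eta> = \<zero>\<^bsub>A\<^esub>)"
  using assms
proof (induction S rule: finite_induct)
  case empty
  interpret R: ring A by (rule ring_A)
  \<comment> \<open>No diagram misses a node of the empty set, so \<open>\<one>\<close> serves as
    the empty product.\<close>
  show ?case by (intro bexI[of _ "\<one>\<^bsub>A\<^esub>"]) auto
next
  case (insert j S)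
  interpret R: ring A by (rule ring_A)
  let ?B = "group_algebra K (rook_monoid n\<lparr>carrier := full_diagrams n\<rparr>)"
  note hom = restrict_face_hom[unfolded face_A]
  interpret B: ring ?B by (rule ring_surjection.axioms(2)[OF restrict_face_surjection[unfolded face_A]])
  note \<pi>_mult = ring_hom_mult[OF hom]
  have \<pi>: "restrict_face \<in> additive_maps A ?B"
    using hom by (auto simp: ring_hom_def additive_maps_def)
  obtain \<eta> where \<eta>: "\<eta> \<in> carrier A" "restrict_face \<eta> = restrict_face \<one>\<^bsub>A\<^esub>"
    and kill: "\<And>X c. \<lbrakk>X \<in> diagrams n; c \<in> carrier K; \<not> S \<subseteq> right_nodes X\<rbrakk> \<Longrightarrow> single K X c \<otimes>\<^bsub>A\<^esub> \<eta> = \<zero>\<^bsub>A\<^esub>"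
    using insert by auto
  have j: "j \<in> {1..n}" using insert by auto
  let ?e = "inv\<^bsub>K\<^esub> \<epsilon>" and ?E = "delete_strand n j"
  have e: "?e \<in> carrier K" "?e \<otimes>\<^bsub>K\<^esub> \<epsilon> = \<one>\<^bsub>K\<^esub>" using unit by simp_all
  note E = delete_strand[OF j]
  define p where "p = single K ?E ?e"
  have p: "p \<in> carrier A" unfolding p_def using E e by (intro single_A) (simp_all add: rook_monoid_simps)
  have \<pi>p: "restrict_face p = \<zero>\<^bsub>?B\<^esub>"
    unfolding p_def restrict_face_single using E(2)
    by (simp add: group_algebra_def twisted_monoid_algebra_def)
  define q where "q = \<one>\<^bsub>A\<^esub> \<ominus>\<^bsub>A\<^esub> p"
  have q: "q \<in> carrier A" unfolding q_def using p by simp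
  have \<pi>q: "restrict_face q = restrict_face \<one>\<^bsub>A\<^esub>"
  proof -
    have "restrict_face q = restrict_face \<one>\<^bsub>A\<^esub> \<ominus>\<^bsub>?B\<^esub> restrict_face p"
      unfolding q_def by (rule additive_minus[OF \<pi> R.is_abelian_group B.is_abelian_group R.one_closed p])
    then show ?thesis
      unfolding \<pi>p using additive_closed[OF \<pi> R.one_closed] by (simp add: a_minus_def)
  qed
  show ?case
  proof (intro bexI conjI ballI impI)
    \<comment> \<open>The new factor stands to the left of \<open>\<eta>\<close>, so that it meets
      \<open>X\<close> first: \<open>X q\<close> is either zero or a combination of diagrams that
      still miss a node of \<open>S\<close>.\<close>
    show "q \<otimes>\<^bsub>A\<^esub> \<eta> \<in> carrier A" using q \<eta>(1) by simp
    show "restrict_face (q \<otimes>\<^bsub>A\<^esub> \<eta>) = restrict_face \<one>\<^bsub>A\<^esub>"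
      using \<pi>_mult[OF q \<eta>(1)] \<pi>_mult[OF R.one_closed R.one_closed] \<pi>q \<eta>(2) by simp
    fix X c assume X: "X \<in> diagrams n" and c: "c \<in> carrier K" and miss: "\<not> insert j S \<subseteq> right_nodes X"
    let ?x = "single K X c"
    have x: "?x \<in> carrier A" using X c by (intro single_A) (simp_all add: rook_monoid_simps)
    let ?XE = "concat_diagrams n X ?E" and ?d = "wt X ?E \<otimes>\<^bsub>K\<^esub> (c \<otimes>\<^bsub>K\<^esub> ?e)"
    have XE: "?XE \<in> diagrams n"
      using D.m_closed X E(1) by (simp add: rook_monoid_simps)
    have d: "?d \<in> carrier K" using c e by simp
    have xp: "?x \<otimes>\<^bsub>A\<^esub> p = single K ?XE ?d"
      unfolding p_def using mult_single[of X ?E c ?e] X E(1) c e by (simp add: rook_monoid_simps)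
    have y: "single K ?XE ?d \<in> carrier A" using XE d by (intro single_A) (simp_all add: rook_monoid_simps)
    have xq: "?x \<otimes>\<^bsub>A\<^esub> q = ?x \<ominus>\<^bsub>A\<^esub> single K ?XE ?d"
      unfolding q_def a_minus_def using x p xp by (simp add: R.r_distr R.r_minus)
    show "?x \<otimes>\<^bsub>A\<^esub> (q \<otimes>\<^bsub>A\<^esub> \<eta>) = \<zero>\<^bsub>A\<^esub>"
    proof (cases "j \<in> right_nodes X")
      case True
      \<comment> \<open>The missing node then belongs to \<open>S\<close>. It is missing from
        \<open>X\<close> and from \<open>X p\<^sub>j\<close> alike, and \<open>\<eta>\<close> kills
        both.\<close>
      then have XS: "\<not> S \<subseteq> right_nodes X" using miss by blast
      then have "\<not> S \<subseteq> right_nodes ?XE" using concat_delete_strand(1)[OF X j] by blast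
      then have "?x \<otimes>\<^bsub>A\<^esub> \<eta> = \<zero>\<^bsub>A\<^esub>" "single K ?XE ?d \<otimes>\<^bsub>A\<^esub> \<eta> = \<zero>\<^bsub>A\<^esub>"
        using kill[OF X c XS] kill[OF XE d] by simp_all
      then have "(?x \<otimes>\<^bsub>A\<^esub> q) \<otimes>\<^bsub>A\<^esub> \<eta> = \<zero>\<^bsub>A\<^esub>"
        unfolding xq a_minus_def using x y \<eta>(1) by (simp add: R.l_distr R.l_minus)
      then show ?thesis using R.m_assoc[OF x q \<eta>(1)] by simp
    next
      case False
      \<comment> \<open>The single isolated node contributes one \<open>\<epsilon>\<close>, which
        cancels the coefficient of \<open>p\<close>; hence \<open>X p = X\<close> and
        \<open>X q = 0\<close>.\<close>
      have "?d = c \<otimes>\<^bsub>K\<^esub> (?e \<otimes>\<^bsub>K\<^esub> \<epsilon>)"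
        using concat_delete_strand(3)[OF X j False] c e(1) by (simp add: K.m_ac)
      then have "?d = c" using e(2) c by simp
      then have "?x \<otimes>\<^bsub>A\<^esub> q = \<zero>\<^bsub>A\<^esub>"
        unfolding xq concat_delete_strand(2)[OF X j False] using x by (simp add: a_minus_def R.r_neg)
      then show ?thesis using R.m_assoc[OF x q \<eta>(1)] \<eta>(1) by simp
    qed
  qed
qed

text \<open>The annihilator for the set of all nodes kills every diagram with a missing edge, as
  such a diagram lacks a right node too.\<close>

theorem Tor_rook:
  "graded_isomorphic K
    (Tor K (braided_rook_algebra K n \<epsilon>) (rook_trivial K n) (rook_trivial K n))
    (Tor K (group_algebra K (braid_group n))
      (group_trivial K (braid_group n)) (group_trivial K (braid_group n)))"
proof -
  obtain \<eta> where \<eta>: "\<eta> \<in> carrier A" "restrict_face \<eta> = restrict_face \<one>\<^bsub>A\<^esub>"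
    and kill: "\<And>X c. \<lbrakk>X \<in> diagrams n; c \<in> carrier K; \<not> {1..n} \<subseteq> right_nodes X\<rbrakk> \<Longrightarrow> single K X c \<otimes>\<^bsub>A\<^esub> \<eta> = \<zero>\<^bsub>A\<^esub>"
    using ex_annihilator[of "{1..n}"] by auto
  have "single K X c \<otimes>\<^bsub>A\<^esub> \<eta> = \<zero>\<^bsub>A\<^esub>"
    if "X \<in> carrier (rook_monoid n) - full_diagrams n" "c \<in> carrier K" for X c
  proof (rule kill)
    show X: "X \<in> diagrams n" using that by (simp add: rook_monoid_simps)
    obtain f where f: "partial_braid n f" "X = cls n f" using X unfolding diagrams_iff by blast
    have "right_nodes X \<subseteq> {1..n}" unfolding f(2) right_nodes_cls[OF f(1)] by (rule ends_range[OF f(1)])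
    then show "\<not> {1..n} \<subseteq> right_nodes X" using that full_iff_right[OF X] by blast
  qed (rule that)
  from Tor_face[OF \<eta>(1) _ this] \<eta>(2) ring_hom_one[OF restrict_face_hom]
  have "graded_isomorphic K (Tor K A (trivial_module K (full_diagrams n)) (trivial_module K (full_diagrams n)))
    (Tor K (group_algebra K (rook_monoid n\<lparr>carrier := full_diagrams n\<rparr>))
      (trivial_module K (full_diagrams n)) (trivial_module K (full_diagrams n)))" by (simp add: face_A)
  moreover have B: "braid_group n = rook_monoid n\<lparr>carrier := full_diagrams n\<rparr>"
    by (simp only: braid_group_def full_diagrams_def)
  moreover have "group_trivial K (braid_group n) = trivial_module K (full_diagrams n)"
    unfolding group_trivial_def B by simp
  moreover have "rook_trivial K n = trivial_module K (full_diagrams n)"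
    by (simp only: rook_trivial_def full_diagrams_def)
  ultimately show ?thesis by (simp only: A_rook)
qed

end

theorem theorem7p4:
  fixes K :: "('k, 'r) ring_scheme" and n :: nat and \<epsilon> :: 'k
  assumes "cring K" and "\<epsilon> \<in> Units K"
  shows "graded_isomorphic K
           (Tor K (braided_rook_algebra K n \<epsilon>) (rook_trivial K n) (rook_trivial K n))
           (Tor K (group_algebra K (braid_group n))
              (group_trivial K (braid_group n)) (group_trivial K (braid_group n)))
       \<and> graded_isomorphic K
           (Tor K (group_algebra K (braid_group n))
              (group_trivial K (braid_group n)) (group_trivial K (braid_group n)))
           (group_homology K (braid_group n))"
proof
  interpret rook_algebra K n \<epsilon>
    using assms by (intro rook_algebra.intro rook_algebra_axioms.intro)
  show "graded_isomorphic K
           (Tor K (braided_rook_algebra K n \<epsilon>) (rook_trivial K n) (rook_trivial K n))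
           (Tor K (group_algebra K (braid_group n))
              (group_trivial K (braid_group n)) (group_trivial K (braid_group n)))"
    by (rule Tor_rook)
  \<comment> \<open>The bar resolution is built for monoids, and the braids form one as the face of
    full diagrams.\<close>
  have "monoid (braid_group n)"
    using monoid_face by (simp add: braid_group_def full_diagrams_def)
  then have "bar_resolution K (braid_group n)"
    using assms by (intro bar_resolution.intro)
  then show "graded_isomorphic K
           (Tor K (group_algebra K (braid_group n))
              (group_trivial K (braid_group n)) (group_trivial K (braid_group n)))
           (group_homology K (braid_group n))"
    by (rule bar_resolution.Tor_group_homology)
qed

end
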